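(* Let $(E,\|\cdot\|)$ be a random normed module over $K$ with base $(\Omega,\mathcal{F},P)$ having full support, and let $E(1)=\{x\in E:\|x\|\le1\}$. If $E(1)$ is $\sigma_{c}(E,E^{*})$-compact, then $(E,\|\cdot\|)$ is random reflexive and $\mathcal{F}$ is essentially purely $P$-atomic. But the converse is not true: there exist a probability space $(\Omega,\mathcal F,P)$ with $\mathcal F$ essentially purely $P$-atomic and a random reflexive random normed module $(E,\|\cdot\|)$ with base $(\Omega,\mathcal F,P)$ and full support such that $E(1)$ is not $\sigma_c(E,E^* )$-compact.
   Context: $(\Omega,\mathcal{F},P)$ is a probability space, $K=\mathbb{R}$ or $\mathbb{C}$, and $L^{0}(\mathcal{F},K)$ is the algebra of equivalence classes (under a.s. equality) of $K$-valued $\mathcal{F}$-measurable functions; $L^0(\mathcal F,\bar{\mathbb R})$ (extended real-valued functions) is a complete lattice under a.s. pointwise order, with $\vee,\wedge$ supremum and infimum. $L^0_+=\{\xi\in L^0(\mathcal F,\mathbb R):\xi\ge 0\}$; $L^0_{++}$ is the set of $\xi\in L^0_+$ with $\xi>0$ a.s. on $\Omega$. A random normed module over $K$ with base $(\Omega,\mathcal F,P)$ is a left $L^0(\mathcal F,K)$-module $E$ with an $L^0$-norm $\|\cdot\|:E\to L^0_+$, i.e. $\|\xi x\|=|\xi|\|x\|$, $\|x+y\|\le\|x\|+\|y\|$, and $\|x\|=0$ iff $x=\theta$. Its random conjugate space $E^*$ is the $L^0(\mathcal F,K)$-module of module homomorphisms $f:E\to L^0(\mathcal F,K)$ for which there is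 $\xi\in L^0_+$ with $|f(x)|\le\xi\|x\|$ for all $x\in E$ (equivalently, the continuous ones, for either the $(\varepsilon,\lambda)$- or the locally $L^0$-convex topology), with $\|f\|^*=\wedge\{\xi\in L^0_+:|f(x)|\le\xi\|x\|\ \forall x\in E\}$; $(E^*,\|\cdot\|^* )$ is again a random normed module, $E^{**}=(E^* )^*$, and $E$ is random reflexive if the canonical embedding $J:E\to E^{**}$, $(Jx)(f)=f(x)$, is surjective. $E$ has full support if a representative $\xi^0$ of $\xi=\vee\{\|x\|:x\in E\}$ satisfies $\xi^0(\omega)>0$ for almost all $\omega\in\Omega$. $\sigma_c(E,E^* )$ is the topology on $E$ in which $G\subset E$ is open iff for every $x\in G$ there are finitely many $f_1,\dots,f_k\in E^*$ and $\varepsilon\in L^0_{++}$ such that $\{y\in E:|f_i(y)-f_i(x)|\le\varepsilon,\ i=1,\dots,k\}\subset G$. $A\in\mathcal F$ is a $P$-atom if $P(A)>0$ and every $B\in\mathcal F$ with $B\subset A$ satisfies $P(B)=0$ or $P(A\setminus B)=0$. $\mathcal F$ (or $(\Omega,\mathcal F,P)$) is essentially purely $P$-atomic if there is a (finite or infinite) sequence $\{A_n\}$ of disjoint $P$-atoms with $\bigcup_nA_n=\Omega$ such that $\mathcal F$ is contained in the $P$-completion of the $\sigma$-algebra generated by $\{A_n\}$. *)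

theory Defs
  imports "HOL-Probability.Probability" "HOL-Algebra.Module"
begin

definition L0_rel :: "'w measure \<Rightarrow> (('w \<Rightarrow> 'a::topological_space) \<times> ('w \<Rightarrow> 'a)) set" where
  "L0_rel M = {(f, g). f \<in> borel_measurable M \<and> g \<in> borel_measurable M \<and> (AE \<omega> in M. f \<omega> = g \<omega>)}"

definition L0_set :: "'w measure \<Rightarrow> ('w \<Rightarrow> 'a::topological_space) set set" where
  "L0_set M = borel_measurable M // L0_rel M"

definition L0_class :: "'w measure \<Rightarrow> ('w \<Rightarrow> 'a::topological_space) \<Rightarrow> ('w \<Rightarrow> 'a) set" where
  "L0_class M f = L0_rel M `` {f}"

definition L0_rep :: "('w \<Rightarrow> 'a) set \<Rightarrow> 'w \<Rightarrow> 'a" where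
  "L0_rep x = (SOME f. f \<in> x)"

definition L0_map :: "'w measure \<Rightarrow> ('a \<Rightarrow> 'b::topological_space) \<Rightarrow> ('w \<Rightarrow> 'a) set \<Rightarrow> ('w \<Rightarrow> 'b) set" where
  "L0_map M h x = L0_class M (\<lambda>\<omega>. h (L0_rep x \<omega>))"

definition L0 :: "'w measure \<Rightarrow> ('w \<Rightarrow> 'k::real_normed_field) set ring" where
  "L0 M = \<lparr>carrier = L0_set M,
           mult = (\<lambda>x y. L0_class M (\<lambda>\<omega>. L0_rep x \<omega> * L0_rep y \<omega>)),
           one = L0_class M (\<lambda>_. 1),
           zero = L0_class M (\<lambda>_. 0),
           add = (\<lambda>x y. L0_class M (\<lambda>\<omega>. L0_rep x \<omega> + L0_rep y \<omega>))\<rparr>"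

abbreviation L0_abs :: "'w measure \<Rightarrow> ('w \<Rightarrow> 'k::real_normed_field) set \<Rightarrow> ('w \<Rightarrow> real) set" where
  "L0_abs M \<equiv> L0_map M norm"

definition L0_order :: "'w measure \<Rightarrow> ('w \<Rightarrow> 'a::{order, topological_space}) set gorder" where
  "L0_order M = \<lparr>carrier = L0_set M, eq = (=),
                 le = (\<lambda>x y. AE \<omega> in M. L0_rep x \<omega> \<le> L0_rep y \<omega>)\<rparr>"

abbreviation L0_le :: "'w measure \<Rightarrow> ('w \<Rightarrow> real) set \<Rightarrow> ('w \<Rightarrow> real) set \<Rightarrow> bool" where
  "L0_le M x y \<equiv> x \<sqsubseteq>\<^bsub>L0_order M\<^esub> y"

definition L0_nonneg :: "'w measure \<Rightarrow> ('w \<Rightarrow> real) set set" where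
  "L0_nonneg M = {\<xi> \<in> carrier (L0 M). L0_le M \<zero>\<^bsub>L0 M\<^esub> \<xi>}"

definition L0_pos :: "'w measure \<Rightarrow> ('w \<Rightarrow> real) set set" where
  "L0_pos M = {\<xi> \<in> L0_nonneg M. AE \<omega> in M. 0 < L0_rep \<xi> \<omega>}"

record ('w, 'k, 'e) rn_module = "(('w \<Rightarrow> 'k) set, 'e) module" +
  rnorm :: "'e \<Rightarrow> ('w \<Rightarrow> real) set"

locale random_normed_module =
  prob_space M + Module.module "L0 M" E
  for M :: "'w measure" and E :: "('w, 'k::real_normed_field, 'e) rn_module" +
  assumes rnorm_closed: "x \<in> carrier E \<Longrightarrow> rnorm E x \<in> L0_nonneg M"
    and rnorm_smult: "\<lbrakk>\<xi> \<in> carrier (L0 M); x \<in> carrier E\<rbrakk> \<Longrightarrow>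
      rnorm E (\<xi> \<odot>\<^bsub>E\<^esub> x) = L0_abs M \<xi> \<otimes>\<^bsub>L0 M\<^esub> rnorm E x"
    and rnorm_triangle: "\<lbrakk>x \<in> carrier E; y \<in> carrier E\<rbrakk> \<Longrightarrow>
      L0_le M (rnorm E (x \<oplus>\<^bsub>E\<^esub> y)) (rnorm E x \<oplus>\<^bsub>L0 M\<^esub> rnorm E y)"
    and rnorm_eq_zero_iff: "x \<in> carrier E \<Longrightarrow> rnorm E x = \<zero>\<^bsub>L0 M\<^esub> \<longleftrightarrow> x = \<zero>\<^bsub>E\<^esub>"

definition unit_ball :: "'w measure \<Rightarrow> ('w, 'k::real_normed_field, 'e) rn_module \<Rightarrow> 'e set" where
  "unit_ball M E = {x \<in> carrier E. L0_le M (rnorm E x) \<one>\<^bsub>L0 M\<^esub>}"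

text \<open>The supremum is taken among extended real-valued functions: for a module of full support it
  is in fact infinite almost everywhere.\<close>

definition full_support :: "'w measure \<Rightarrow> ('w, 'k::real_normed_field, 'e) rn_module \<Rightarrow> bool" where
  "full_support M E \<longleftrightarrow>
    (AE \<omega> in M. 0 < L0_rep (\<Squnion>\<^bsub>L0_order M\<^esub> ((\<lambda>x. L0_map M ereal (rnorm E x)) ` carrier E)) \<omega>)"

definition dominating_set ::
  "'w measure \<Rightarrow> ('w, 'k::real_normed_field, 'e) rn_module \<Rightarrow> ('e \<Rightarrow> ('w \<Rightarrow> 'k) set) \<Rightarrow> ('w \<Rightarrow> real) set set" where
  "dominating_set M E f =
    {\<xi> \<in> L0_nonneg M. \<forall>x\<in>carrier E. L0_le M (L0_abs M (f x)) (\<xi> \<otimes>\<^bsub>L0 M\<^esub> rnorm E x)}"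

text \<open>Functionals are extensional, so that each of them is represented by exactly one HOL function.
  The fields \<open>mult\<close> and \<open>one\<close> are not part of a module structure. The dominating set of an element
  of the conjugate space is nonempty and bounded below by 0, so its infimum is the same in the
  lattice of real-valued as in that of extended real-valued functions.\<close>

definition random_conjugate ::
  "'w measure \<Rightarrow> ('w, 'k::real_normed_field, 'e) rn_module \<Rightarrow> ('w, 'k, 'e \<Rightarrow> ('w \<Rightarrow> 'k) set) rn_module" where
  "random_conjugate M E =
    \<lparr>carrier = {f \<in> carrier E \<rightarrow>\<^sub>E carrier (L0 M).
       (\<forall>x\<in>carrier E. \<forall>y\<in>carrier E. f (x \<oplus>\<^bsub>E\<^esub> y) = f x \<oplus>\<^bsub>L0 M\<^esub> f y) \<and>
       (\<forall>\<xi>\<in>carrier (L0 M). \<forall>x\<in>carrier E. f (\<xi> \<odot>\<^bsub>E\<^esub> x) = \<xi> \<otimes>\<^bsub>L0 M\<^esub> f x) \<and>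
       dominating_set M E f \<noteq> {}},
     mult = undefined,
     one = undefined,
     zero = (\<lambda>x\<in>carrier E. \<zero>\<^bsub>L0 M\<^esub>),
     add = (\<lambda>f g. \<lambda>x\<in>carrier E. f x \<oplus>\<^bsub>L0 M\<^esub> g x),
     smult = (\<lambda>\<xi> f. \<lambda>x\<in>carrier E. \<xi> \<otimes>\<^bsub>L0 M\<^esub> f x),
     rnorm = (\<lambda>f. \<Sqinter>\<^bsub>L0_order M\<^esub> (dominating_set M E f))\<rparr>"

definition canonical_embedding ::
  "'w measure \<Rightarrow> ('w, 'k::real_normed_field, 'e) rn_module \<Rightarrow> 'e \<Rightarrow> ('e \<Rightarrow> ('w \<Rightarrow> 'k) set) \<Rightarrow> ('w \<Rightarrow> 'k) set" where
  "canonical_embedding M E x = (\<lambda>f\<in>carrier (random_conjugate M E). f x)"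

definition random_reflexive :: "'w measure \<Rightarrow> ('w, 'k::real_normed_field, 'e) rn_module \<Rightarrow> bool" where
  "random_reflexive M E \<longleftrightarrow>
    canonical_embedding M E ` carrier E = carrier (random_conjugate M (random_conjugate M E))"

definition sigma_c_open :: "'w measure \<Rightarrow> ('w, 'k::real_normed_field, 'e) rn_module \<Rightarrow> 'e set \<Rightarrow> bool" where
  "sigma_c_open M E G \<longleftrightarrow> G \<subseteq> carrier E \<and>
    (\<forall>x\<in>G. \<exists>F \<epsilon>. finite F \<and> F \<subseteq> carrier (random_conjugate M E) \<and> \<epsilon> \<in> L0_pos M \<and>
      {y \<in> carrier E. \<forall>f\<in>F. L0_le M (L0_abs M (f y \<ominus>\<^bsub>L0 M\<^esub> f x)) \<epsilon>} \<subseteq> G)"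

definition sigma_c :: "'w measure \<Rightarrow> ('w, 'k::real_normed_field, 'e) rn_module \<Rightarrow> 'e topology" where
  "sigma_c M E = topology (sigma_c_open M E)"

definition P_atom :: "'w measure \<Rightarrow> 'w set \<Rightarrow> bool" where
  "P_atom M A \<longleftrightarrow> A \<in> sets M \<and> measure M A > 0 \<and>
    (\<forall>B\<in>sets M. B \<subseteq> A \<longrightarrow> measure M B = 0 \<or> measure M (A - B) = 0)"

text \<open>The \<open>P\<close>-completion of a sub-\<open>\<sigma>\<close>-algebra adjoins all \<open>P\<close>-negligible sets, i.e. all subsets of
  null sets of the whole probability space, not just those of null sets of the sub-\<open>\<sigma>\<close>-algebra.
  (A \<open>\<sigma>\<close>-algebra generated by a partition into atoms has no nonempty null sets at all.)\<close>

definition P_completion :: "'w measure \<Rightarrow> 'w set set \<Rightarrow> 'w set set" where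
  "P_completion M \<G> = {B. B \<subseteq> space M \<and> (\<exists>G\<in>\<G>. \<exists>N\<in>null_sets M. (B - G) \<union> (G - B) \<subseteq> N)}"

text \<open>A finite or infinite sequence of disjoint atoms is the same as a countable disjoint family.\<close>

definition essentially_purely_atomic :: "'w measure \<Rightarrow> bool" where
  "essentially_purely_atomic M \<longleftrightarrow>
    (\<exists>\<A>. countable \<A> \<and> disjoint \<A> \<and> (\<forall>A\<in>\<A>. P_atom M A) \<and> \<Union>\<A> = space M \<and>
         sets M \<subseteq> P_completion M (sigma_sets (space M) \<A>))"

lemma equiv_L0_rel: "equiv (borel_measurable M) (L0_rel M)"
  by (intro equivI refl_onI symI transI) (auto simp: L0_rel_def)

lemma L0_class_in [simp]: "f \<in> borel_measurable M \<Longrightarrow> L0_class M f \<in> L0_set M"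
  unfolding L0_set_def L0_class_def by (rule quotientI)

lemma L0_rep_in: "x \<in> L0_set M \<Longrightarrow> L0_rep x \<in> x"
  unfolding L0_rep_def L0_set_def
  using in_quotient_imp_non_empty[OF equiv_L0_rel, of x M] by (simp add: some_in_eq)

lemma L0_rep_measurable [measurable]: "x \<in> L0_set M \<Longrightarrow> L0_rep x \<in> borel_measurable M"
  using L0_rep_in[of x M] in_quotient_imp_subset[OF equiv_L0_rel] unfolding L0_set_def by blast

lemma L0_class_rep:
  assumes "x \<in> L0_set M"
  shows "L0_class M (L0_rep x) = x"
proof -
  from assms obtain f where x: "x = L0_rel M `` {f}"
    unfolding L0_set_def by (rule quotientE)
  then have "(f, L0_rep x) \<in> L0_rel M" using L0_rep_in[OF assms] by simp
  then have "L0_rel M `` {f} = L0_rel M `` {L0_rep x}"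
    by (rule equiv_class_eq[OF equiv_L0_rel])
  then show ?thesis
    unfolding L0_class_def by (rule trans[OF sym x[symmetric]])
qed

lemma L0_class_eq_iff:
  assumes "f \<in> borel_measurable M" "g \<in> borel_measurable M"
  shows "L0_class M f = L0_class M g \<longleftrightarrow> (AE \<omega> in M. f \<omega> = g \<omega>)"
  unfolding L0_class_def using eq_equiv_class_iff[OF equiv_L0_rel assms] assms
  by (auto simp: L0_rel_def)

lemma L0_rep_class:
  assumes "f \<in> borel_measurable M"
  shows "AE \<omega> in M. L0_rep (L0_class M f) \<omega> = f \<omega>"
proof -
  note f = L0_class_in[OF assms]
  show ?thesis
    using L0_class_eq_iff[OF L0_rep_measurable[OF f] assms] L0_class_rep[OF f] by simp
qed

lemma L0_eqI:
  assumes "x \<in> L0_set M" "y \<in> L0_set M" "AE \<omega> in M. L0_rep x \<omega> = L0_rep y \<omega>"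
  shows "x = y"
  using L0_class_eq_iff[OF L0_rep_measurable[OF assms(1)] L0_rep_measurable[OF assms(2)]] assms
  by (simp add: L0_class_rep)

lemma cring_L0: "cring (L0 M :: ('w \<Rightarrow> 'k::{real_normed_field, second_countable_topology}) set ring)"
proof -
  let ?L = "L0_set M :: ('w \<Rightarrow> 'k) set set"
  let ?add = "\<lambda>x y. L0_class M (\<lambda>\<omega>. L0_rep x \<omega> + L0_rep y \<omega>)"
  let ?mul = "\<lambda>x y. L0_class M (\<lambda>\<omega>. L0_rep x \<omega> * L0_rep y \<omega>)"
  have add: "?add x y \<in> ?L" "AE \<omega> in M. L0_rep (?add x y) \<omega> = L0_rep x \<omega> + L0_rep y \<omega>"
    if "x \<in> ?L" "y \<in> ?L" for x y
    using borel_measurable_add[OF L0_rep_measurable[OF that(1)] L0_rep_measurable[OF that(2)]]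
    by (rule L0_class_in L0_rep_class)+
  have mul: "?mul x y \<in> ?L" "AE \<omega> in M. L0_rep (?mul x y) \<omega> = L0_rep x \<omega> * L0_rep y \<omega>"
    if "x \<in> ?L" "y \<in> ?L" for x y
    using borel_measurable_times[OF L0_rep_measurable[OF that(1)] L0_rep_measurable[OF that(2)]]
    by (rule L0_class_in L0_rep_class)+
  have cst: "L0_class M (\<lambda>_. c) \<in> ?L" "AE \<omega> in M. L0_rep (L0_class M (\<lambda>_. c)) \<omega> = c" for c :: 'k
    using borel_measurable_const by (rule L0_class_in L0_rep_class)+
  show ?thesis
  proof (rule cringI)
    show "abelian_group (L0 M :: ('w \<Rightarrow> 'k) set ring)"
    proof (rule abelian_groupI; simp add: L0_def add(1) cst(1))
      fix x y z assume x: "x \<in> ?L" and y: "y \<in> ?L" and z: "z \<in> ?L"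
      show "?add (?add x y) z = ?add x (?add y z)"
        apply (rule L0_eqI[where M = M])
          apply (simp_all add: add(1) x y z)
        using add(2)[OF add(1)[OF x y] z] add(2)[OF x y] add(2)[OF y z] add(2)[OF x add(1)[OF y z]]
        by eventually_elim (simp add: add.assoc)
    next
      fix x y assume "x \<in> ?L" "y \<in> ?L"
      show "?add x y = ?add y x" by (simp add: add.commute)
    next
      fix x assume x: "x \<in> ?L"
      show "?add (L0_class M (\<lambda>_. 0)) x = x"
        apply (rule L0_eqI[OF add(1)[OF cst(1) x] x])
        using add(2)[OF cst(1) x, of 0] cst(2)[of 0] by eventually_elim simp
    next
      fix x assume x: "x \<in> ?L"
      let ?n = "L0_class M (\<lambda>\<omega>. - L0_rep x \<omega>)"
      have n: "?n \<in> ?L" "AE \<omega> in M. L0_rep ?n \<omega> = - L0_rep x \<omega>"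
        using borel_measurable_uminus[OF L0_rep_measurable[OF x]]
        by (rule L0_class_in L0_rep_class)+
      have "?add ?n x = L0_class M (\<lambda>_. 0)"
        apply (rule L0_eqI[OF add(1)[OF n(1) x] cst(1)])
        using add(2)[OF n(1) x] cst(2)[of 0] n(2) by eventually_elim simp
      with n(1) show "\<exists>y\<in>?L. ?add y x = L0_class M (\<lambda>_. 0)" by blast
    qed
  next
    show "comm_monoid (L0 M :: ('w \<Rightarrow> 'k) set ring)"
    proof (rule comm_monoidI; simp add: L0_def mul(1) cst(1))
      fix x y z assume x: "x \<in> ?L" and y: "y \<in> ?L" and z: "z \<in> ?L"
      show "?mul (?mul x y) z = ?mul x (?mul y z)"
        apply (rule L0_eqI[where M = M])
          apply (simp_all add: mul(1) x y z)
        using mul(2)[OF mul(1)[OF x y] z] mul(2)[OF x y] mul(2)[OF y z] mul(2)[OF x mul(1)[OF y z]]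
        by eventually_elim (simp add: mult.assoc)
    next
      fix x y assume "x \<in> ?L" "y \<in> ?L"
      show "?mul x y = ?mul y x" by (simp add: mult.commute)
    next
      fix x assume x: "x \<in> ?L"
      show "?mul (L0_class M (\<lambda>_. 1)) x = x"
        apply (rule L0_eqI[OF mul(1)[OF cst(1) x] x])
        using mul(2)[OF cst(1) x, of 1] cst(2)[of 1] by eventually_elim simp
    qed
  next
    fix x y z
    assume "x \<in> carrier (L0 M :: ('w \<Rightarrow> 'k) set ring)" "y \<in> carrier (L0 M :: ('w \<Rightarrow> 'k) set ring)"
      "z \<in> carrier (L0 M :: ('w \<Rightarrow> 'k) set ring)"
    then have x: "x \<in> ?L" and y: "y \<in> ?L" and z: "z \<in> ?L" by (simp_all add: L0_def)
    have "?mul (?add x y) z = ?add (?mul x z) (?mul y z)"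
      apply (rule L0_eqI[where M = M])
        apply (simp_all add: add(1) mul(1) x y z)
      using add(2)[OF x y] mul(2)[OF add(1)[OF x y] z] mul(2)[OF x z] mul(2)[OF y z]
        add(2)[OF mul(1)[OF x z] mul(1)[OF y z]]
      by eventually_elim (simp add: distrib_right)
    then show "(x \<oplus>\<^bsub>L0 M\<^esub> y) \<otimes>\<^bsub>L0 M\<^esub> z = x \<otimes>\<^bsub>L0 M\<^esub> z \<oplus>\<^bsub>L0 M\<^esub> y \<otimes>\<^bsub>L0 M\<^esub> z"
      by (simp add: L0_def)
  qed
qed

lemma L0_pos_lower_bound:
  assumes "\<epsilon> \<in> L0_pos M" "\<delta> \<in> L0_pos M"
  shows "\<exists>\<eta>\<in>L0_pos M. L0_le M \<eta> \<epsilon> \<and> L0_le M \<eta> \<delta>"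
proof
  let ?\<eta> = "L0_class M (\<lambda>\<omega>. min (L0_rep \<epsilon> \<omega>) (L0_rep \<delta> \<omega>))"
  have [simp]: "\<epsilon> \<in> L0_set M" "\<delta> \<in> L0_set M"
    and pos: "AE \<omega> in M. 0 < L0_rep \<epsilon> \<omega>" "AE \<omega> in M. 0 < L0_rep \<delta> \<omega>"
    using assms by (auto simp: L0_pos_def L0_nonneg_def L0_def)
  have rep: "AE \<omega> in M. L0_rep ?\<eta> \<omega> = min (L0_rep \<epsilon> \<omega>) (L0_rep \<delta> \<omega>)"
    by (intro L0_rep_class) measurable
  have zero: "AE \<omega> in M. L0_rep (L0_class M (\<lambda>_. 0::real)) \<omega> = 0"
    by (intro L0_rep_class) measurable
  have "AE \<omega> in M. L0_rep (L0_class M (\<lambda>_. 0)) \<omega> \<le> L0_rep ?\<eta> \<omega>"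
    using rep zero pos by eventually_elim simp
  moreover have "AE \<omega> in M. 0 < L0_rep ?\<eta> \<omega>"
    using rep pos by eventually_elim simp
  ultimately show "?\<eta> \<in> L0_pos M"
    by (simp add: L0_pos_def L0_nonneg_def L0_def L0_order_def)
  show "L0_le M ?\<eta> \<epsilon> \<and> L0_le M ?\<eta> \<delta>"
    using rep by (auto simp: L0_order_def)
qed

lemma L0_le_trans: "L0_le M x y \<Longrightarrow> L0_le M y z \<Longrightarrow> L0_le M x z"
  by (auto simp: L0_order_def)

lemma istopology_sigma_c: "istopology (sigma_c_open M E)"
  unfolding istopology_def
proof (intro conjI allI impI)
  fix S T assume S: "sigma_c_open M E S" and T: "sigma_c_open M E T"
  show "sigma_c_open M E (S \<inter> T)"
    unfolding sigma_c_open_def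
  proof (intro conjI ballI)
    show "S \<inter> T \<subseteq> carrier E" using S by (auto simp: sigma_c_open_def)
    fix x assume x: "x \<in> S \<inter> T"
    let ?U = "\<lambda>F \<epsilon>. {y \<in> carrier E. \<forall>f\<in>F. L0_le M (L0_abs M (f y \<ominus>\<^bsub>L0 M\<^esub> f x)) \<epsilon>}"
    from S x obtain F \<epsilon> where F: "finite F" "F \<subseteq> carrier (random_conjugate M E)"
      "\<epsilon> \<in> L0_pos M" "?U F \<epsilon> \<subseteq> S"
      unfolding sigma_c_open_def by blast
    from T x obtain F' \<epsilon>' where F': "finite F'" "F' \<subseteq> carrier (random_conjugate M E)"
      "\<epsilon>' \<in> L0_pos M" "?U F' \<epsilon>' \<subseteq> T"
      unfolding sigma_c_open_def by blast
    obtain \<eta> where \<eta>: "\<eta> \<in> L0_pos M" "L0_le M \<eta> \<epsilon>" "L0_le M \<eta> \<epsilon>'"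
      using L0_pos_lower_bound F(3) F'(3) by blast
    have "?U (F \<union> F') \<eta> \<subseteq> ?U F \<epsilon> \<inter> ?U F' \<epsilon>'"
      using L0_le_trans[OF _ \<eta>(2)] L0_le_trans[OF _ \<eta>(3)] by blast
    then have "?U (F \<union> F') \<eta> \<subseteq> S \<inter> T" using F(4) F'(4) by blast
    with F F' \<eta>(1) show "\<exists>F \<epsilon>. finite F \<and> F \<subseteq> carrier (random_conjugate M E) \<and> \<epsilon> \<in> L0_pos M \<and>
      ?U F \<epsilon> \<subseteq> S \<inter> T"
      by (intro exI[of _ "F \<union> F'"] exI[of _ \<eta>]) simp
  qed
next
  fix \<K> assume K: "\<forall>K\<in>\<K>. sigma_c_open M E K"
  show "sigma_c_open M E (\<Union>\<K>)"
    unfolding sigma_c_open_def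
  proof (intro conjI ballI)
    show "\<Union>\<K> \<subseteq> carrier E" using K by (auto simp: sigma_c_open_def)
    fix x assume "x \<in> \<Union>\<K>"
    then obtain G where G: "G \<in> \<K>" "x \<in> G" by blast
    with K have "sigma_c_open M E G" by blast
    with G(2) obtain F \<epsilon> where "finite F" "F \<subseteq> carrier (random_conjugate M E)" "\<epsilon> \<in> L0_pos M"
      "{y \<in> carrier E. \<forall>f\<in>F. L0_le M (L0_abs M (f y \<ominus>\<^bsub>L0 M\<^esub> f x)) \<epsilon>} \<subseteq> G"
      unfolding sigma_c_open_def by blast
    with G(1) show "\<exists>F \<epsilon>. finite F \<and> F \<subseteq> carrier (random_conjugate M E) \<and> \<epsilon> \<in> L0_pos M \<and>
      {y \<in> carrier E. \<forall>f\<in>F. L0_le M (L0_abs M (f y \<ominus>\<^bsub>L0 M\<^esub> f x)) \<epsilon>} \<subseteq> \<Union>\<K>"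
      by (intro exI[of _ F] exI[of _ \<epsilon>]) blast
  qed
qed

lemma openin_sigma_c: "openin (sigma_c M E) = sigma_c_open M E"
  unfolding sigma_c_def by (rule topology_inverse'[OF istopology_sigma_c])

end

theory Submission
  imports Defs
begin

text \<open>Compactness of \<open>E(1)\<close> is much stronger than the theorem suggests, because
  \<open>\<sigma>\<^sub>c\<close>-neighbourhoods are of box type. If there were infinitely many disjoint nonnull sets, full
  support would give \<open>x\<^sub>n \<in> E(1)\<close> whose norms are indicators of disjoint nonnull sets \<open>B\<^sub>n\<close>, and a
  random Hahn-Banach argument a single \<open>f \<in> E\<^sup>*\<close> with \<open>Re f(x\<^sub>n) = 1\<^bsub>B\<^sub>n\<^esub>\<close>. The \<open>x\<^sub>n\<close> would then form
  an infinite closed discrete subset of \<open>E(1)\<close>. So \<open>\<Omega>\<close> is a finite union of atoms, on each of which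
  \<open>L\<^sup>0\<close> is the scalar field, and reflexivity reduces to a Helly type approximation on each atom.
  The same fact shows that \<open>E = L\<^sup>0\<close> over an infinite atomic space has a noncompact ball, although it
  is random reflexive.\<close>

section \<open>Essential suprema and atoms\<close>

text \<open>Compactness enters three times. An open cover rules out infinitely many disjoint nonnull
  sets; a continuous real function attains its minimum on the ball, so that finitely many equations
  are solved exactly and not merely up to an error; the finite intersection property then treats all
  functionals at once. The obstacle in the random Hahn-Banach argument is that \<open>L0 M\<close>
  has zero divisors. In a one-step extension along x a coefficient t may vanish on part of the
  space, so t x may lie in the submodule although t is not zero, and the value at x cannot be chosen
  freely. Cones in the product of E and the measurable functions carry no such condition of
  well-definedness, and they are scaled only by multipliers that are positive everywhere, hence
  invertible. A radius in \<open>L0_pos M\<close> needs no positive lower bound. This is why one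
  functional already separates infinitely many points, and why infinitely many atoms destroy
  compactness: the radius may be chosen anew on each of them.\<close>

text \<open>Exhaustion: the supremum of the measures of countable unions is attained, because
  near-optimal families can be pooled into one countable family. A member adding positive measure to
  that union would exceed the supremum.\<close>

lemma (in finite_measure) countable_ess_union:
  assumes "\<A> \<subseteq> sets M"
  obtains \<C> where "\<C> \<subseteq> \<A>" "countable \<C>" "\<And>A. A \<in> \<A> \<Longrightarrow> A - \<Union>\<C> \<in> null_sets M"
proof -
  define K where "K = {\<C>. \<C> \<subseteq> \<A> \<and> countable \<C>}"
  have sets: "\<Union>\<C> \<in> sets M" if "\<C> \<in> K" for \<C>
    using that assms by (intro sets.countable_Union) (auto simp: K_def)
  have bdd: "bdd_above ((\<lambda>\<C>. measure M (\<Union>\<C>)) ` K)"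
    by (intro bdd_aboveI[of _ "measure M (space M)"]) (auto simp: bounded_measure)
  have "{} \<in> K" by (simp add: K_def)
  define s where "s = (SUP \<C>\<in>K. measure M (\<Union>\<C>))"
  have "\<exists>\<C>\<in>K. s - 1 / real (Suc n) < measure M (\<Union>\<C>)" for n
    using less_cSUP_iff[OF _ bdd, of "s - 1 / real (Suc n)"] \<open>{} \<in> K\<close>
    by (auto simp: s_def)
  then obtain \<D> where \<D>: "\<And>n. \<D> n \<in> K" "\<And>n. s - 1 / real (Suc n) < measure M (\<Union>(\<D> n))"
    by metis
  define \<C> where "\<C> = (\<Union>n. \<D> n)"
  have C: "\<C> \<in> K" using \<D>(1) by (auto simp: K_def \<C>_def)
  have "s \<le> measure M (\<Union>\<C>)"
  proof (rule LIMSEQ_le_const2)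
    show "(\<lambda>n. s - 1 / real (Suc n)) \<longlonglongrightarrow> s"
      using tendsto_diff[OF tendsto_const LIMSEQ_inverse_real_of_nat, of s] by (simp add: divide_inverse)
    have "s - 1 / real (Suc n) \<le> measure M (\<Union>\<C>)" for n
      using \<D>(2)[of n] finite_measure_mono[of "\<Union>(\<D> n)" "\<Union>\<C>"] sets[OF C]
      by (force simp: \<C>_def)
    then show "\<exists>N. \<forall>n\<ge>N. s - 1 / real (Suc n) \<le> measure M (\<Union>\<C>)" by blast
  qed
  show ?thesis
  proof (rule that)
    show "\<C> \<subseteq> \<A>" "countable \<C>" using C by (auto simp: K_def)
    fix A assume A: "A \<in> \<A>"
    then have A': "A \<in> sets M" "insert A \<C> \<in> K" using assms C by (auto simp: K_def)
    have "measure M (\<Union>(insert A \<C>)) \<le> s"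
      unfolding s_def by (rule cSUP_upper[OF A'(2) bdd])
    moreover have "measure M (\<Union>(insert A \<C>)) = measure M (\<Union>\<C>) + measure M (A - \<Union>\<C>)"
      using finite_measure_Union[of "\<Union>\<C>" "A - \<Union>\<C>"] A' sets[OF C]
      by (simp add: Un_commute Int_Diff)
    ultimately have "measure M (A - \<Union>\<C>) = 0"
      using \<open>s \<le> _\<close> measure_nonneg[of M "A - \<Union>\<C>"] by linarith
    then show "A - \<Union>\<C> \<in> null_sets M"
      using A' sets[OF C] by (auto simp: null_sets_def emeasure_eq_measure)
  qed
qed

text \<open>For each rational q, countably many members exhaust the superlevel sets at height q up
  to null sets. The functions chosen for all q together have the essential supremum as pointwise
  supremum, since a strict excess of some f would be visible at a rational height.\<close>

lemma (in finite_measure) ess_sup_ereal: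
  fixes S :: "('a \<Rightarrow> ereal) set"
  assumes S: "S \<subseteq> borel_measurable M"
  obtains s where "s \<in> borel_measurable M" "\<And>f. f \<in> S \<Longrightarrow> AE \<omega> in M. f \<omega> \<le> s \<omega>"
    "\<And>h. h \<in> borel_measurable M \<Longrightarrow> (\<And>f. f \<in> S \<Longrightarrow> AE \<omega> in M. f \<omega> \<le> h \<omega>) \<Longrightarrow> AE \<omega> in M. s \<omega> \<le> h \<omega>"
proof -
  define L where "L q f = {\<omega>\<in>space M. ereal (real_of_rat q) < f \<omega>}" for q f
  have L: "L q f \<in> sets M" if "f \<in> S" for q f
  proof -
    have [measurable]: "f \<in> borel_measurable M" using that S by auto
    show ?thesis unfolding L_def by measurable
  qed
  have "\<exists>C\<subseteq>S. countable C \<and> (\<forall>f\<in>S. L q f - (\<Union>g\<in>C. L q g) \<in> null_sets M)" for q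
  proof -
    obtain \<C> where \<C>: "\<C> \<subseteq> L q ` S" "countable \<C>" "\<And>A. A \<in> L q ` S \<Longrightarrow> A - \<Union>\<C> \<in> null_sets M"
      using countable_ess_union[of "L q ` S"] L by blast
    obtain C where "C \<subseteq> S" "countable C" "\<C> = L q ` C"
      using \<C>(1,2) by (meson countable_subset_image)
    then show ?thesis using \<C>(3) by blast
  qed
  then obtain C where C: "\<And>q. C q \<subseteq> S" "\<And>q. countable (C q)"
    "\<And>q f. f \<in> S \<Longrightarrow> L q f - (\<Union>g\<in>C q. L q g) \<in> null_sets M"
    by metis
  define D where "D = (\<Union>q. C q)"
  have D: "D \<subseteq> S" "countable D" using C(1,2) by (auto simp: D_def)
  define s where "s \<omega> = (SUP g\<in>D. g \<omega>)" for \<omega>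
  show ?thesis
  proof (rule that)
    show "s \<in> borel_measurable M"
      unfolding s_def using D S by (intro borel_measurable_SUP) auto
    fix f assume f: "f \<in> S"
    have "AE \<omega> in M. \<omega> \<notin> L q f - (\<Union>g\<in>C q. L q g)" for q
      using C(3)[OF f] by (rule AE_not_in)
    then have "AE \<omega> in M. \<forall>q. \<omega> \<notin> L q f - (\<Union>g\<in>C q. L q g)"
      by (simp add: AE_all_countable)
    then show "AE \<omega> in M. f \<omega> \<le> s \<omega>"
      using AE_space
    proof eventually_elim
      case (elim \<omega>)
      show ?case
      proof (rule ccontr)
        assume "\<not> f \<omega> \<le> s \<omega>"
        then obtain r where r: "s \<omega> < ereal r" "ereal r < f \<omega>" using ereal_dense2[of "s \<omega>" "f \<omega>"] by (meson not_le)
        \<comment> \<open>A second real above r: the endpoints may be infinite, and the rational is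
          chosen between two reals.\<close>
        obtain r' where "ereal r < ereal r'" "ereal r' < f \<omega>" using ereal_dense2[OF r(2)] by auto
        moreover obtain q where "r < real_of_rat q" "real_of_rat q < r'"
          using of_rat_dense[of r r'] calculation by auto
        ultimately have q: "s \<omega> < ereal (real_of_rat q)" "ereal (real_of_rat q) < f \<omega>"
          using r by (auto intro: less_trans[of "s \<omega>" "ereal r"] less_trans[of _ "ereal r'"])
        then obtain g where "g \<in> C q" "ereal (real_of_rat q) < g \<omega>"
          using elim by (auto simp: L_def)
        then have "ereal (real_of_rat q) < s \<omega>"
          unfolding s_def D_def by (auto intro!: less_SUP_iff[THEN iffD2])
        with q show False by simp
      qed
    qed
  next
    fix h assume h: "\<And>f. f \<in> S \<Longrightarrow> AE \<omega> in M. f \<omega> \<le> h \<omega>"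
    then have "AE \<omega> in M. \<forall>f\<in>D. f \<omega> \<le> h \<omega>"
      using D by (subst AE_ball_countable) auto
    then show "AE \<omega> in M. s \<omega> \<le> h \<omega>"
      by eventually_elim (simp add: s_def SUP_least)
  qed
qed

text \<open>Negation turns this into an essential supremum of extended real functions. The lower
  bound \<open>l\<close> and any one member of \<open>S\<close> make it finite almost everywhere, so
  passing back through \<open>real_of_ereal\<close> loses nothing.\<close>

lemma (in finite_measure) ess_inf_real:
  fixes S :: "('a \<Rightarrow> real) set"
  assumes S: "S \<subseteq> borel_measurable M" "S \<noteq> {}"
    and l: "l \<in> borel_measurable M" "\<And>f. f \<in> S \<Longrightarrow> AE \<omega> in M. l \<omega> \<le> f \<omega>"
  obtains s where "s \<in> borel_measurable M" "\<And>f. f \<in> S \<Longrightarrow> AE \<omega> in M. s \<omega> \<le> f \<omega>"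
    "\<And>h. h \<in> borel_measurable M \<Longrightarrow> (\<And>f. f \<in> S \<Longrightarrow> AE \<omega> in M. h \<omega> \<le> f \<omega>) \<Longrightarrow> AE \<omega> in M. h \<omega> \<le> s \<omega>"
proof -
  let ?T = "(\<lambda>f \<omega>. ereal (- f \<omega>)) ` S"
  obtain e :: "'a \<Rightarrow> ereal" where e: "e \<in> borel_measurable M" "\<And>f. f \<in> ?T \<Longrightarrow> AE \<omega> in M. f \<omega> \<le> e \<omega>"
    "\<And>h. h \<in> borel_measurable M \<Longrightarrow> (\<And>f. f \<in> ?T \<Longrightarrow> AE \<omega> in M. f \<omega> \<le> h \<omega>) \<Longrightarrow> AE \<omega> in M. e \<omega> \<le> h \<omega>"
  proof (rule ess_sup_ereal)
    show "?T \<subseteq> borel_measurable M" using S(1) by (auto intro!: borel_measurable_ereal borel_measurable_uminus)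
  qed (blast intro: that)
  obtain f0 where f0: "f0 \<in> S" using S by auto
  have le: "AE \<omega> in M. ereal (- f \<omega>) \<le> e \<omega>" if "f \<in> S" for f using e(2) that by blast
  have up: "AE \<omega> in M. e \<omega> \<le> ereal (- h \<omega>)"
    if "h \<in> borel_measurable M" "\<And>f. f \<in> S \<Longrightarrow> AE \<omega> in M. h \<omega> \<le> f \<omega>" for h
    using that by (intro e(3)) auto
  show ?thesis
  proof (rule that)
    show "(\<lambda>\<omega>. - real_of_ereal (e \<omega>)) \<in> borel_measurable M" using e(1) by measurable
    have "AE \<omega> in M. e \<omega> \<le> ereal (- l \<omega>)" by (rule up) (use l in auto)
    then have fin: "AE \<omega> in M. \<bar>e \<omega>\<bar> \<noteq> \<infinity>" using le[OF f0] by eventually_elim auto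
    show "AE \<omega> in M. - real_of_ereal (e \<omega>) \<le> f \<omega>" if "f \<in> S" for f
      using le[OF that] fin by eventually_elim (auto simp: ereal_le_real_iff)
    show "AE \<omega> in M. h \<omega> \<le> - real_of_ereal (e \<omega>)"
      if "h \<in> borel_measurable M" "\<And>f. f \<in> S \<Longrightarrow> AE \<omega> in M. h \<omega> \<le> f \<omega>" for h
    proof -
      have "AE \<omega> in M. e \<omega> \<le> ereal (- h \<omega>)" by (rule up) (use that in auto)
      then show ?thesis using fin by eventually_elim (auto simp: real_le_ereal_iff)
    qed
  qed
qed

section \<open>Atoms and finite atomic partitions\<close>

text \<open>Every preimage inside an atom is null or has null complement there. Discarding the
  countably many basic open sets with null preimage leaves at most one value, because two distinct
  values have disjoint neighbourhoods whose preimages would both be nonnull.\<close>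

lemma P_atom_AE_constant:
  fixes f :: "'w \<Rightarrow> 'a::{t2_space, second_countable_topology}"
  assumes "prob_space M" and A: "P_atom M A" and f: "f \<in> borel_measurable M"
  shows "\<exists>c. AE \<omega> in M. \<omega> \<in> A \<longrightarrow> f \<omega> = c"
proof -
  interpret prob_space M by fact
  have A': "A \<in> sets M" "measure M A > 0" using A by (auto simp: P_atom_def)
  obtain \<B> :: "'a set set" where \<B>: "countable \<B>" "topological_basis \<B>"
    using ex_countable_basis by blast
  let ?V = "\<lambda>b. {\<omega>\<in>A. f \<omega> \<in> b}"
  have V: "?V b \<in> sets M" if "b \<in> sets borel" for b
  proof -
    have "?V b = A \<inter> (f -` b \<inter> space M)" using A'(1) sets.sets_into_space by auto
    then show ?thesis using that f A'(1) by (metis measurable_sets sets.Int)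
  qed
  define U where "U = \<Union>{b\<in>\<B>. measure M (?V b) = 0}"
  have nullV: "?V b \<in> null_sets M" if "b \<in> sets borel" "measure M (?V b) = 0" for b
    using that V by (auto simp: null_sets_def emeasure_eq_measure)
  have Bb: "b \<in> sets borel" if "b \<in> \<B>" for b
    using that \<B>(2) by (simp add: topological_basis_open)
  have "AE \<omega> in M. \<forall>b\<in>{b\<in>\<B>. measure M (?V b) = 0}. \<omega> \<notin> ?V b"
    using \<B>(1) AE_not_in[OF nullV] Bb by (subst AE_ball_countable) auto
  then have ae: "AE \<omega> in M. \<omega> \<in> A \<longrightarrow> f \<omega> \<notin> U"
    by eventually_elim (auto simp: U_def)
  have uniq: "c = d" if "c \<notin> U" "d \<notin> U" for c d
  proof (rule ccontr)
    assume "c \<noteq> d"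
    then obtain G H where GH: "open G" "open H" "c \<in> G" "d \<in> H" "G \<inter> H = {}"
      using hausdorff[of c d] by blast
    obtain b where b: "b \<in> \<B>" "c \<in> b" "b \<subseteq> G" using topological_basisE[OF \<B>(2) GH(1,3)] by blast
    obtain e where e: "e \<in> \<B>" "d \<in> e" "e \<subseteq> H" using topological_basisE[OF \<B>(2) GH(2,4)] by blast
    have nz: "measure M (?V b) \<noteq> 0" "measure M (?V e) \<noteq> 0" using b e that by (auto simp: U_def)
    then have "measure M (A - ?V b) = 0"
      using A V[OF Bb[OF b(1)]] unfolding P_atom_def by auto
    moreover have "measure M (?V e) \<le> measure M (A - ?V b)"
      using A'(1) V[OF Bb[OF b(1)]] b e GH by (intro finite_measure_mono) auto
    ultimately show False using nz measure_nonneg[of M "?V e"] by linarith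
  qed
  show ?thesis
  proof (cases "\<exists>c. c \<notin> U")
    case True
    then obtain c where "c \<notin> U" by blast
    then show ?thesis using ae uniq by (intro exI[of _ c]) (auto elim!: eventually_mono)
  next
    \<comment> \<open>Here \<open>U\<close> is everything, so \<open>ae\<close> says that almost no
      point lies in \<open>A\<close>, and any constant will do.\<close>
    case False
    then show ?thesis using ae by auto
  qed
qed

lemma P_atom_not_AE:
  assumes "prob_space M" "P_atom M A" shows "\<not> (AE \<omega> in M. \<omega> \<notin> A)"
proof -
  interpret prob_space M by fact
  have "A \<in> sets M" "A \<notin> null_sets M" using assms(2) by (auto simp: P_atom_def null_sets_def emeasure_eq_measure)
  then show ?thesis by (simp add: AE_iff_null_sets)
qed

text \<open>A set that is not a finite union of atoms up to a null set is neither null nor an atom,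
  so it splits into two nonnull parts, one of which is again of this kind. Iterating from the whole
  space gives a decreasing sequence whose successive differences are disjoint and nonnull, against
  \<open>fin\<close>.\<close>

lemma finite_atomic_partition:
  assumes "prob_space M"
    and fin: "\<And>B :: nat \<Rightarrow> 'w set. disjoint_family B \<Longrightarrow> \<exists>n. B n \<notin> sets M \<or> measure M (B n) = 0"
  obtains \<A> where "finite \<A>" "disjoint \<A>" "\<And>A. A \<in> \<A> \<Longrightarrow> P_atom M A" "\<Union>\<A> = space M"
proof -
  interpret prob_space M by fact
  define good where "good X \<longleftrightarrow> (\<exists>\<A>. finite \<A> \<and> disjoint \<A> \<and> (\<forall>A\<in>\<A>. P_atom M A) \<and> \<Union>\<A> \<subseteq> X \<and>
    measure M (X - \<Union>\<A>) = 0)" for X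
  have good_Un: "good (X \<union> Y)" if "good X" "good Y" "X \<inter> Y = {}" "X \<in> sets M" "Y \<in> sets M" for X Y
  proof -
    obtain \<A> where a: "finite \<A>" "disjoint \<A>" "\<And>A. A\<in>\<A> \<Longrightarrow> P_atom M A" "\<Union>\<A> \<subseteq> X" "measure M (X - \<Union>\<A>) = 0"
      using \<open>good X\<close> unfolding good_def by blast
    obtain \<B> where b: "finite \<B>" "disjoint \<B>" "\<And>A. A\<in>\<B> \<Longrightarrow> P_atom M A" "\<Union>\<B> \<subseteq> Y" "measure M (Y - \<Union>\<B>) = 0"
      using \<open>good Y\<close> unfolding good_def by blast
    have s: "\<Union>\<A> \<in> sets M" "\<Union>\<B> \<in> sets M" using a b by (auto simp: P_atom_def intro!: sets.finite_Union)
    have "measure M (X \<union> Y - \<Union>(\<A> \<union> \<B>)) \<le> measure M (X - \<Union>\<A>) + measure M (Y - \<Union>\<B>)"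
      using s that by (intro order.trans[OF finite_measure_mono measure_Un_le]) auto
    then have "measure M (X \<union> Y - \<Union>(\<A> \<union> \<B>)) = 0" using a b measure_nonneg[of M "X \<union> Y - \<Union>(\<A> \<union> \<B>)"] by linarith
    moreover have "disjoint (\<A> \<union> \<B>)" using a b that by (intro disjoint_union) blast+
    ultimately show ?thesis unfolding good_def using a b by (intro exI[of _ "\<A> \<union> \<B>"]) auto
  qed
  have split: "\<exists>Y. Y \<in> sets M \<and> Y \<subseteq> X \<and> \<not> good Y \<and> measure M (X - Y) > 0"
    if X: "X \<in> sets M" "\<not> good X" for X
  proof -
    have "measure M X \<noteq> 0" using X unfolding good_def by (auto dest!: spec[of _ "{}"])
    moreover have "\<not> P_atom M X" using X unfolding good_def by (auto dest!: spec[of _ "{X}"])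
    ultimately obtain B where B: "B \<in> sets M" "B \<subseteq> X" "measure M B > 0" "measure M (X - B) > 0"
      using X(1) by (auto simp: P_atom_def zero_less_measure_iff)
    have "X = B \<union> (X - B)" "X - (X - B) = B" using B by auto
    then have "\<not> good B \<or> \<not> good (X - B)" using good_Un[of B "X - B"] X B by auto
    then show ?thesis using B X \<open>X - (X - B) = B\<close> by (metis Diff_subset sets.Diff)
  qed
  have "good (space M)"
  proof (rule ccontr)
    assume ng: "\<not> good (space M)"
    have "\<exists>X. \<forall>n. (X n \<in> sets M \<and> \<not> good (X n)) \<and> (X (Suc n) \<subseteq> X n \<and> measure M (X n - X (Suc n)) > 0)"
      by (rule dependent_nat_choice) (use ng split in blast)+
    then obtain X where X: "\<And>n. X n \<in> sets M" "\<And>n. X (Suc n) \<subseteq> X n" "\<And>n. measure M (X n - X (Suc n)) > 0"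
      by blast
    have dec: "X n \<subseteq> X m" if "m \<le> n" for m n using lift_Suc_antimono_le[of X, OF X(2) that] .
    have "disjoint_family (\<lambda>n. X n - X (Suc n))"
      unfolding disjoint_family_on_def
    proof (intro ballI impI)
      fix m n :: nat assume "m \<noteq> n"
      then consider "Suc m \<le> n" | "Suc n \<le> m" by linarith
      then show "(X m - X (Suc m)) \<inter> (X n - X (Suc n)) = {}" by cases (use dec in blast)+
    qed
    from fin[OF this] X show False by (metis less_irrefl sets.Diff)
  qed
  then obtain \<A> where a: "finite \<A>" "disjoint \<A>" "\<And>A. A\<in>\<A> \<Longrightarrow> P_atom M A" "\<Union>\<A> \<subseteq> space M"
    "measure M (space M - \<Union>\<A>) = 0"
    unfolding good_def by blast
  have "\<A> \<noteq> {}" using a(5) prob_space by auto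
  then obtain A0 where A0: "A0 \<in> \<A>" by blast
  have s: "\<Union>\<A> \<in> sets M" using a by (auto simp: P_atom_def intro!: sets.finite_Union)
  \<comment> \<open>The null remainder is absorbed into one atom, because the family has to cover
    the space exactly.\<close>
  define R where "R = space M - \<Union>\<A>"
  have R: "R \<in> null_sets M" using s a(5) by (auto simp: R_def null_sets_def emeasure_eq_measure)
  have mR: "measure M (Y - R) = measure M Y" if "Y \<in> sets M" for Y
    using measure_Diff_null_set[OF that R] .
  have "P_atom M (A0 \<union> R)"
    unfolding P_atom_def
  proof (intro conjI ballI impI)
    note at = a(3)[OF A0, unfolded P_atom_def]
    show "A0 \<union> R \<in> sets M" using R at by auto
    show "0 < measure M (A0 \<union> R)" using at R by (simp add: measure_Un_null_set)
    fix B assume B: "B \<in> sets M" "B \<subseteq> A0 \<union> R"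
    then have "measure M (B - R) = 0 \<or> measure M (A0 - (B - R)) = 0" using at R by blast
    moreover have "measure M ((A0 \<union> R) - B) \<le> measure M (A0 - (B - R))"
    proof -
      have "measure M ((A0 \<union> R) - B) = measure M ((A0 \<union> R) - B - R)" using mR[of "(A0 \<union> R) - B"] B R at by auto
      also have "\<dots> \<le> measure M (A0 - (B - R))" using B R at by (intro finite_measure_mono) auto
      finally show ?thesis .
    qed
    ultimately show "measure M B = 0 \<or> measure M (A0 \<union> R - B) = 0"
      using mR[OF B(1)] measure_nonneg[of M "A0 \<union> R - B"] by linarith
  qed
  show ?thesis
  proof (rule that[of "insert (A0 \<union> R) (\<A> - {A0})"])
    show "finite (insert (A0 \<union> R) (\<A> - {A0}))" using a by simp
    show "disjoint (insert (A0 \<union> R) (\<A> - {A0}))"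
    proof (rule disjointI)
      have *: "(A0 \<union> R) \<inter> C = {}" if "C \<in> \<A> - {A0}" for C
      proof -
        have "A0 \<inter> C = {}" using disjointD[OF a(2) A0, of C] that by blast
        moreover have "C \<subseteq> \<Union>\<A>" using that by (simp add: Union_upper)
        ultimately show ?thesis unfolding R_def by blast
      qed
      fix C D assume "C \<in> insert (A0 \<union> R) (\<A> - {A0})" "D \<in> insert (A0 \<union> R) (\<A> - {A0})" "C \<noteq> D"
      then consider "C = A0 \<union> R" "D \<in> \<A> - {A0}" | "D = A0 \<union> R" "C \<in> \<A> - {A0}" | "C \<in> \<A>" "D \<in> \<A>" "C \<noteq> D"
        by (elim insertE) auto
      then show "C \<inter> D = {}"
        by cases (simp_all add: * disjointD[OF a(2)] Int_commute[of _ "A0 \<union> R"])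
    qed
    have "\<Union>\<A> = A0 \<union> \<Union>(\<A> - {A0})" using A0 by blast
    then show "\<Union>(insert (A0 \<union> R) (\<A> - {A0})) = space M" using a(4) unfolding R_def by auto
    show "P_atom M A" if "A \<in> insert (A0 \<union> R) (\<A> - {A0})" for A
      using that \<open>P_atom M (A0 \<union> R)\<close> a(3) by auto
  qed
qed

text \<open>A measurable \<open>B\<close> is replaced by the union of the atoms that it meets in
  positive measure: it fills these up to null sets and meets the others in null sets.\<close>

lemma essentially_purely_atomicI:
  assumes "prob_space M" and a: "finite \<A>" "disjoint \<A>" "\<And>A. A \<in> \<A> \<Longrightarrow> P_atom M A" "\<Union>\<A> = space M"
  shows "essentially_purely_atomic M"
proof -
  interpret prob_space M by fact
  have "B \<in> P_completion M (sigma_sets (space M) \<A>)" if B: "B \<in> sets M" for B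
  proof -
    define \<G> where "\<G> = {A\<in>\<A>. measure M (A \<inter> B) \<noteq> 0}"
    have As: "A \<in> sets M" if "A \<in> \<A>" for A using a(3)[OF that] by (simp add: P_atom_def)
    have "sigma_algebra (space M) (sigma_sets (space M) \<A>)"
      using a(4) by (intro sigma_algebra_sigma_sets) auto
    then interpret S: sigma_algebra "space M" "sigma_sets (space M) \<A>" .
    have G: "\<Union>\<G> \<in> sigma_sets (space M) \<A>" using a(1) by (intro S.finite_Union) (auto simp: \<G>_def)
    have n1: "(\<Union>A\<in>\<A> - \<G>. A \<inter> B) \<in> null_sets M"
      using a(1) As B by (intro null_sets_UN') (auto simp: \<G>_def null_sets_def emeasure_eq_measure countable_finite)
    have n2: "(\<Union>A\<in>\<G>. A - B) \<in> null_sets M"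
    proof (intro null_sets_UN')
      show "countable \<G>" using a(1) by (auto simp: \<G>_def countable_finite)
      fix A assume "A \<in> \<G>"
      then have A: "A \<in> \<A>" "measure M (A \<inter> B) \<noteq> 0" by (auto simp: \<G>_def)
      have "A \<inter> B \<in> sets M" "A \<inter> B \<subseteq> A" using As[OF A(1)] B by auto
      then have "measure M (A - A \<inter> B) = 0" using a(3)[OF A(1)] A(2) by (auto simp: P_atom_def)
      moreover have "A - A \<inter> B = A - B" by auto
      ultimately have "measure M (A - B) = 0" by metis
      then show "A - B \<in> null_sets M" using sets.Diff[OF As[OF A(1)] B]
        unfolding null_sets_def by (simp add: emeasure_eq_measure)
    qed
    have "(B - \<Union>\<G>) \<union> (\<Union>\<G> - B) \<subseteq> (\<Union>A\<in>\<A> - \<G>. A \<inter> B) \<union> (\<Union>A\<in>\<G>. A - B)"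
    proof (intro Un_mono subsetI)
      fix x assume x: "x \<in> B - \<Union>\<G>"
      then have "x \<in> \<Union>\<A>" using a(4) sets.sets_into_space[OF B] by auto
      with x show "x \<in> (\<Union>A\<in>\<A> - \<G>. A \<inter> B)" by auto
    qed auto
    moreover have "(\<Union>A\<in>\<A> - \<G>. A \<inter> B) \<union> (\<Union>A\<in>\<G>. A - B) \<in> null_sets M" using n1 n2 by (rule null_sets.Un)
    ultimately show ?thesis
      unfolding P_completion_def using G sets.sets_into_space[OF B] by (intro CollectI conjI bexI[of _ "\<Union>\<G>"] bexI)
  qed
  then show ?thesis unfolding essentially_purely_atomic_def
    using a by (intro exI[of _ \<A>]) (auto simp: countable_finite)
qed

section \<open>Representatives and norms\<close>

lemma L0_carrier [simp]: "carrier (L0 M) = L0_set M"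
  by (simp add: L0_def)

lemma L0_le_iff: "L0_le M x y \<longleftrightarrow> (AE \<omega> in M. L0_rep x \<omega> \<le> L0_rep y \<omega>)"
  by (simp add: L0_order_def)

lemma L0_class_eqI:
  "f \<in> borel_measurable M \<Longrightarrow> g \<in> borel_measurable M \<Longrightarrow> AE \<omega> in M. f \<omega> = g \<omega> \<Longrightarrow> L0_class M f = L0_class M g"
  by (simp add: L0_class_eq_iff)

context
  fixes M :: "'w measure" and x y :: "('w \<Rightarrow> 'k::{real_normed_field, second_countable_topology}) set"
  assumes x: "x \<in> L0_set M" and y: "y \<in> L0_set M"
begin

lemma L0_add_closed: "x \<oplus>\<^bsub>L0 M\<^esub> y \<in> L0_set M"
  and L0_mult_closed: "x \<otimes>\<^bsub>L0 M\<^esub> y \<in> L0_set M"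
proof -
  interpret cring "L0 M :: ('w \<Rightarrow> 'k) set ring" by (rule cring_L0)
  show "x \<oplus>\<^bsub>L0 M\<^esub> y \<in> L0_set M" "x \<otimes>\<^bsub>L0 M\<^esub> y \<in> L0_set M"
    using x y a_closed[of x y] m_closed[of x y] by simp_all
qed

lemma L0_rep_add: "AE \<omega> in M. L0_rep (x \<oplus>\<^bsub>L0 M\<^esub> y) \<omega> = L0_rep x \<omega> + L0_rep y \<omega>"
  using L0_rep_class[OF borel_measurable_add[OF L0_rep_measurable[OF x] L0_rep_measurable[OF y]]]
  by (simp add: L0_def)

lemma L0_rep_mult: "AE \<omega> in M. L0_rep (x \<otimes>\<^bsub>L0 M\<^esub> y) \<omega> = L0_rep x \<omega> * L0_rep y \<omega>"
  using L0_rep_class[OF borel_measurable_times[OF L0_rep_measurable[OF x] L0_rep_measurable[OF y]]]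
  by (simp add: L0_def)

end

lemma L0_zero_closed: "\<zero>\<^bsub>L0 M\<^esub> \<in> L0_set M"
  and L0_one_closed: "\<one>\<^bsub>L0 M\<^esub> \<in> L0_set M"
  by (simp_all add: L0_def)

lemma L0_rep_zero: "AE \<omega> in M. L0_rep \<zero>\<^bsub>L0 M\<^esub> \<omega> = 0"
  and L0_rep_one: "AE \<omega> in M. L0_rep \<one>\<^bsub>L0 M\<^esub> \<omega> = 1"
  by (simp_all add: L0_def L0_rep_class)

lemma L0_minus:
  fixes x y :: "('w \<Rightarrow> 'k::{real_normed_field, second_countable_topology}) set"
  assumes x: "x \<in> L0_set M" and y: "y \<in> L0_set M"
  shows L0_minus_closed: "x \<ominus>\<^bsub>L0 M\<^esub> y \<in> L0_set M"
    and L0_rep_minus: "AE \<omega> in M. L0_rep (x \<ominus>\<^bsub>L0 M\<^esub> y) \<omega> = L0_rep x \<omega> - L0_rep y \<omega>"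
proof -
  interpret cring "L0 M :: ('w \<Rightarrow> 'k) set ring" by (rule cring_L0)
  show c: "x \<ominus>\<^bsub>L0 M\<^esub> y \<in> L0_set M" using minus_closed x y by simp
  \<comment> \<open>Additive inverses are given abstractly by the ring, so the representative of the
    difference is read off from this identity.\<close>
  have "(x \<ominus>\<^bsub>L0 M\<^esub> y) \<oplus>\<^bsub>L0 M\<^esub> y = x" using x y a_inv_closed[of y] r_zero[of x] by (simp add: minus_eq a_assoc l_neg)
  with L0_rep_add[OF c y] show "AE \<omega> in M. L0_rep (x \<ominus>\<^bsub>L0 M\<^esub> y) \<omega> = L0_rep x \<omega> - L0_rep y \<omega>"
    by (auto elim!: eventually_mono simp: algebra_simps)
qed

lemma
  fixes x :: "('w \<Rightarrow> 'k::real_normed_field) set"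
  assumes x: "x \<in> L0_set M"
  shows L0_abs_closed: "L0_abs M x \<in> L0_set M"
    and L0_rep_abs: "AE \<omega> in M. L0_rep (L0_abs M x) \<omega> = norm (L0_rep x \<omega>)"
proof -
  have "(\<lambda>\<omega>. norm (L0_rep x \<omega>)) \<in> borel_measurable M" using L0_rep_measurable[OF x] by measurable
  then show "L0_abs M x \<in> L0_set M" "AE \<omega> in M. L0_rep (L0_abs M x) \<omega> = norm (L0_rep x \<omega>)"
    unfolding L0_map_def by (auto intro: L0_rep_class)
qed

lemma L0_nonneg_iff: "x \<in> L0_nonneg M \<longleftrightarrow> x \<in> L0_set M \<and> (AE \<omega> in M. 0 \<le> L0_rep x \<omega>)"
proof -
  have z: "AE \<omega> in M. L0_rep \<zero>\<^bsub>L0 M\<^esub> \<omega> = (0::real)" by (rule L0_rep_zero)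
  have "AE \<omega> in M. L0_rep \<zero>\<^bsub>L0 M\<^esub> \<omega> \<le> L0_rep x \<omega> \<longleftrightarrow> 0 \<le> L0_rep x \<omega>"
    using z by eventually_elim simp
  then have "(AE \<omega> in M. L0_rep \<zero>\<^bsub>L0 M\<^esub> \<omega> \<le> L0_rep x \<omega>) \<longleftrightarrow> (AE \<omega> in M. 0 \<le> L0_rep x \<omega>)"
    by (rule eventually_subst)
  then show ?thesis by (simp add: L0_nonneg_def L0_le_iff)
qed

lemma L0_pos_iff: "x \<in> L0_pos M \<longleftrightarrow> x \<in> L0_set M \<and> (AE \<omega> in M. 0 < L0_rep x \<omega>)"
  by (auto simp: L0_pos_def L0_nonneg_iff elim!: eventually_mono)

lemma L0_class_mult:
  fixes s t :: "'w \<Rightarrow> 'k::{real_normed_field, second_countable_topology}"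
  assumes s: "s \<in> borel_measurable M" and t: "t \<in> borel_measurable M"
  shows "L0_class M s \<otimes>\<^bsub>L0 M\<^esub> L0_class M t = L0_class M (\<lambda>\<omega>. s \<omega> * t \<omega>)"
proof (rule L0_eqI)
  show "AE \<omega> in M. L0_rep (L0_class M s \<otimes>\<^bsub>L0 M\<^esub> L0_class M t) \<omega> = L0_rep (L0_class M (\<lambda>\<omega>. s \<omega> * t \<omega>)) \<omega>"
    using L0_rep_mult[OF L0_class_in[OF s] L0_class_in[OF t]] L0_rep_class[OF s] L0_rep_class[OF t]
      L0_rep_class[OF borel_measurable_times[OF s t]]
    by eventually_elim simp
qed (intro L0_class_in L0_mult_closed borel_measurable_times s t)+

lemma L0_class_add:
  fixes s t :: "'w \<Rightarrow> 'k::{real_normed_field, second_countable_topology}"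
  assumes s: "s \<in> borel_measurable M" and t: "t \<in> borel_measurable M"
  shows "L0_class M s \<oplus>\<^bsub>L0 M\<^esub> L0_class M t = L0_class M (\<lambda>\<omega>. s \<omega> + t \<omega>)"
proof (rule L0_eqI)
  show "AE \<omega> in M. L0_rep (L0_class M s \<oplus>\<^bsub>L0 M\<^esub> L0_class M t) \<omega> = L0_rep (L0_class M (\<lambda>\<omega>. s \<omega> + t \<omega>)) \<omega>"
    using L0_rep_add[OF L0_class_in[OF s] L0_class_in[OF t]] L0_rep_class[OF s] L0_rep_class[OF t]
      L0_rep_class[OF borel_measurable_add[OF s t]]
    by eventually_elim simp
qed (intro L0_class_in L0_add_closed borel_measurable_add s t)+

text \<open>These type classes treat the real and the complex field in one argument: the norm of the
  field comes from an inner product, and finite dimension gives the second countability that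
  measurability of sums and products relies on.\<close>

locale rn_module_euclidean = random_normed_module M E
  for M :: "'w measure" and E :: "('w, 'k::{real_normed_field, euclidean_space}, 'e) rn_module"
begin

abbreviation scl :: "('w \<Rightarrow> 'k) \<Rightarrow> 'e \<Rightarrow> 'e" (infixr "\<star>" 75) where
  "t \<star> x \<equiv> L0_class M t \<odot>\<^bsub>E\<^esub> x"

abbreviation nrm :: "'e \<Rightarrow> 'w \<Rightarrow> real" where
  "nrm x \<equiv> L0_rep (rnorm E x)"

lemma rnorm_L0: "x \<in> carrier E \<Longrightarrow> rnorm E x \<in> L0_set M"
  using rnorm_closed by (simp add: L0_nonneg_iff)

lemma nrm_measurable [measurable]: "x \<in> carrier E \<Longrightarrow> nrm x \<in> borel_measurable M"
  by (intro L0_rep_measurable rnorm_L0)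

lemma nrm_nonneg: "x \<in> carrier E \<Longrightarrow> AE \<omega> in M. 0 \<le> nrm x \<omega>"
  using rnorm_closed by (simp add: L0_nonneg_iff)

lemma scl_closed: "t \<in> borel_measurable M \<Longrightarrow> x \<in> carrier E \<Longrightarrow> t \<star> x \<in> carrier E"
  by (intro smult_closed) auto

lemma nrm_scl:
  assumes t: "t \<in> borel_measurable M" and x: "x \<in> carrier E"
  shows "AE \<omega> in M. nrm (t \<star> x) \<omega> = norm (t \<omega>) * nrm x \<omega>"
proof -
  have c: "L0_class M t \<in> L0_set M" using t by simp
  have eq: "rnorm E (t \<star> x) = L0_abs M (L0_class M t) \<otimes>\<^bsub>L0 M\<^esub> rnorm E x"
    using rnorm_smult[OF _ x] c by simp
  show ?thesis
    unfolding eq using L0_rep_mult[OF L0_abs_closed[OF c] rnorm_L0[OF x]] L0_rep_abs[OF c] L0_rep_class[OF t]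
    by eventually_elim simp
qed

lemma nrm_add:
  assumes x: "x \<in> carrier E" and y: "y \<in> carrier E"
  shows "AE \<omega> in M. nrm (x \<oplus>\<^bsub>E\<^esub> y) \<omega> \<le> nrm x \<omega> + nrm y \<omega>"
  using rnorm_triangle[OF x y, unfolded L0_le_iff] L0_rep_add[OF rnorm_L0[OF x] rnorm_L0[OF y]]
  by eventually_elim simp

lemma nrm_eq_zeroD: 
  assumes "x \<in> carrier E" "AE \<omega> in M. nrm x \<omega> = 0" shows "x = \<zero>\<^bsub>E\<^esub>"
proof -
  have z: "AE \<omega> in M. L0_rep \<zero>\<^bsub>L0 M\<^esub> \<omega> = (0::real)" by (rule L0_rep_zero)
  have "rnorm E x = \<zero>\<^bsub>L0 M\<^esub>"
    using assms(2) z
    by (intro L0_eqI[OF rnorm_L0[OF assms(1)] L0_zero_closed], eventually_elim) simp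
  then show ?thesis using rnorm_eq_zero_iff assms(1) by blast
qed

lemma nrm_zero: "AE \<omega> in M. nrm \<zero>\<^bsub>E\<^esub> \<omega> = 0"
  using rnorm_eq_zero_iff[of "\<zero>\<^bsub>E\<^esub>"] L0_rep_zero[of M] by simp

lemma scl_scl:
  assumes s: "s \<in> borel_measurable M" and t: "t \<in> borel_measurable M" and x: "x \<in> carrier E"
  shows "s \<star> t \<star> x = (\<lambda>\<omega>. s \<omega> * t \<omega>) \<star> x"
proof -
  have "L0_class M s \<otimes>\<^bsub>L0 M\<^esub> L0_class M t = L0_class M (\<lambda>\<omega>. s \<omega> * t \<omega>)"
    using s t by (rule L0_class_mult)
  then show ?thesis using smult_assoc1[of "L0_class M s" "L0_class M t" x] assms by simp
qed

lemma scl_add_left: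
  assumes s: "s \<in> borel_measurable M" and t: "t \<in> borel_measurable M" and x: "x \<in> carrier E"
  shows "(\<lambda>\<omega>. s \<omega> + t \<omega>) \<star> x = s \<star> x \<oplus>\<^bsub>E\<^esub> t \<star> x"
proof -
  have "L0_class M s \<oplus>\<^bsub>L0 M\<^esub> L0_class M t = L0_class M (\<lambda>\<omega>. s \<omega> + t \<omega>)"
    using s t by (rule L0_class_add)
  then show ?thesis using smult_l_distr[of "L0_class M s" "L0_class M t" x] assms by simp
qed

lemma scl_add_right:
  "t \<in> borel_measurable M \<Longrightarrow> x \<in> carrier E \<Longrightarrow> y \<in> carrier E \<Longrightarrow> t \<star> (x \<oplus>\<^bsub>E\<^esub> y) = t \<star> x \<oplus>\<^bsub>E\<^esub> t \<star> y"
  by (intro smult_r_distr) auto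

lemma scl_one: "x \<in> carrier E \<Longrightarrow> (\<lambda>_. 1) \<star> x = x"
  using smult_one by (simp add: L0_def)

lemma scl_zero: "x \<in> carrier E \<Longrightarrow> (\<lambda>_. 0) \<star> x = \<zero>\<^bsub>E\<^esub>"
  using nrm_scl[of "\<lambda>_. 0" x] by (intro nrm_eq_zeroD scl_closed) auto

lemma scl_uminus_one: "x \<in> carrier E \<Longrightarrow> (\<lambda>_. -1) \<star> x = \<ominus>\<^bsub>E\<^esub> x"
  using scl_add_left[of "\<lambda>_. -1" "\<lambda>_. 1" x] scl_zero[of x] scl_one[of x] scl_closed[of "\<lambda>_. -1" x]
  by (intro M.minus_equality[symmetric]) (auto)

lemma nrm_uminus: "x \<in> carrier E \<Longrightarrow> AE \<omega> in M. nrm (\<ominus>\<^bsub>E\<^esub> x) \<omega> = nrm x \<omega>"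
  using nrm_scl[of "\<lambda>_. -1" x] by (simp add: scl_uminus_one)

lemma scl_minus_right:
  "t \<in> borel_measurable M \<Longrightarrow> x \<in> carrier E \<Longrightarrow> t \<star> (\<ominus>\<^bsub>E\<^esub> x) = \<ominus>\<^bsub>E\<^esub> (t \<star> x)"
  by (rule smult_r_minus) auto

section \<open>A random Hahn-Banach theorem\<close>

text \<open>Hahn-Banach is run over real multipliers only; the K-linear functional is recovered
  afterwards from its real part.\<close>

definition rscl :: "('w \<Rightarrow> real) \<Rightarrow> 'e \<Rightarrow> 'e" (infixr "\<star>\<^sub>R" 75) where
  "t \<star>\<^sub>R x = (\<lambda>\<omega>. of_real (t \<omega>)) \<star> x"

context
  fixes t :: "'w \<Rightarrow> real" assumes t: "t \<in> borel_measurable M"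
begin

lemma of_real_measurable: "(\<lambda>\<omega>. of_real (t \<omega>) :: 'k) \<in> borel_measurable M"
  unfolding of_real_def using t by (intro borel_measurable_scaleR borel_measurable_const)

lemma rscl_closed: "x \<in> carrier E \<Longrightarrow> t \<star>\<^sub>R x \<in> carrier E"
  unfolding rscl_def by (intro scl_closed of_real_measurable)

lemma nrm_rscl: "x \<in> carrier E \<Longrightarrow> AE \<omega> in M. nrm (t \<star>\<^sub>R x) \<omega> = \<bar>t \<omega>\<bar> * nrm x \<omega>"
  unfolding rscl_def using nrm_scl[OF of_real_measurable] by simp

lemma rscl_add_right:
  "x \<in> carrier E \<Longrightarrow> y \<in> carrier E \<Longrightarrow> t \<star>\<^sub>R (x \<oplus>\<^bsub>E\<^esub> y) = t \<star>\<^sub>R x \<oplus>\<^bsub>E\<^esub> t \<star>\<^sub>R y"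
  unfolding rscl_def by (intro scl_add_right of_real_measurable)

lemma rscl_minus_right: "x \<in> carrier E \<Longrightarrow> t \<star>\<^sub>R (\<ominus>\<^bsub>E\<^esub> x) = \<ominus>\<^bsub>E\<^esub> (t \<star>\<^sub>R x)"
  unfolding rscl_def by (intro scl_minus_right of_real_measurable)

lemma rscl_null: "t \<star>\<^sub>R \<zero>\<^bsub>E\<^esub> = \<zero>\<^bsub>E\<^esub>"
  unfolding rscl_def by (intro smult_r_null) (simp add: of_real_measurable)

end

lemma rscl_rscl:
  "s \<in> borel_measurable M \<Longrightarrow> t \<in> borel_measurable M \<Longrightarrow> x \<in> carrier E \<Longrightarrow>
    s \<star>\<^sub>R t \<star>\<^sub>R x = (\<lambda>\<omega>. s \<omega> * t \<omega>) \<star>\<^sub>R x"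
  unfolding rscl_def using scl_scl[OF of_real_measurable of_real_measurable] by simp

lemma rscl_add_left:
  "s \<in> borel_measurable M \<Longrightarrow> t \<in> borel_measurable M \<Longrightarrow> x \<in> carrier E \<Longrightarrow>
    (\<lambda>\<omega>. s \<omega> + t \<omega>) \<star>\<^sub>R x = s \<star>\<^sub>R x \<oplus>\<^bsub>E\<^esub> t \<star>\<^sub>R x"
  unfolding rscl_def using scl_add_left[OF of_real_measurable of_real_measurable] by simp

lemma rscl_one: "x \<in> carrier E \<Longrightarrow> (\<lambda>_. 1) \<star>\<^sub>R x = x"
  and rscl_zero: "x \<in> carrier E \<Longrightarrow> (\<lambda>_. 0) \<star>\<^sub>R x = \<zero>\<^bsub>E\<^esub>"
  by (simp_all add: rscl_def scl_one scl_zero)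

text \<open>A cone in the product of the module and the measurable functions, thought of as the
  epigraph of a sublinear map. The maximal ones are exactly the epigraphs of linear maps, and
  unions of chains of cones are cones, so that Zorn's lemma applies without any essential infimum.\<close>

definition hb_cone :: "('e \<times> ('w \<Rightarrow> real)) set \<Rightarrow> bool" where
  "hb_cone S \<longleftrightarrow> S \<subseteq> carrier E \<times> borel_measurable M \<and>
    (\<forall>x \<xi> y \<eta>. (x, \<xi>) \<in> S \<longrightarrow> (y, \<eta>) \<in> S \<longrightarrow> (x \<oplus>\<^bsub>E\<^esub> y, \<lambda>\<omega>. \<xi> \<omega> + \<eta> \<omega>) \<in> S) \<and>
    (\<forall>x \<xi> t. (x, \<xi>) \<in> S \<longrightarrow> t \<in> borel_measurable M \<longrightarrow> (\<forall>\<omega>. 0 < t \<omega>) \<longrightarrow>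
      (t \<star>\<^sub>R x, \<lambda>\<omega>. t \<omega> * \<xi> \<omega>) \<in> S) \<and>
    (\<forall>x \<xi> \<eta>. (x, \<xi>) \<in> S \<longrightarrow> \<eta> \<in> borel_measurable M \<longrightarrow> (AE \<omega> in M. \<xi> \<omega> \<le> \<eta> \<omega>) \<longrightarrow> (x, \<eta>) \<in> S) \<and>
    (\<forall>\<xi>. (\<zero>\<^bsub>E\<^esub>, \<xi>) \<in> S \<longrightarrow> (AE \<omega> in M. 0 \<le> \<xi> \<omega>)) \<and>
    (\<forall>x\<in>carrier E. (x, nrm x) \<in> S)"

lemma hb_coneD:
  assumes "hb_cone S"
  shows "(x, \<xi>) \<in> S \<Longrightarrow> x \<in> carrier E" "(x, \<xi>) \<in> S \<Longrightarrow> \<xi> \<in> borel_measurable M"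
    "(x, \<xi>) \<in> S \<Longrightarrow> (y, \<eta>) \<in> S \<Longrightarrow> (x \<oplus>\<^bsub>E\<^esub> y, \<lambda>\<omega>. \<xi> \<omega> + \<eta> \<omega>) \<in> S"
    "(x, \<xi>) \<in> S \<Longrightarrow> t \<in> borel_measurable M \<Longrightarrow> (\<And>\<omega>. 0 < t \<omega>) \<Longrightarrow> (t \<star>\<^sub>R x, \<lambda>\<omega>. t \<omega> * \<xi> \<omega>) \<in> S"
    "(x, \<xi>) \<in> S \<Longrightarrow> \<eta> \<in> borel_measurable M \<Longrightarrow> (AE \<omega> in M. \<xi> \<omega> \<le> \<eta> \<omega>) \<Longrightarrow> (x, \<eta>) \<in> S"
    "(\<zero>\<^bsub>E\<^esub>, \<xi>) \<in> S \<Longrightarrow> AE \<omega> in M. 0 \<le> \<xi> \<omega>"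
    "x \<in> carrier E \<Longrightarrow> (x, nrm x) \<in> S"
  using assms unfolding hb_cone_def by blast+

text \<open>The two points add up to a point over the zero of E. Read as a lower bound for \<xi>,
  this bounds the fibre over x from below by minus any element of the fibre over -x.\<close>

lemma hb_coneD_opposite:
  assumes S: "hb_cone S" "(x, \<xi>) \<in> S" "(\<ominus>\<^bsub>E\<^esub> x, \<eta>) \<in> S"
  shows "AE \<omega> in M. 0 \<le> \<xi> \<omega> + \<eta> \<omega>"
  using hb_coneD(3)[OF S] hb_coneD(1)[OF S(1,2)] by (auto simp: M.r_neg intro: hb_coneD(6)[OF S(1)])

lemma hb_cone_Union:
  assumes "\<C> \<noteq> {}" "subset.chain {S. hb_cone S} \<C>"
  shows "hb_cone (\<Union>\<C>)"
proof -
  have c: "hb_cone S" if "S \<in> \<C>" for S using assms(2) that by (auto simp: subset.chain_def)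
  have two: "\<exists>S\<in>\<C>. p \<in> S \<and> q \<in> S" if "p \<in> \<Union>\<C>" "q \<in> \<Union>\<C>" for p q
    proof -
    from that obtain S T where ST: "S \<in> \<C>" "p \<in> S" "T \<in> \<C>" "q \<in> T" by blast
    then have "S \<subseteq> T \<or> T \<subseteq> S" using assms(2) by (auto simp: subset_chain_def)
    then show ?thesis using ST by blast
  qed
  show ?thesis
    unfolding hb_cone_def
  proof (intro conjI allI impI ballI)
    show "\<Union>\<C> \<subseteq> carrier E \<times> borel_measurable M"
      using c unfolding hb_cone_def by blast
    fix x \<xi> y \<eta> assume "(x, \<xi>) \<in> \<Union>\<C>" "(y, \<eta>) \<in> \<Union>\<C>"
    then obtain S where "S \<in> \<C>" "(x, \<xi>) \<in> S" "(y, \<eta>) \<in> S" using two by blast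
    then show "(x \<oplus>\<^bsub>E\<^esub> y, \<lambda>\<omega>. \<xi> \<omega> + \<eta> \<omega>) \<in> \<Union>\<C>" using hb_coneD(3)[OF c] by blast
  next
    fix x \<xi> and t :: "'w \<Rightarrow> real"
    assume "(x, \<xi>) \<in> \<Union>\<C>" "t \<in> borel_measurable M" "\<forall>\<omega>. 0 < t \<omega>"
    then show "(t \<star>\<^sub>R x, \<lambda>\<omega>. t \<omega> * \<xi> \<omega>) \<in> \<Union>\<C>" using hb_coneD(4)[OF c] by blast
  next
    fix x \<xi> \<eta> assume "(x, \<xi>) \<in> \<Union>\<C>" "\<eta> \<in> borel_measurable M" "AE \<omega> in M. \<xi> \<omega> \<le> \<eta> \<omega>"
    then show "(x, \<eta>) \<in> \<Union>\<C>" using hb_coneD(5)[OF c] by blast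
  next
    fix \<xi> assume "(\<zero>\<^bsub>E\<^esub>, \<xi>) \<in> \<Union>\<C>"
    then show "AE \<omega> in M. 0 \<le> \<xi> \<omega>" using hb_coneD(6)[OF c] by blast
  next
    fix x assume "x \<in> carrier E"
    then show "(x, nrm x) \<in> \<Union>\<C>" using assms(1) hb_coneD(7)[OF c] by blast
  qed
qed

text \<open>Adjoining the multiples of (x, \<xi>) by zero or by positive functions gives a larger
  cone, provided that nothing negative appears over zero. A point over zero comes from z + t x = 0;
  dividing by t puts a multiple of z over -x, where \<open>cons\<close> applies. Maximality then
  yields the membership.\<close>

lemma maximal_hb_cone_mem:
  assumes S: "hb_cone S" and max: "\<forall>S'. hb_cone S' \<longrightarrow> S \<subseteq> S' \<longrightarrow> S' = S"
    and x: "x \<in> carrier E" and \<xi>: "\<xi> \<in> borel_measurable M"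
    and cons: "\<And>\<zeta>. (\<ominus>\<^bsub>E\<^esub> x, \<zeta>) \<in> S \<Longrightarrow> AE \<omega> in M. 0 \<le> \<xi> \<omega> + \<zeta> \<omega>"
  shows "(x, \<xi>) \<in> S"
proof -
  note D = hb_coneD[OF S]
  define pos :: "('w \<Rightarrow> real) \<Rightarrow> bool" where
    "pos t \<longleftrightarrow> t \<in> borel_measurable M \<and> (t = (\<lambda>_. 0) \<or> (\<forall>\<omega>. 0 < t \<omega>))" for t
  have pos_m: "t \<in> borel_measurable M" if "pos t" for t using that by (simp add: pos_def)
  have pos_add: "pos (\<lambda>\<omega>. s \<omega> + t \<omega>)" if "pos s" "pos t" for s t
    using that by (auto simp: pos_def add_pos_pos)
  have pos_mult: "pos (\<lambda>\<omega>. s \<omega> * t \<omega>)" if "s \<in> borel_measurable M" "\<forall>\<omega>. 0 < s \<omega>" "pos t" for s t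
    using that by (auto simp: pos_def)
  define S' where "S' = {(y, \<eta>). \<exists>z \<zeta> t. (z, \<zeta>) \<in> S \<and> pos t \<and> y = z \<oplus>\<^bsub>E\<^esub> t \<star>\<^sub>R x \<and>
    \<eta> \<in> borel_measurable M \<and> (AE \<omega> in M. \<zeta> \<omega> + t \<omega> * \<xi> \<omega> \<le> \<eta> \<omega>)}"
  have "hb_cone S'"
    unfolding hb_cone_def
  proof (intro conjI allI impI ballI)
    show "S' \<subseteq> carrier E \<times> borel_measurable M"
      using D(1) x by (auto simp: S'_def intro!: M.a_closed rscl_closed pos_m)
    fix y1 \<eta>1 y2 \<eta>2 assume "(y1, \<eta>1) \<in> S'" "(y2, \<eta>2) \<in> S'"
    then obtain z1 \<zeta>1 t1 z2 \<zeta>2 t2 where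
      1: "(z1, \<zeta>1) \<in> S" "pos t1" "y1 = z1 \<oplus>\<^bsub>E\<^esub> t1 \<star>\<^sub>R x" "\<eta>1 \<in> borel_measurable M" "AE \<omega> in M. \<zeta>1 \<omega> + t1 \<omega> * \<xi> \<omega> \<le> \<eta>1 \<omega>"
      and 2: "(z2, \<zeta>2) \<in> S" "pos t2" "y2 = z2 \<oplus>\<^bsub>E\<^esub> t2 \<star>\<^sub>R x" "\<eta>2 \<in> borel_measurable M" "AE \<omega> in M. \<zeta>2 \<omega> + t2 \<omega> * \<xi> \<omega> \<le> \<eta>2 \<omega>"
      unfolding S'_def by blast
    have "y1 \<oplus>\<^bsub>E\<^esub> y2 = (z1 \<oplus>\<^bsub>E\<^esub> z2) \<oplus>\<^bsub>E\<^esub> (\<lambda>\<omega>. t1 \<omega> + t2 \<omega>) \<star>\<^sub>R x"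
      using D(1)[OF 1(1)] D(1)[OF 2(1)] rscl_closed[OF pos_m[OF 1(2)] x] rscl_closed[OF pos_m[OF 2(2)] x]
      by (simp add: 1(3) 2(3) rscl_add_left[OF pos_m[OF 1(2)] pos_m[OF 2(2)] x] M.a_ac)
    moreover have "AE \<omega> in M. \<zeta>1 \<omega> + \<zeta>2 \<omega> + (t1 \<omega> + t2 \<omega>) * \<xi> \<omega> \<le> \<eta>1 \<omega> + \<eta>2 \<omega>"
      using 1(5) 2(5) by eventually_elim (simp add: algebra_simps)
    ultimately show "(y1 \<oplus>\<^bsub>E\<^esub> y2, \<lambda>\<omega>. \<eta>1 \<omega> + \<eta>2 \<omega>) \<in> S'"
      using D(3)[OF 1(1) 2(1)] pos_add[OF 1(2) 2(2)] borel_measurable_add[OF 1(4) 2(4)]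
      unfolding S'_def by blast
  next
    fix y \<eta> and s :: "'w \<Rightarrow> real"
    assume "(y, \<eta>) \<in> S'" and s: "s \<in> borel_measurable M" "\<forall>\<omega>. 0 < s \<omega>"
    then obtain z \<zeta> t where
      1: "(z, \<zeta>) \<in> S" "pos t" "y = z \<oplus>\<^bsub>E\<^esub> t \<star>\<^sub>R x" "\<eta> \<in> borel_measurable M" "AE \<omega> in M. \<zeta> \<omega> + t \<omega> * \<xi> \<omega> \<le> \<eta> \<omega>"
      unfolding S'_def by blast
    have "s \<star>\<^sub>R y = s \<star>\<^sub>R z \<oplus>\<^bsub>E\<^esub> (\<lambda>\<omega>. s \<omega> * t \<omega>) \<star>\<^sub>R x"
      using D(1)[OF 1(1)] rscl_closed[OF pos_m[OF 1(2)] x]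
      by (simp add: 1(3) rscl_add_right[OF s(1)] rscl_rscl[OF s(1) pos_m[OF 1(2)] x])
    moreover have "AE \<omega> in M. s \<omega> * \<zeta> \<omega> + (s \<omega> * t \<omega>) * \<xi> \<omega> \<le> s \<omega> * \<eta> \<omega>"
      using 1(5)
    proof eventually_elim
      case (elim \<omega>)
      then have "s \<omega> * (\<zeta> \<omega> + t \<omega> * \<xi> \<omega>) \<le> s \<omega> * \<eta> \<omega>" using s(2) by (simp add: less_imp_le mult_left_mono)
      then show ?case by (simp add: algebra_simps)
    qed
    ultimately show "(s \<star>\<^sub>R y, \<lambda>\<omega>. s \<omega> * \<eta> \<omega>) \<in> S'"
      using D(4)[OF 1(1) s(1)] s(2) pos_mult[OF s 1(2)] borel_measurable_times[OF s(1) 1(4)]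
      unfolding S'_def by blast
  next
    fix y \<eta> \<eta>' assume "(y, \<eta>) \<in> S'" and \<eta>': "\<eta>' \<in> borel_measurable M" "AE \<omega> in M. \<eta> \<omega> \<le> \<eta>' \<omega>"
    then obtain z \<zeta> t where
      1: "(z, \<zeta>) \<in> S" "pos t" "y = z \<oplus>\<^bsub>E\<^esub> t \<star>\<^sub>R x" "AE \<omega> in M. \<zeta> \<omega> + t \<omega> * \<xi> \<omega> \<le> \<eta> \<omega>"
      unfolding S'_def by blast
    have "AE \<omega> in M. \<zeta> \<omega> + t \<omega> * \<xi> \<omega> \<le> \<eta>' \<omega>"
      using 1(4) \<eta>'(2) by eventually_elim simp
    then show "(y, \<eta>') \<in> S'" using 1(1-3) \<eta>'(1) unfolding S'_def by blast
  next
    fix \<eta> assume "(\<zero>\<^bsub>E\<^esub>, \<eta>) \<in> S'"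
    then obtain z \<zeta> t where
      1: "(z, \<zeta>) \<in> S" "pos t" "\<zero>\<^bsub>E\<^esub> = z \<oplus>\<^bsub>E\<^esub> t \<star>\<^sub>R x" "AE \<omega> in M. \<zeta> \<omega> + t \<omega> * \<xi> \<omega> \<le> \<eta> \<omega>"
      unfolding S'_def by blast
    have z: "z \<in> carrier E" using D(1)[OF 1(1)] .
    show "AE \<omega> in M. 0 \<le> \<eta> \<omega>"
    proof (cases "t = (\<lambda>_. 0)")
      case True
      then have "z = \<zero>\<^bsub>E\<^esub>" using 1(3) z x by (simp add: rscl_zero)
      then have "AE \<omega> in M. 0 \<le> \<zeta> \<omega>" using D(6) 1(1) by blast
      then show ?thesis using 1(4) by eventually_elim (simp add: True)
    next
      case False
      then have t: "t \<in> borel_measurable M" "\<And>\<omega>. 0 < t \<omega>" using 1(2) by (auto simp: pos_def)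
      let ?r = "\<lambda>\<omega>. 1 / t \<omega>"
      have r: "?r \<in> borel_measurable M" "\<And>\<omega>. 0 < ?r \<omega>" using t by auto
      have "?r \<star>\<^sub>R \<zero>\<^bsub>E\<^esub> = ?r \<star>\<^sub>R z \<oplus>\<^bsub>E\<^esub> (\<lambda>\<omega>. ?r \<omega> * t \<omega>) \<star>\<^sub>R x"
        unfolding 1(3) using rscl_add_right[OF r(1) z rscl_closed[OF t(1) x]] rscl_rscl[OF r(1) t(1) x] by simp
      moreover have "(\<lambda>\<omega>. ?r \<omega> * t \<omega>) = (\<lambda>_. 1)" using t(2) by (auto simp: less_imp_neq[symmetric])
      ultimately have "\<zero>\<^bsub>E\<^esub> = ?r \<star>\<^sub>R z \<oplus>\<^bsub>E\<^esub> x"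
        using rscl_one[OF x] rscl_null[OF r(1)]
        by simp
      then have "?r \<star>\<^sub>R z = \<ominus>\<^bsub>E\<^esub> x"
        using x rscl_closed[OF r(1) z] by (metis M.minus_equality)
      then have "(\<ominus>\<^bsub>E\<^esub> x, \<lambda>\<omega>. ?r \<omega> * \<zeta> \<omega>) \<in> S" using D(4)[OF 1(1) r] by simp
      from cons[OF this] 1(4) show ?thesis
      proof eventually_elim
        case (elim \<omega>)
        have "0 \<le> t \<omega> * (\<xi> \<omega> + 1 / t \<omega> * \<zeta> \<omega>)" using elim(1) t(2)[of \<omega>] by (intro mult_nonneg_nonneg) auto
        also have "\<dots> = \<zeta> \<omega> + t \<omega> * \<xi> \<omega>" using t(2)[of \<omega>] by (simp add: field_simps)
        finally show ?case using elim(2) by simp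
      qed
    qed
  next
    fix y assume y: "y \<in> carrier E"
    show "(y, nrm y) \<in> S'"
      unfolding S'_def using y x by (intro CollectI case_prodI exI[of _ y] exI[of _ "nrm y"] exI[of _ "\<lambda>_. 0"])
        (auto simp: D(7) pos_def rscl_zero)
  qed
  moreover have "S \<subseteq> S'"
  proof
    fix p assume "p \<in> S"
    then obtain y \<eta> where p: "p = (y, \<eta>)" "(y, \<eta>) \<in> S" by (cases p) auto
    have "y = y \<oplus>\<^bsub>E\<^esub> (\<lambda>_. 0) \<star>\<^sub>R x" using D(1)[OF p(2)] x by (simp add: rscl_zero)
    moreover have "AE \<omega> in M. \<eta> \<omega> + 0 * \<xi> \<omega> \<le> \<eta> \<omega>" "pos (\<lambda>_. 0)" by (simp_all add: pos_def)
    ultimately show "p \<in> S'"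
      unfolding S'_def p(1) using p(2) D(2)[OF p(2)] by blast
  qed
  moreover have "(x, \<xi>) \<in> S'"
    unfolding S'_def
  proof (intro CollectI case_prodI exI conjI)
    show "(\<zero>\<^bsub>E\<^esub>, nrm \<zero>\<^bsub>E\<^esub>) \<in> S" by (simp add: D(7))
    show "pos (\<lambda>_. 1)" by (simp add: pos_def)
    show "x = \<zero>\<^bsub>E\<^esub> \<oplus>\<^bsub>E\<^esub> (\<lambda>_. 1) \<star>\<^sub>R x" using x by (simp add: rscl_one)
    show "AE \<omega> in M. nrm \<zero>\<^bsub>E\<^esub> \<omega> + 1 * \<xi> \<omega> \<le> \<xi> \<omega>" using nrm_zero by eventually_elim simp
  qed fact
  ultimately show ?thesis using max by blast
qed

text \<open>Additivity of the norm on \<open>Z\<close> is what makes the starting cone closed under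
  sums. That cone forces u to be at least the norm on \<open>Z\<close>, while the point (x, nrm x)
  in every cone gives the opposite bound. In a maximal cone each fibre contains its essential
  infimum, with the negative of it over -x, which makes the infimum additive in x.\<close>

lemma random_Hahn_Banach:
  assumes Z: "Z \<subseteq> carrier E" "\<zero>\<^bsub>E\<^esub> \<in> Z" "\<And>z z'. z \<in> Z \<Longrightarrow> z' \<in> Z \<Longrightarrow> z \<oplus>\<^bsub>E\<^esub> z' \<in> Z"
    "\<And>z t. z \<in> Z \<Longrightarrow> t \<in> borel_measurable M \<Longrightarrow> (\<And>\<omega>. 0 < t \<omega>) \<Longrightarrow> t \<star>\<^sub>R z \<in> Z"
    and nrmZ: "\<And>z z'. z \<in> Z \<Longrightarrow> z' \<in> Z \<Longrightarrow> AE \<omega> in M. nrm (z \<oplus>\<^bsub>E\<^esub> z') \<omega> = nrm z \<omega> + nrm z' \<omega>"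
  obtains u :: "'e \<Rightarrow> 'w \<Rightarrow> real" where
    "\<And>x. x \<in> carrier E \<Longrightarrow> u x \<in> borel_measurable M"
    "\<And>x y. x \<in> carrier E \<Longrightarrow> y \<in> carrier E \<Longrightarrow> AE \<omega> in M. u (x \<oplus>\<^bsub>E\<^esub> y) \<omega> = u x \<omega> + u y \<omega>"
    "\<And>t x. t \<in> borel_measurable M \<Longrightarrow> x \<in> carrier E \<Longrightarrow> AE \<omega> in M. u (t \<star>\<^sub>R x) \<omega> = t \<omega> * u x \<omega>"
    "\<And>x. x \<in> carrier E \<Longrightarrow> AE \<omega> in M. \<bar>u x \<omega>\<bar> \<le> nrm x \<omega>"
    "\<And>z. z \<in> Z \<Longrightarrow> AE \<omega> in M. u z \<omega> = nrm z \<omega>"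
proof -
  have ZE: "z \<in> carrier E" if "z \<in> Z" for z using Z(1) that by blast
  \<comment> \<open>Up to attainment, the epigraph of the sublinear map that sends x to the
    essential infimum of nrm (x + z) - nrm z over z in \<open>Z\<close>. Taking y = 0 puts - nrm z
    over -z.\<close>
  define S0 where "S0 = {(x, \<eta>). \<exists>y\<in>carrier E. \<exists>z\<in>Z. x = y \<oplus>\<^bsub>E\<^esub> \<ominus>\<^bsub>E\<^esub> z \<and> \<eta> \<in> borel_measurable M \<and>
    (AE \<omega> in M. nrm y \<omega> - nrm z \<omega> \<le> \<eta> \<omega>)}"
  have S0: "hb_cone S0"
    unfolding hb_cone_def
  proof (intro conjI allI impI ballI)
    show "S0 \<subseteq> carrier E \<times> borel_measurable M" using Z(1) by (auto simp: S0_def)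
    fix x1 \<eta>1 x2 \<eta>2 assume "(x1, \<eta>1) \<in> S0" "(x2, \<eta>2) \<in> S0"
    then obtain y1 z1 y2 z2 where
      1: "y1 \<in> carrier E" "z1 \<in> Z" "x1 = y1 \<oplus>\<^bsub>E\<^esub> \<ominus>\<^bsub>E\<^esub> z1" "\<eta>1 \<in> borel_measurable M" "AE \<omega> in M. nrm y1 \<omega> - nrm z1 \<omega> \<le> \<eta>1 \<omega>"
      and 2: "y2 \<in> carrier E" "z2 \<in> Z" "x2 = y2 \<oplus>\<^bsub>E\<^esub> \<ominus>\<^bsub>E\<^esub> z2" "\<eta>2 \<in> borel_measurable M" "AE \<omega> in M. nrm y2 \<omega> - nrm z2 \<omega> \<le> \<eta>2 \<omega>"
      unfolding S0_def by blast
    have "x1 \<oplus>\<^bsub>E\<^esub> x2 = (y1 \<oplus>\<^bsub>E\<^esub> y2) \<oplus>\<^bsub>E\<^esub> \<ominus>\<^bsub>E\<^esub> (z1 \<oplus>\<^bsub>E\<^esub> z2)"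
      using 1 2 ZE by (simp add: M.minus_add M.a_ac)
    moreover have "AE \<omega> in M. nrm (y1 \<oplus>\<^bsub>E\<^esub> y2) \<omega> - nrm (z1 \<oplus>\<^bsub>E\<^esub> z2) \<omega> \<le> \<eta>1 \<omega> + \<eta>2 \<omega>"
      using 1(5) 2(5) nrm_add[OF 1(1) 2(1)] nrmZ[OF 1(2) 2(2)] by eventually_elim simp
    ultimately show "(x1 \<oplus>\<^bsub>E\<^esub> x2, \<lambda>\<omega>. \<eta>1 \<omega> + \<eta>2 \<omega>) \<in> S0"
      using 1 2 Z(3)[OF 1(2) 2(2)] unfolding S0_def by (auto intro!: bexI)
  next
    fix x \<eta> and t :: "'w \<Rightarrow> real" assume "(x, \<eta>) \<in> S0" and t: "t \<in> borel_measurable M" "\<forall>\<omega>. 0 < t \<omega>"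
    then obtain y z where
      1: "y \<in> carrier E" "z \<in> Z" "x = y \<oplus>\<^bsub>E\<^esub> \<ominus>\<^bsub>E\<^esub> z" "\<eta> \<in> borel_measurable M" "AE \<omega> in M. nrm y \<omega> - nrm z \<omega> \<le> \<eta> \<omega>"
      unfolding S0_def by blast
    have "t \<star>\<^sub>R x = t \<star>\<^sub>R y \<oplus>\<^bsub>E\<^esub> \<ominus>\<^bsub>E\<^esub> (t \<star>\<^sub>R z)"
      using 1 ZE by (simp add: rscl_add_right[OF t(1)] rscl_minus_right[OF t(1)])
    moreover have "AE \<omega> in M. nrm (t \<star>\<^sub>R y) \<omega> - nrm (t \<star>\<^sub>R z) \<omega> \<le> t \<omega> * \<eta> \<omega>"
      using 1(5) nrm_rscl[OF t(1) 1(1)] nrm_rscl[OF t(1) ZE[OF 1(2)]]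
    proof eventually_elim
      case (elim \<omega>)
      have "t \<omega> * (nrm y \<omega> - nrm z \<omega>) \<le> t \<omega> * \<eta> \<omega>" using elim t(2) by (simp add: less_imp_le mult_left_mono)
      then show ?case using elim t(2) by (simp add: less_imp_le algebra_simps)
    qed
    ultimately show "(t \<star>\<^sub>R x, \<lambda>\<omega>. t \<omega> * \<eta> \<omega>) \<in> S0"
      using borel_measurable_times[OF t(1) 1(4)] rscl_closed[OF t(1) 1(1)] Z(4)[OF 1(2) t(1)] t(2)
      unfolding S0_def by blast
  next
    fix x \<eta> \<eta>' assume "(x, \<eta>) \<in> S0" and \<eta>': "\<eta>' \<in> borel_measurable M" "AE \<omega> in M. \<eta> \<omega> \<le> \<eta>' \<omega>"
    then obtain y z where
      1: "y \<in> carrier E" "z \<in> Z" "x = y \<oplus>\<^bsub>E\<^esub> \<ominus>\<^bsub>E\<^esub> z" "AE \<omega> in M. nrm y \<omega> - nrm z \<omega> \<le> \<eta> \<omega>"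
      unfolding S0_def by blast
    have "AE \<omega> in M. nrm y \<omega> - nrm z \<omega> \<le> \<eta>' \<omega>" using 1(4) \<eta>'(2) by eventually_elim simp
    then show "(x, \<eta>') \<in> S0" using 1(1-3) \<eta>'(1) unfolding S0_def by blast
  next
    fix \<eta> assume "(\<zero>\<^bsub>E\<^esub>, \<eta>) \<in> S0"
    then obtain y z where
      1: "y \<in> carrier E" "z \<in> Z" "\<zero>\<^bsub>E\<^esub> = y \<oplus>\<^bsub>E\<^esub> \<ominus>\<^bsub>E\<^esub> z" "AE \<omega> in M. nrm y \<omega> - nrm z \<omega> \<le> \<eta> \<omega>"
      unfolding S0_def by blast
    have "y = \<ominus>\<^bsub>E\<^esub> (\<ominus>\<^bsub>E\<^esub> z)" using 1 ZE M.minus_equality[of y "\<ominus>\<^bsub>E\<^esub> z"] by simp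
    then have "y = z" using ZE[OF 1(2)] by simp
    then show "AE \<omega> in M. 0 \<le> \<eta> \<omega>" using 1(4) by simp
  next
    fix x assume x: "x \<in> carrier E"
    have "AE \<omega> in M. nrm x \<omega> - nrm \<zero>\<^bsub>E\<^esub> \<omega> \<le> nrm x \<omega>" using nrm_zero by eventually_elim simp
    moreover have "x = x \<oplus>\<^bsub>E\<^esub> \<ominus>\<^bsub>E\<^esub> \<zero>\<^bsub>E\<^esub>" using x by simp
    ultimately show "(x, nrm x) \<in> S0"
      unfolding S0_def using x Z(2) nrm_measurable[OF x] by blast
  qed
  have "\<exists>S\<in>{S. hb_cone S \<and> S0 \<subseteq> S}. \<forall>S'\<in>{S. hb_cone S \<and> S0 \<subseteq> S}. S \<subseteq> S' \<longrightarrow> S' = S"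
  proof (rule subset_Zorn_nonempty)
    show "{S. hb_cone S \<and> S0 \<subseteq> S} \<noteq> {}" using S0 by blast
    fix \<C> assume c: "\<C> \<noteq> {}" "subset.chain {S. hb_cone S \<and> S0 \<subseteq> S} \<C>"
    then have "hb_cone (\<Union>\<C>)" by (intro hb_cone_Union) (auto simp: subset.chain_def)
    moreover have "S0 \<subseteq> \<Union>\<C>" using c by (fastforce simp: subset_chain_def)
    ultimately show "\<Union>\<C> \<in> {S. hb_cone S \<and> S0 \<subseteq> S}" by blast
  qed
  then obtain S where "S \<in> {S. hb_cone S \<and> S0 \<subseteq> S}"
    and S_max: "\<forall>S'\<in>{S. hb_cone S \<and> S0 \<subseteq> S}. S \<subseteq> S' \<longrightarrow> S' = S"
    by (elim bexE)
  then have S: "hb_cone S" "S0 \<subseteq> S" by simp_all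
  have max: "\<forall>S'. hb_cone S' \<longrightarrow> S \<subseteq> S' \<longrightarrow> S' = S"
    using S_max S(2) by simp
  note D = hb_coneD[OF S(1)] and opp = hb_coneD_opposite[OF S(1)] and mem = maximal_hb_cone_mem[OF S(1) max]
  \<comment> \<open>The fibre over x is bounded below, because the norm of -x lies over -x. With s
    its essential infimum, maximality puts both (x, s) and (-x, -s) into \<open>S\<close>.\<close>
  have ex: "\<exists>\<xi>. (x, \<xi>) \<in> S \<and> (\<ominus>\<^bsub>E\<^esub> x, \<lambda>\<omega>. - \<xi> \<omega>) \<in> S" if x: "x \<in> carrier E" for x
  proof -
    let ?L = "{\<xi>. (x, \<xi>) \<in> S}"
    have mx: "\<ominus>\<^bsub>E\<^esub> x \<in> carrier E" using x by simp
    have L: "?L \<subseteq> borel_measurable M" "?L \<noteq> {}" using D(2) D(7)[OF x] by blast+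
    have l: "(\<lambda>\<omega>. - nrm (\<ominus>\<^bsub>E\<^esub> x) \<omega>) \<in> borel_measurable M" using mx by measurable
    have lb: "AE \<omega> in M. - nrm (\<ominus>\<^bsub>E\<^esub> x) \<omega> \<le> \<xi> \<omega>" if "\<xi> \<in> ?L" for \<xi>
      using opp[of x \<xi>, OF _ D(7)[OF mx]] that by (auto elim!: eventually_mono)
    obtain s where s: "s \<in> borel_measurable M" "\<And>\<xi>. \<xi> \<in> ?L \<Longrightarrow> AE \<omega> in M. s \<omega> \<le> \<xi> \<omega>"
      "\<And>h. h \<in> borel_measurable M \<Longrightarrow> (\<And>\<xi>. \<xi> \<in> ?L \<Longrightarrow> AE \<omega> in M. h \<omega> \<le> \<xi> \<omega>) \<Longrightarrow> AE \<omega> in M. h \<omega> \<le> s \<omega>"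
    proof (rule ess_inf_real[OF L l])
      show "AE \<omega> in M. - nrm (\<ominus>\<^bsub>E\<^esub> x) \<omega> \<le> \<xi> \<omega>" if "\<xi> \<in> ?L" for \<xi> using lb[OF that] .
    qed (blast intro: that)
    have "(x, s) \<in> S"
    proof (rule mem[OF x s(1)])
      fix \<zeta> assume \<zeta>: "(\<ominus>\<^bsub>E\<^esub> x, \<zeta>) \<in> S"
      have "AE \<omega> in M. - \<zeta> \<omega> \<le> s \<omega>"
      proof (rule s(3))
        show "(\<lambda>\<omega>. - \<zeta> \<omega>) \<in> borel_measurable M" using D(2)[OF \<zeta>] by simp
        show "AE \<omega> in M. - \<zeta> \<omega> \<le> \<xi> \<omega>" if "\<xi> \<in> ?L" for \<xi>
          using opp[of x \<xi>, OF _ \<zeta>] that by (auto elim!: eventually_mono)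
      qed
      then show "AE \<omega> in M. 0 \<le> s \<omega> + \<zeta> \<omega>" by (auto elim!: eventually_mono)
    qed
    moreover have "(\<ominus>\<^bsub>E\<^esub> x, \<lambda>\<omega>. - s \<omega>) \<in> S"
    proof (rule mem[OF mx])
      fix \<zeta> assume "(\<ominus>\<^bsub>E\<^esub> (\<ominus>\<^bsub>E\<^esub> x), \<zeta>) \<in> S"
      then have "\<zeta> \<in> ?L" using x by simp
      from s(2)[OF this] show "AE \<omega> in M. 0 \<le> - s \<omega> + \<zeta> \<omega>" by (auto elim!: eventually_mono)
    qed (use s(1) in simp)
    ultimately show ?thesis by blast
  qed
  define u where "u x = (SOME \<xi>. (x, \<xi>) \<in> S \<and> (\<ominus>\<^bsub>E\<^esub> x, \<lambda>\<omega>. - \<xi> \<omega>) \<in> S)" for x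
  have u: "(x, u x) \<in> S" "(\<ominus>\<^bsub>E\<^esub> x, \<lambda>\<omega>. - u x \<omega>) \<in> S" if "x \<in> carrier E" for x
    using someI_ex[OF ex[OF that]] by (auto simp: u_def)
  have ueq: "AE \<omega> in M. u x \<omega> = \<xi> \<omega>" if x: "x \<in> carrier E" and "(x, \<xi>) \<in> S" "(\<ominus>\<^bsub>E\<^esub> x, \<lambda>\<omega>. - \<xi> \<omega>) \<in> S" for x \<xi>
    using opp[OF u(1)[OF x] that(3)] opp[OF that(2) u(2)[OF x]] by eventually_elim simp
  have add: "AE \<omega> in M. u (x \<oplus>\<^bsub>E\<^esub> y) \<omega> = u x \<omega> + u y \<omega>" if x: "x \<in> carrier E" and y: "y \<in> carrier E" for x y
    using D(3)[OF u(1)[OF x] u(1)[OF y]] D(3)[OF u(2)[OF x] u(2)[OF y]] x y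
    by (intro ueq) (simp_all add: M.minus_add M.a_comm)
  have scale: "AE \<omega> in M. u (t \<star>\<^sub>R x) \<omega> = t \<omega> * u x \<omega>"
    if x: "x \<in> carrier E" and t: "t \<in> borel_measurable M" "\<And>\<omega>. 0 < t \<omega>" for x t
    using D(4)[OF u(1)[OF x] t] D(4)[OF u(2)[OF x] t] x t
    by (intro ueq) (simp_all add: rscl_minus_right rscl_closed)
  have le: "AE \<omega> in M. u x \<omega> \<le> nrm x \<omega>" if x: "x \<in> carrier E" for x
    using opp[OF D(7)[OF x] u(2)[OF x]] by eventually_elim simp
  show ?thesis
  proof (rule that[of u])
    show "u x \<in> borel_measurable M" if "x \<in> carrier E" for x using D(2) u(1) that by blast
    show "AE \<omega> in M. u (x \<oplus>\<^bsub>E\<^esub> y) \<omega> = u x \<omega> + u y \<omega>" if "x \<in> carrier E" "y \<in> carrier E" for x y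
      using add that .
    show "AE \<omega> in M. u (t \<star>\<^sub>R x) \<omega> = t \<omega> * u x \<omega>" if t: "t \<in> borel_measurable M" and x: "x \<in> carrier E" for t x
    proof -
      \<comment> \<open>t is the difference of two everywhere positive functions, to which positive
        homogeneity applies.\<close>
      let ?a = "\<lambda>\<omega>. \<bar>t \<omega>\<bar> + 1" and ?b = "\<lambda>\<omega>. \<bar>t \<omega>\<bar> + 1 - t \<omega>"
      have m: "?a \<in> borel_measurable M" "?b \<in> borel_measurable M" using t by auto
      have p: "0 < ?a \<omega>" "0 < ?b \<omega>" for \<omega> by (auto simp: abs_if)
      have "?a \<star>\<^sub>R x = t \<star>\<^sub>R x \<oplus>\<^bsub>E\<^esub> ?b \<star>\<^sub>R x" using rscl_add_left[OF t m(2) x] by simp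
      with add[OF rscl_closed[OF t x] rscl_closed[OF m(2) x]]
      have "AE \<omega> in M. u (?a \<star>\<^sub>R x) \<omega> = u (t \<star>\<^sub>R x) \<omega> + u (?b \<star>\<^sub>R x) \<omega>" by simp
      then show ?thesis using scale[OF x m(1) p(1)] scale[OF x m(2) p(2)]
        by eventually_elim (simp add: algebra_simps)
    qed
    show "AE \<omega> in M. \<bar>u x \<omega>\<bar> \<le> nrm x \<omega>" if x: "x \<in> carrier E" for x
    proof -
      have mx: "\<ominus>\<^bsub>E\<^esub> x \<in> carrier E" using x by simp
      show ?thesis using le[OF x] opp[OF u(1)[OF x] D(7)[OF mx]] nrm_uminus[OF x] by eventually_elim simp
    qed
    show "AE \<omega> in M. u z \<omega> = nrm z \<omega>" if z: "z \<in> Z" for z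
    proof -
      have "AE \<omega> in M. nrm \<zero>\<^bsub>E\<^esub> \<omega> - nrm z \<omega> \<le> - nrm z \<omega>" using nrm_zero by eventually_elim simp
      moreover have "\<ominus>\<^bsub>E\<^esub> z = \<zero>\<^bsub>E\<^esub> \<oplus>\<^bsub>E\<^esub> \<ominus>\<^bsub>E\<^esub> z" using ZE[OF z] by simp
      moreover have "(\<lambda>\<omega>. - nrm z \<omega>) \<in> borel_measurable M" using nrm_measurable[OF ZE[OF z]] by simp
      ultimately have "(\<ominus>\<^bsub>E\<^esub> z, \<lambda>\<omega>. - nrm z \<omega>) \<in> S0"
        unfolding S0_def using z M.zero_closed by blast
      then have "(\<ominus>\<^bsub>E\<^esub> z, \<lambda>\<omega>. - nrm z \<omega>) \<in> S" using S(2) by blast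
      from opp[OF u(1)[OF ZE[OF z]] this] le[OF ZE[OF z]] show ?thesis by eventually_elim simp
    qed
  qed
qed

end

section \<open>The random conjugate space\<close>

text \<open>By Frobenius' theorem only the real and the complex field have both of the type classes below,
  and \<open>conj_elt\<close> is complex conjugation.\<close>

definition conj_elt :: "'k::{real_normed_field, real_inner} \<Rightarrow> 'k" where
  "conj_elt a = of_real ((norm a)\<^sup>2) * inverse a"

text \<open>Multiplicativity of the norm makes multiplication by a fixed element a similarity;
  polarisation carries this over to the inner product.\<close>

lemma inner_mult_mult:
  fixes a x y :: "'k::{real_normed_field, real_inner}"
  shows "inner (a * x) (a * y) = (norm a)\<^sup>2 * inner x y"
proof -
  have "norm (a * x + a * y) = norm a * norm (x + y)" by (simp add: norm_mult flip: distrib_left)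
  then show ?thesis
    by (simp add: dot_norm[of "a * x"] dot_norm[of x] norm_mult power_mult_distrib right_diff_distrib diff_divide_distrib)
qed

text \<open>\<open>inner 1\<close> plays the role of the real part, so this is the familiar Re (conj
  a b). It comes from factoring a out of both arguments of the inner product.\<close>

lemma inner_conj_elt:
  fixes a b :: "'k::{real_normed_field, real_inner}"
  shows "inner a b = inner 1 (conj_elt a * b)"
proof (cases "a = 0")
  case False
  have "inner a b = inner (a * 1) (a * (inverse a * b))" using False by (simp flip: mult.assoc)
  also have "\<dots> = (norm a)\<^sup>2 * inner 1 (inverse a * b)" by (rule inner_mult_mult)
  also have "\<dots> = inner 1 (conj_elt a * b)"
    by (simp only: conj_elt_def mult_scaleR_left inner_scaleR_right flip: scaleR_conv_of_real)
  finally show ?thesis .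
qed (simp add: conj_elt_def)

lemma norm_conj_elt [simp]: "norm (conj_elt a) = norm a"
  by (cases "a = 0") (simp_all add: conj_elt_def norm_mult norm_inverse power2_eq_square)

lemma conj_elt_conj_elt [simp]: "conj_elt (conj_elt a) = a"
proof (cases "a = 0")
  case False
  have "conj_elt (conj_elt a) = of_real ((norm a)\<^sup>2) * inverse (of_real ((norm a)\<^sup>2) * inverse a)"
    unfolding conj_elt_def[of "conj_elt a"] norm_conj_elt by (simp add: conj_elt_def)
  then show ?thesis using False by (simp add: field_simps)
qed (simp add: conj_elt_def)

lemma conj_elt_one [simp]: "conj_elt 1 = 1"
  by (simp add: conj_elt_def)

text \<open>Nondegeneracy of the real part: the test element c = inverse (a - b) would give the
  difference real part 1.\<close>

lemma conj_elt_eqI: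
  fixes a b :: "'k::{real_normed_field, real_inner}"
  assumes "\<And>c. inner 1 (a * c) = inner 1 (b * c)"
  shows "a = b"
proof (rule ccontr)
  assume "a \<noteq> b"
  then have "inner 1 ((a - b) * inverse (a - b)) = (1::real)" by (simp add: dot_square_norm)
  then show False
    using assms[of "inverse (a - b)"] by (simp add: left_diff_distrib inner_diff_right)
qed

text \<open>Additivity is invisible in a formula with an inverse. It is inherited from the
  bilinearity of the inner product, because the real functional b -> Re (conj a b) determines conj
  a.\<close>

lemma linear_conj_elt: "linear (conj_elt :: 'k::{real_normed_field, real_inner} \<Rightarrow> 'k)"
proof (rule linearI)
  show "conj_elt (a + b) = conj_elt a + conj_elt b" for a b :: 'k
    by (rule conj_elt_eqI)
      (simp add: inner_conj_elt[symmetric] inner_add_left inner_add_right distrib_right)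
  show "conj_elt (r *\<^sub>R a) = r *\<^sub>R conj_elt a" for r and a :: 'k
    by (rule conj_elt_eqI) (simp add: inner_conj_elt[symmetric])
qed

lemma conj_elt_measurable [measurable]:
  fixes f :: "'w \<Rightarrow> 'k::{real_normed_field, euclidean_space}"
  assumes "f \<in> borel_measurable M"
  shows "(\<lambda>\<omega>. conj_elt (f \<omega>)) \<in> borel_measurable M"
proof -
  have "bounded_linear (conj_elt :: 'k \<Rightarrow> 'k)" by (rule linear_conv_bounded_linear[THEN iffD1, OF linear_conj_elt])
  then have "(conj_elt :: 'k \<Rightarrow> 'k) \<in> borel_measurable borel"
    by (rule borel_measurable_continuous_onI[OF linear_continuous_on])
  then show ?thesis using assms by (rule measurable_compose_rev)
qed

section \<open>Dominating sets and lattice operations in L0\<close>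

text \<open>Only membership of the values in \<open>L0_set M\<close> is assumed, so that it serves E
  and its conjugate module alike.\<close>

lemma dominating_set_iff:
  assumes "\<And>x. x \<in> carrier E \<Longrightarrow> f x \<in> L0_set M" "\<And>x. x \<in> carrier E \<Longrightarrow> rnorm E x \<in> L0_set M"
  shows "\<xi> \<in> dominating_set M E f \<longleftrightarrow> \<xi> \<in> L0_set M \<and> (AE \<omega> in M. 0 \<le> L0_rep \<xi> \<omega>) \<and>
    (\<forall>x\<in>carrier E. AE \<omega> in M. norm (L0_rep (f x) \<omega>) \<le> L0_rep \<xi> \<omega> * L0_rep (rnorm E x) \<omega>)"
proof -
  have "L0_le M (L0_abs M (f x)) (\<xi> \<otimes>\<^bsub>L0 M\<^esub> rnorm E x) \<longleftrightarrow>
    (AE \<omega> in M. norm (L0_rep (f x) \<omega>) \<le> L0_rep \<xi> \<omega> * L0_rep (rnorm E x) \<omega>)"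
    if "x \<in> carrier E" "\<xi> \<in> L0_set M" for x
  proof -
    have "AE \<omega> in M. L0_rep (L0_abs M (f x)) \<omega> \<le> L0_rep (\<xi> \<otimes>\<^bsub>L0 M\<^esub> rnorm E x) \<omega> \<longleftrightarrow>
      norm (L0_rep (f x) \<omega>) \<le> L0_rep \<xi> \<omega> * L0_rep (rnorm E x) \<omega>"
      using L0_rep_abs[OF assms(1)[OF that(1)]] L0_rep_mult[OF that(2) assms(2)[OF that(1)]]
      by eventually_elim simp
    then show ?thesis unfolding L0_le_iff by (rule eventually_subst)
  qed
  then show ?thesis unfolding dominating_set_def mem_Collect_eq L0_nonneg_iff by blast
qed

text \<open>The lattice supremum is a choice operator, so it is enough to exhibit one least upper
  bound: the class of the essential supremum of the representatives.\<close>

lemma L0_ereal_sup: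
  fixes S :: "('w \<Rightarrow> ereal) set set"
  assumes "prob_space M" "S \<subseteq> L0_set M"
  shows "least (L0_order M) (\<Squnion>\<^bsub>L0_order M\<^esub> S) (Upper (L0_order M) S)"
proof -
  interpret prob_space M by fact
  have "L0_rep ` S \<subseteq> borel_measurable M" using assms(2) L0_rep_measurable by blast
  then obtain s where s: "s \<in> borel_measurable M" "\<And>f. f \<in> L0_rep ` S \<Longrightarrow> AE \<omega> in M. f \<omega> \<le> s \<omega>"
    "\<And>h. h \<in> borel_measurable M \<Longrightarrow> (\<And>f. f \<in> L0_rep ` S \<Longrightarrow> AE \<omega> in M. f \<omega> \<le> h \<omega>) \<Longrightarrow> AE \<omega> in M. s \<omega> \<le> h \<omega>"
    by (rule ess_sup_ereal) blast
  note r = L0_rep_class[OF s(1)]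
  have "least (L0_order M) (L0_class M s) (Upper (L0_order M) S)"
    unfolding least_def
  proof (intro conjI ballI)
    show "Upper (L0_order M) S \<subseteq> carrier (L0_order M)" by (auto simp: Upper_def)
    have "AE \<omega> in M. L0_rep x \<omega> \<le> L0_rep (L0_class M s) \<omega>" if "x \<in> S" for x
      using s(2)[of "L0_rep x"] that r by (auto elim: eventually_elim2)
    then show "L0_class M s \<in> Upper (L0_order M) S"
      using s(1) by (auto simp: Upper_def L0_order_def)
    fix y assume "y \<in> Upper (L0_order M) S"
    then have y: "y \<in> L0_set M" "\<And>x. x \<in> S \<Longrightarrow> AE \<omega> in M. L0_rep x \<omega> \<le> L0_rep y \<omega>"
      using assms(2) by (auto simp: Upper_def L0_order_def)
    have "AE \<omega> in M. s \<omega> \<le> L0_rep y \<omega>"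
      by (rule s(3)) (use y L0_rep_measurable in auto)
    then show "L0_class M s \<sqsubseteq>\<^bsub>L0_order M\<^esub> y"
      using r by (auto simp: L0_order_def elim: eventually_elim2)
  qed
  then show ?thesis unfolding Lattice.sup_def by (rule someI)
qed

text \<open>As for the supremum, one greatest lower bound has to be exhibited; the bound 0 keeps the
  essential infimum real-valued.\<close>

lemma L0_nonneg_inf:
  assumes "prob_space M" "S \<subseteq> L0_nonneg M" "S \<noteq> {}"
  shows "greatest (L0_order M) (\<Sqinter>\<^bsub>L0_order M\<^esub> S) (Lower (L0_order M) S)"
proof -
  interpret prob_space M by fact
  have S: "x \<in> L0_set M" "AE \<omega> in M. 0 \<le> L0_rep x \<omega>" if "x \<in> S" for x
    using assms(2) that by (auto simp: L0_nonneg_iff)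
  have m: "L0_rep ` S \<subseteq> borel_measurable M" "L0_rep ` S \<noteq> {}" using S(1) L0_rep_measurable assms(3) by blast+
  obtain s where s: "s \<in> borel_measurable M" "\<And>f. f \<in> L0_rep ` S \<Longrightarrow> AE \<omega> in M. s \<omega> \<le> f \<omega>"
    "\<And>h. h \<in> borel_measurable M \<Longrightarrow> (\<And>f. f \<in> L0_rep ` S \<Longrightarrow> AE \<omega> in M. h \<omega> \<le> f \<omega>) \<Longrightarrow> AE \<omega> in M. h \<omega> \<le> s \<omega>"
  proof (rule ess_inf_real[OF m])
    show "(\<lambda>_. 0) \<in> borel_measurable M" by simp
    show "AE \<omega> in M. 0 \<le> f \<omega>" if "f \<in> L0_rep ` S" for f using that S(2) by auto
  qed (blast intro: that)
  note r = L0_rep_class[OF s(1)]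
  have "greatest (L0_order M) (L0_class M s) (Lower (L0_order M) S)"
    unfolding greatest_def
  proof (intro conjI ballI)
    show "Lower (L0_order M) S \<subseteq> carrier (L0_order M)" by (auto simp: Lower_def)
    have "AE \<omega> in M. L0_rep (L0_class M s) \<omega> \<le> L0_rep x \<omega>" if "x \<in> S" for x
      using s(2)[of "L0_rep x"] that r by (auto elim: eventually_elim2)
    then show "L0_class M s \<in> Lower (L0_order M) S"
      using s(1) by (auto simp: Lower_def L0_order_def)
    fix y assume "y \<in> Lower (L0_order M) S"
    then have y: "y \<in> L0_set M" "\<And>x. x \<in> S \<Longrightarrow> AE \<omega> in M. L0_rep y \<omega> \<le> L0_rep x \<omega>"
      using S(1) by (auto simp: Lower_def L0_order_def)
    have "AE \<omega> in M. L0_rep y \<omega> \<le> s \<omega>"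
      by (rule s(3)) (use y L0_rep_measurable in auto)
    then show "y \<sqsubseteq>\<^bsub>L0_order M\<^esub> L0_class M s"
      using r by (auto simp: L0_order_def elim: eventually_elim2)
  qed
  then show ?thesis unfolding Lattice.inf_def by (rule someI)
qed

context rn_module_euclidean
begin

abbreviation conj_module :: "('w, 'k, 'e \<Rightarrow> ('w \<Rightarrow> 'k) set) rn_module" where
  "conj_module \<equiv> random_conjugate M E"

lemma dominating_set_conj:
  assumes "f \<in> carrier conj_module"
  shows "\<xi> \<in> dominating_set M E f \<longleftrightarrow> \<xi> \<in> L0_set M \<and> (AE \<omega> in M. 0 \<le> L0_rep \<xi> \<omega>) \<and>
    (\<forall>x\<in>carrier E. AE \<omega> in M. norm (L0_rep (f x) \<omega>) \<le> L0_rep \<xi> \<omega> * nrm x \<omega>)"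
  using assms by (intro dominating_set_iff rnorm_L0) (auto simp: random_conjugate_def)

lemma conjD:
  assumes f: "f \<in> carrier conj_module"
  shows conj_L0: "x \<in> carrier E \<Longrightarrow> f x \<in> L0_set M"
    and conj_measurable: "x \<in> carrier E \<Longrightarrow> L0_rep (f x) \<in> borel_measurable M"
    and conj_extensional: "f \<in> extensional (carrier E)"
    and conj_add: "x \<in> carrier E \<Longrightarrow> y \<in> carrier E \<Longrightarrow>
      AE \<omega> in M. L0_rep (f (x \<oplus>\<^bsub>E\<^esub> y)) \<omega> = L0_rep (f x) \<omega> + L0_rep (f y) \<omega>"
    and conj_scl: "t \<in> borel_measurable M \<Longrightarrow> x \<in> carrier E \<Longrightarrow>
      AE \<omega> in M. L0_rep (f (t \<star> x)) \<omega> = t \<omega> * L0_rep (f x) \<omega>"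
proof -
  have L: "f x \<in> L0_set M" if "x \<in> carrier E" for x
    using f that by (auto simp: random_conjugate_def)
  show "x \<in> carrier E \<Longrightarrow> f x \<in> L0_set M" "x \<in> carrier E \<Longrightarrow> L0_rep (f x) \<in> borel_measurable M"
    using L L0_rep_measurable by blast+
  show "f \<in> extensional (carrier E)" using f by (auto simp: random_conjugate_def PiE_def)
  show "AE \<omega> in M. L0_rep (f (x \<oplus>\<^bsub>E\<^esub> y)) \<omega> = L0_rep (f x) \<omega> + L0_rep (f y) \<omega>"
    if "x \<in> carrier E" "y \<in> carrier E"
    using f that L0_rep_add[OF L[OF that(1)] L[OF that(2)]] by (simp add: random_conjugate_def)
  show "AE \<omega> in M. L0_rep (f (t \<star> x)) \<omega> = t \<omega> * L0_rep (f x) \<omega>"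
    if t: "t \<in> borel_measurable M" and x: "x \<in> carrier E"
  proof -
    have "f (t \<star> x) = L0_class M t \<otimes>\<^bsub>L0 M\<^esub> f x" using f t x by (simp add: random_conjugate_def)
    then show ?thesis
      using L0_rep_mult[OF L0_class_in[OF t] L[OF x]] L0_rep_class[OF t] by (auto elim: eventually_elim2)
  qed
qed

lemma conj_dominated:
  assumes f: "f \<in> carrier conj_module"
  obtains \<xi> where "\<xi> \<in> borel_measurable M" "AE \<omega> in M. 0 \<le> \<xi> \<omega>"
    "\<And>x. x \<in> carrier E \<Longrightarrow> AE \<omega> in M. norm (L0_rep (f x) \<omega>) \<le> \<xi> \<omega> * nrm x \<omega>"
proof -
  obtain \<xi> where "\<xi> \<in> dominating_set M E f" using f by (auto simp: random_conjugate_def)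
  then show ?thesis using that[of "L0_rep \<xi>"] L0_rep_measurable by (auto simp: dominating_set_conj[OF f])
qed

text \<open>Lets the laws of a functional be checked on representatives almost everywhere instead of
  on classes.\<close>

lemma conjI_function:
  fixes \<phi> :: "'e \<Rightarrow> 'w \<Rightarrow> 'k"
  assumes m: "\<And>x. x \<in> carrier E \<Longrightarrow> \<phi> x \<in> borel_measurable M"
    and add: "\<And>x y. x \<in> carrier E \<Longrightarrow> y \<in> carrier E \<Longrightarrow> AE \<omega> in M. \<phi> (x \<oplus>\<^bsub>E\<^esub> y) \<omega> = \<phi> x \<omega> + \<phi> y \<omega>"
    and scl: "\<And>t x. t \<in> borel_measurable M \<Longrightarrow> x \<in> carrier E \<Longrightarrow> AE \<omega> in M. \<phi> (t \<star> x) \<omega> = t \<omega> * \<phi> x \<omega>"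
    and \<xi>: "\<xi> \<in> borel_measurable M" "AE \<omega> in M. 0 \<le> \<xi> \<omega>"
      "\<And>x. x \<in> carrier E \<Longrightarrow> AE \<omega> in M. norm (\<phi> x \<omega>) \<le> \<xi> \<omega> * nrm x \<omega>"
  shows "(\<lambda>x\<in>carrier E. L0_class M (\<phi> x)) \<in> carrier conj_module"
proof -
  let ?f = "\<lambda>x\<in>carrier E. L0_class M (\<phi> x)"
  have "?f (\<zeta> \<odot>\<^bsub>E\<^esub> x) = \<zeta> \<otimes>\<^bsub>L0 M\<^esub> ?f x" if z: "\<zeta> \<in> L0_set M" and x: "x \<in> carrier E" for \<zeta> x
  proof -
    have zm: "L0_rep \<zeta> \<in> borel_measurable M" using z by (rule L0_rep_measurable)
    have "?f (L0_rep \<zeta> \<star> x) = L0_class M (L0_rep \<zeta>) \<otimes>\<^bsub>L0 M\<^esub> ?f x"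
      using x m scl[OF zm x] zm scl_closed[OF zm x]
      by (simp add: L0_class_mult) (intro L0_class_eqI borel_measurable_times; simp)
    then show ?thesis by (simp add: L0_class_rep[OF z])
  qed
  moreover have "?f (x \<oplus>\<^bsub>E\<^esub> y) = ?f x \<oplus>\<^bsub>L0 M\<^esub> ?f y" if "x \<in> carrier E" "y \<in> carrier E" for x y
    using that m add[OF that]
    by (simp add: L0_class_add) (intro L0_class_eqI borel_measurable_add; simp)
  moreover have "L0_class M \<xi> \<in> dominating_set M E ?f"
  proof (subst dominating_set_iff)
    have "AE \<omega> in M. norm (L0_rep (?f x) \<omega>) \<le> L0_rep (L0_class M \<xi>) \<omega> * nrm x \<omega>" if x: "x \<in> carrier E" for x
      using \<xi>(3)[OF x] L0_rep_class[OF \<xi>(1)] L0_rep_class[OF m[OF x]]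
      by eventually_elim (simp add: x)
    moreover have "AE \<omega> in M. 0 \<le> L0_rep (L0_class M \<xi>) \<omega>"
      using \<xi>(2) L0_rep_class[OF \<xi>(1)] by eventually_elim simp
    ultimately show "L0_class M \<xi> \<in> L0_set M \<and> (AE \<omega> in M. 0 \<le> L0_rep (L0_class M \<xi>) \<omega>) \<and>
      (\<forall>x\<in>carrier E. AE \<omega> in M. norm (L0_rep (?f x) \<omega>) \<le> L0_rep (L0_class M \<xi>) \<omega> * nrm x \<omega>)"
      using \<xi>(1) by simp
  qed (simp_all add: m rnorm_L0)
  ultimately show ?thesis
    using m by (auto simp: random_conjugate_def)
qed

text \<open>Coordinate form of the classical f x = u x - i u (i x): over the basis 1, i the sum of u
  (conj b x) b is exactly this, and over the reals it is u itself. The sum is characterised by <c, f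
  x> = u (conj c x); homogeneity over K follows by testing this against a basis, and c = 1 gives the
  real part.\<close>

lemma conj_of_real_functional:
  fixes u :: "'e \<Rightarrow> 'w \<Rightarrow> real"
  assumes m: "\<And>x. x \<in> carrier E \<Longrightarrow> u x \<in> borel_measurable M"
    and add: "\<And>x y. x \<in> carrier E \<Longrightarrow> y \<in> carrier E \<Longrightarrow> AE \<omega> in M. u (x \<oplus>\<^bsub>E\<^esub> y) \<omega> = u x \<omega> + u y \<omega>"
    and scl: "\<And>t x. t \<in> borel_measurable M \<Longrightarrow> x \<in> carrier E \<Longrightarrow> AE \<omega> in M. u (t \<star>\<^sub>R x) \<omega> = t \<omega> * u x \<omega>"
    and le: "\<And>x. x \<in> carrier E \<Longrightarrow> AE \<omega> in M. \<bar>u x \<omega>\<bar> \<le> nrm x \<omega>"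
  obtains f where "f \<in> carrier conj_module"
    "\<And>x. x \<in> carrier E \<Longrightarrow> AE \<omega> in M. inner 1 (L0_rep (f x) \<omega>) = u x \<omega>"
proof -
  have sclm: "(\<lambda>_. d) \<star> x \<in> carrier E" if "x \<in> carrier E" for d x using that by (simp add: scl_closed)
  define \<phi> :: "'e \<Rightarrow> 'w \<Rightarrow> 'k" where "\<phi> x \<omega> = (\<Sum>b\<in>Basis. u ((\<lambda>_. conj_elt b) \<star> x) \<omega> *\<^sub>R b)" for x \<omega>
  have \<phi>m: "\<phi> x \<in> borel_measurable M" if "x \<in> carrier E" for x
    unfolding \<phi>_def using m[OF sclm[OF that]] by measurable
  have usum: "AE \<omega> in M. u ((\<lambda>\<omega>. \<Sum>b\<in>F. s b \<omega> *\<^sub>R d b) \<star> x) \<omega> = (\<Sum>b\<in>F. s b \<omega> * u ((\<lambda>_. d b) \<star> x) \<omega>)"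
    if x: "x \<in> carrier E" and F: "finite F" and s: "\<And>b. s b \<in> borel_measurable M"
    for x F and s :: "'k \<Rightarrow> 'w \<Rightarrow> real" and d :: "'k \<Rightarrow> 'k"
    using F
  proof induction
    case empty
    have "(\<lambda>_. 0) \<star> x = (\<lambda>_. 0) \<star>\<^sub>R x" by (simp add: rscl_def)
    then show ?case using scl[of "\<lambda>_. 0" x] x by simp
  next
    case (insert b F)
    let ?S = "\<lambda>\<omega>. \<Sum>b\<in>F. s b \<omega> *\<^sub>R d b"
    have mb: "(\<lambda>\<omega>. s b \<omega> *\<^sub>R d b) \<in> borel_measurable M" "?S \<in> borel_measurable M"
      using s by measurable
    have "(\<lambda>\<omega>. s b \<omega> *\<^sub>R d b) \<star> x = s b \<star>\<^sub>R (\<lambda>_. d b) \<star> x"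
      unfolding rscl_def using scl_scl[OF of_real_measurable[OF s] borel_measurable_const x]
      by (simp add: scaleR_conv_of_real)
    then have 1: "AE \<omega> in M. u ((\<lambda>\<omega>. s b \<omega> *\<^sub>R d b) \<star> x) \<omega> = s b \<omega> * u ((\<lambda>_. d b) \<star> x) \<omega>"
      using scl[OF s sclm[OF x]] by simp
    have "(\<lambda>\<omega>. \<Sum>b\<in>insert b F. s b \<omega> *\<^sub>R d b) \<star> x = (\<lambda>\<omega>. s b \<omega> *\<^sub>R d b) \<star> x \<oplus>\<^bsub>E\<^esub> ?S \<star> x"
      using insert.hyps scl_add_left[OF mb x] by simp
    then show ?case
      using add[OF scl_closed[OF mb(1) x] scl_closed[OF mb(2) x]] 1 insert.IH insert.hyps
      by (auto elim!: eventually_elim2)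
  qed
  \<comment> \<open>The vector c may depend on the point: homogeneity under a random scalar t is
    obtained from the measurable choice c = conj (conj b t).\<close>
  have inner_\<phi>: "AE \<omega> in M. inner (c \<omega>) (\<phi> x \<omega>) = u ((\<lambda>\<omega>. conj_elt (c \<omega>)) \<star> x) \<omega>"
    if x: "x \<in> carrier E" and c: "c \<in> borel_measurable M" for x c
  proof -
    have cs: "conj_elt (c \<omega>) = (\<Sum>b\<in>Basis. inner (c \<omega>) b *\<^sub>R conj_elt b)" for \<omega>
    proof -
      have "conj_elt (c \<omega>) = conj_elt (\<Sum>b\<in>Basis. inner (c \<omega>) b *\<^sub>R b)" by (simp add: euclidean_representation)
      then show ?thesis by (simp add: linear_sum[OF linear_conj_elt] linear_scale[OF linear_conj_elt])
    qed
    have "AE \<omega> in M. u ((\<lambda>\<omega>. \<Sum>b\<in>Basis. inner (c \<omega>) b *\<^sub>R conj_elt b) \<star> x) \<omega> =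
        (\<Sum>b\<in>Basis. inner (c \<omega>) b * u ((\<lambda>_. conj_elt b) \<star> x) \<omega>)"
      using c by (intro usum[OF x]) auto
    then show ?thesis unfolding cs[symmetric]
      by eventually_elim (simp add: \<phi>_def inner_sum_right mult.commute)
  qed
  have "(\<lambda>x\<in>carrier E. L0_class M (\<phi> x)) \<in> carrier conj_module"
  proof (rule conjI_function[OF \<phi>m])
    show "AE \<omega> in M. \<phi> (x \<oplus>\<^bsub>E\<^esub> y) \<omega> = \<phi> x \<omega> + \<phi> y \<omega>" if x: "x \<in> carrier E" and y: "y \<in> carrier E" for x y
    proof -
      have "AE \<omega> in M. \<forall>b\<in>Basis. u ((\<lambda>_. conj_elt b) \<star> (x \<oplus>\<^bsub>E\<^esub> y)) \<omega> =
          u ((\<lambda>_. conj_elt b) \<star> x) \<omega> + u ((\<lambda>_. conj_elt (b::'k)) \<star> y) \<omega>"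
        using add[OF sclm[OF x] sclm[OF y]] x y by (intro AE_finite_allI) (simp_all add: scl_add_right)
      then show ?thesis
        by eventually_elim (simp add: \<phi>_def scaleR_add_left sum.distrib)
    qed
    show "AE \<omega> in M. \<phi> (t \<star> x) \<omega> = t \<omega> * \<phi> x \<omega>" if t: "t \<in> borel_measurable M" and x: "x \<in> carrier E" for t x
    proof -
      have "AE \<omega> in M. inner b (\<phi> (t \<star> x) \<omega>) = inner b (t \<omega> * \<phi> x \<omega>)" for b
      proof -
        have bt: "(\<lambda>\<omega>. conj_elt b * t \<omega>) \<in> borel_measurable M" using t by measurable
        have "AE \<omega> in M. inner b (\<phi> (t \<star> x) \<omega>) = u ((\<lambda>_. conj_elt b) \<star> t \<star> x) \<omega>"
          using inner_\<phi>[OF scl_closed[OF t x], of "\<lambda>_. b"] by simp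
        moreover have "(\<lambda>_. conj_elt b) \<star> t \<star> x = (\<lambda>\<omega>. conj_elt b * t \<omega>) \<star> x"
          using t x by (intro scl_scl) auto
        moreover have "AE \<omega> in M. inner (conj_elt (conj_elt b * t \<omega>)) (\<phi> x \<omega>) = u ((\<lambda>\<omega>. conj_elt b * t \<omega>) \<star> x) \<omega>"
          using inner_\<phi>[OF x conj_elt_measurable[OF bt]] by simp
        moreover have "inner (conj_elt (conj_elt b * t \<omega>)) (\<phi> x \<omega>) = inner b (t \<omega> * \<phi> x \<omega>)" for \<omega>
          by (simp add: inner_conj_elt[of b] inner_conj_elt[of "conj_elt _"] mult.assoc)
        ultimately show ?thesis by (auto elim: eventually_elim2)
      qed
      then have "AE \<omega> in M. \<forall>b\<in>Basis. inner b (\<phi> (t \<star> x) \<omega>) = inner b (t \<omega> * \<phi> x \<omega>)"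
        by (intro AE_finite_allI) auto
      then show ?thesis by eventually_elim (auto intro: euclidean_eqI simp: inner_commute)
    qed
    \<comment> \<open>A crude bound by the dimension suffices, because the conjugate module asks
      only for some dominating function.\<close>
    show "AE \<omega> in M. norm (\<phi> x \<omega>) \<le> real DIM('k) * nrm x \<omega>" if x: "x \<in> carrier E" for x
    proof -
      have "AE \<omega> in M. \<bar>u ((\<lambda>_. conj_elt b) \<star> x) \<omega>\<bar> \<le> nrm x \<omega>" if "b \<in> Basis" for b :: 'k
        using le[OF sclm[OF x, of "conj_elt b"]] nrm_scl[OF borel_measurable_const x, of "conj_elt b"]
        by eventually_elim (simp add: that)
      then have "AE \<omega> in M. \<forall>b\<in>(Basis::'k set). \<bar>u ((\<lambda>_. conj_elt b) \<star> x) \<omega>\<bar> \<le> nrm x \<omega>"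
        by (intro AE_finite_allI) auto
      then show ?thesis
      proof eventually_elim
        case (elim \<omega>)
        have "norm (\<phi> x \<omega>) \<le> (\<Sum>b\<in>(Basis::'k set). norm (u ((\<lambda>_. conj_elt b) \<star> x) \<omega> *\<^sub>R b))"
          unfolding \<phi>_def by (rule norm_sum)
        also have "\<dots> \<le> (\<Sum>b\<in>(Basis::'k set). nrm x \<omega>)" using elim by (intro sum_mono) simp
        finally show ?case by simp
      qed
    qed
  qed simp_all
  moreover have "AE \<omega> in M. inner 1 (L0_rep ((\<lambda>x\<in>carrier E. L0_class M (\<phi> x)) x) \<omega>) = u x \<omega>"
    if x: "x \<in> carrier E" for x
    using inner_\<phi>[OF x, of "\<lambda>_. 1"] L0_rep_class[OF \<phi>m[OF x]] scl_one[OF x] x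
    by (auto elim: eventually_elim2)
  ultimately show ?thesis by (rule that)
qed

section \<open>Neighbourhoods in the topology and full support\<close>

lemma topspace_sigma_c: "topspace (sigma_c M E) = carrier E"
proof -
  have "(\<lambda>_. 1) \<in> borel_measurable M" by simp
  then have "L0_class M (\<lambda>_. 1::real) \<in> L0_pos M"
    using L0_rep_class[of "\<lambda>_. 1::real" M] by (auto simp: L0_pos_iff elim!: eventually_mono)
  then have "sigma_c_open M E (carrier E)"
    unfolding sigma_c_open_def by (intro conjI ballI exI[of _ "{}"] exI[of _ "L0_class M (\<lambda>_. 1)"]) auto
  then show ?thesis
    by (auto simp: topspace_def openin_sigma_c sigma_c_open_def[of M E "_ :: 'e set"])
qed

lemma L0_le_abs_minus_iff:
  assumes "x \<in> L0_set M" "y \<in> L0_set M"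
  shows "L0_le M (L0_abs M (x \<ominus>\<^bsub>L0 M\<^esub> y)) \<epsilon> \<longleftrightarrow>
    (AE \<omega> in M. norm ((L0_rep x \<omega> :: 'k) - L0_rep y \<omega>) \<le> L0_rep \<epsilon> \<omega>)"
proof -
  have "AE \<omega> in M. L0_rep (L0_abs M (x \<ominus>\<^bsub>L0 M\<^esub> y)) \<omega> \<le> L0_rep \<epsilon> \<omega> \<longleftrightarrow>
      norm (L0_rep x \<omega> - L0_rep y \<omega>) \<le> L0_rep \<epsilon> \<omega>"
    using L0_rep_abs[OF L0_minus_closed[OF assms]] L0_rep_minus[OF assms] by eventually_elim simp
  then show ?thesis unfolding L0_le_iff by (rule eventually_subst)
qed

text \<open>The gap between e and the distance of f y from a is almost everywhere positive, so half
  of it is an admissible radius at y; halving also turns the weak inequality of basic neighbourhoods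
  into a strict one. Centre and radius may be arbitrary measurable functions, which is the freedom
  that the discrete sequence exploits.\<close>

lemma sigma_c_open_ball:
  assumes f: "f \<in> carrier conj_module" and a: "a \<in> borel_measurable M" and e: "e \<in> borel_measurable M"
  shows "sigma_c_open M E {y \<in> carrier E. AE \<omega> in M. norm (L0_rep (f y) \<omega> - a \<omega>) < e \<omega>}"
    (is "sigma_c_open M E ?G")
  unfolding sigma_c_open_def
proof (intro conjI ballI)
  show "?G \<subseteq> carrier E" by blast
  fix y assume "y \<in> ?G"
  then have y: "y \<in> carrier E" "AE \<omega> in M. norm (L0_rep (f y) \<omega> - a \<omega>) < e \<omega>" by auto
  define d where "d \<omega> = e \<omega> - norm (L0_rep (f y) \<omega> - a \<omega>)" for \<omega>
  have d: "(\<lambda>\<omega>. d \<omega> / 2) \<in> borel_measurable M" "AE \<omega> in M. 0 < d \<omega>"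
    unfolding d_def using conj_measurable[OF f y(1)] a e y(2) by (auto elim!: eventually_mono)
  have "L0_class M (\<lambda>\<omega>. d \<omega> / 2) \<in> L0_pos M"
    using d(1,2) L0_rep_class[OF d(1)] by (auto simp: L0_pos_iff elim: eventually_elim2)
  moreover have "{z \<in> carrier E. \<forall>f\<in>{f}. L0_le M (L0_abs M (f z \<ominus>\<^bsub>L0 M\<^esub> f y)) (L0_class M (\<lambda>\<omega>. d \<omega> / 2))} \<subseteq> ?G"
  proof
    fix z assume "z \<in> {z \<in> carrier E. \<forall>f\<in>{f}. L0_le M (L0_abs M (f z \<ominus>\<^bsub>L0 M\<^esub> f y)) (L0_class M (\<lambda>\<omega>. d \<omega> / 2))}"
    then have z: "z \<in> carrier E"
      "AE \<omega> in M. norm (L0_rep (f z) \<omega> - L0_rep (f y) \<omega>) \<le> L0_rep (L0_class M (\<lambda>\<omega>. d \<omega> / 2)) \<omega>"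
      using L0_le_abs_minus_iff[OF conj_L0[OF f] conj_L0[OF f y(1)]] by auto
    have "AE \<omega> in M. norm (L0_rep (f z) \<omega> - a \<omega>) < e \<omega>"
      using z(2) L0_rep_class[OF d(1)] d(2)
    proof eventually_elim
      case (elim \<omega>)
      have "norm (L0_rep (f z) \<omega> - a \<omega>) \<le> norm (L0_rep (f z) \<omega> - L0_rep (f y) \<omega>) + norm (L0_rep (f y) \<omega> - a \<omega>)"
        using norm_triangle_ineq[of "L0_rep (f z) \<omega> - L0_rep (f y) \<omega>" "L0_rep (f y) \<omega> - a \<omega>"] by simp
      then show ?case using elim by (simp add: d_def)
    qed
    then show "z \<in> ?G" using z(1) by blast
  qed
  ultimately show "\<exists>F \<epsilon>. finite F \<and> F \<subseteq> carrier conj_module \<and> \<epsilon> \<in> L0_pos M \<and>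
      {z \<in> carrier E. \<forall>f\<in>F. L0_le M (L0_abs M (f z \<ominus>\<^bsub>L0 M\<^esub> f y)) \<epsilon>} \<subseteq> ?G"
    using f by (intro exI[of _ "{f}"] exI[of _ "L0_class M (\<lambda>\<omega>. d \<omega> / 2)"] conjI) auto
qed

text \<open>Otherwise all norms vanish almost everywhere on \<open>A\<close>, and the supremum
  altered to 0 on \<open>A\<close> is still an upper bound. The supremum would then be at most 0 on
  \<open>A\<close>, although it is positive almost everywhere.\<close>

lemma full_supportD:
  assumes full: "full_support M E" and A: "A \<in> sets M" "measure M A > 0"
  obtains x where "x \<in> carrier E" "measure M {\<omega>\<in>A. 0 < nrm x \<omega>} > 0"
proof (rule ccontr)
  assume "\<not> thesis"
  then have "\<forall>x\<in>carrier E. \<not> 0 < measure M {\<omega>\<in>A. 0 < nrm x \<omega>}" using that by blast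
  then have no: "measure M {\<omega>\<in>A. 0 < nrm x \<omega>} = 0" if "x \<in> carrier E" for x
    using that by (simp add: zero_less_measure_iff)
  have le0: "AE \<omega> in M. \<omega> \<in> A \<longrightarrow> nrm x \<omega> \<le> 0" if x: "x \<in> carrier E" for x
  proof -
    have "{\<omega>\<in>A. 0 < nrm x \<omega>} = A \<inter> {\<omega>\<in>space M. 0 < nrm x \<omega>}" using sets.sets_into_space[OF A(1)] by auto
    then have "{\<omega>\<in>A. 0 < nrm x \<omega>} \<in> sets M" using A(1) nrm_measurable[OF x] by (auto intro!: sets.Int)
    then have "{\<omega>\<in>A. 0 < nrm x \<omega>} \<in> null_sets M" using no[OF x] by (auto simp: null_sets_def emeasure_eq_measure)
    from AE_not_in[OF this] show ?thesis by (auto elim!: eventually_mono)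
  qed
  let ?S = "(\<lambda>x. L0_map M ereal (rnorm E x)) ` carrier E"
  have mx: "(\<lambda>\<omega>. ereal (nrm x \<omega>)) \<in> borel_measurable M" if "x \<in> carrier E" for x
    using nrm_measurable[OF that] by measurable
  have S: "?S \<subseteq> L0_set M" using mx by (auto simp: L0_map_def)
  define s where "s = \<Squnion>\<^bsub>L0_order M\<^esub> ?S"
  have least: "least (L0_order M) s (Upper (L0_order M) ?S)"
    unfolding s_def using L0_ereal_sup[OF prob_space_axioms S] .
  then have s: "s \<in> L0_set M" "\<And>x. x \<in> carrier E \<Longrightarrow> AE \<omega> in M. L0_rep (L0_map M ereal (rnorm E x)) \<omega> \<le> L0_rep s \<omega>"
    using S by (auto simp: least_def Upper_def L0_order_def)
  define h where "h \<omega> = (if \<omega> \<in> A then 0 else L0_rep s \<omega>)" for \<omega>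
  have h: "h \<in> borel_measurable M" unfolding h_def using A(1) L0_rep_measurable[OF s(1)] by measurable
  have "L0_class M h \<in> Upper (L0_order M) ?S"
  proof -
    have "AE \<omega> in M. L0_rep (L0_map M ereal (rnorm E x)) \<omega> \<le> L0_rep (L0_class M h) \<omega>" if x: "x \<in> carrier E" for x
      using s(2)[OF x] le0[OF x] L0_rep_class[OF h] L0_rep_class[OF mx[OF x]]
      unfolding L0_map_def by eventually_elim (auto simp: h_def)
    then show ?thesis using h by (auto simp: Upper_def L0_order_def)
  qed
  then have "s \<sqsubseteq>\<^bsub>L0_order M\<^esub> L0_class M h" using least by (auto simp: least_def)
  then have "AE \<omega> in M. L0_rep s \<omega> \<le> L0_rep (L0_class M h) \<omega>" by (simp add: L0_order_def)
  moreover have "AE \<omega> in M. 0 < L0_rep s \<omega>" using full by (simp add: full_support_def s_def)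
  ultimately have "AE \<omega> in M. \<omega> \<notin> A" using L0_rep_class[OF h]
    by eventually_elim (auto simp: h_def split: if_splits)
  then have "A \<in> null_sets M" using A(1) by (simp add: AE_iff_null_sets)
  then show False using A(2) by (simp add: null_sets_def emeasure_eq_measure)
qed

section \<open>Closed discrete sequences in the unit ball\<close>

lemma unit_ball_iff: "x \<in> unit_ball M E \<longleftrightarrow> x \<in> carrier E \<and> (AE \<omega> in M. nrm x \<omega> \<le> 1)"
proof -
  have one: "AE \<omega> in M. L0_rep \<one>\<^bsub>L0 M\<^esub> \<omega> = (1::real)" by (rule L0_rep_one)
  have "AE \<omega> in M. nrm x \<omega> \<le> L0_rep \<one>\<^bsub>L0 M\<^esub> \<omega> \<longleftrightarrow> nrm x \<omega> \<le> 1"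
    using one by eventually_elim simp
  then have "(AE \<omega> in M. nrm x \<omega> \<le> L0_rep \<one>\<^bsub>L0 M\<^esub> \<omega>) \<longleftrightarrow> (AE \<omega> in M. nrm x \<omega> \<le> 1)"
    by (rule eventually_subst)
  then show ?thesis by (simp add: unit_ball_def L0_le_iff)
qed

lemma nrm_diff:
  assumes x: "x \<in> carrier E" and y: "y \<in> carrier E"
  shows "AE \<omega> in M. \<bar>nrm x \<omega> - nrm y \<omega>\<bar> \<le> nrm (x \<oplus>\<^bsub>E\<^esub> \<ominus>\<^bsub>E\<^esub> y) \<omega>"
proof -
  let ?d = "x \<oplus>\<^bsub>E\<^esub> \<ominus>\<^bsub>E\<^esub> y"
  have d: "?d \<in> carrier E" using x y by simp
  have "?d \<oplus>\<^bsub>E\<^esub> y = x" using x y by (simp add: M.a_assoc M.l_neg)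
  with nrm_add[OF d y] have 1: "AE \<omega> in M. nrm x \<omega> \<le> nrm ?d \<omega> + nrm y \<omega>" by simp
  have "\<ominus>\<^bsub>E\<^esub> ?d = y \<oplus>\<^bsub>E\<^esub> \<ominus>\<^bsub>E\<^esub> x" using x y by (simp add: M.minus_add M.a_comm)
  then have "\<ominus>\<^bsub>E\<^esub> ?d \<oplus>\<^bsub>E\<^esub> x = y" using x y by (simp add: M.a_assoc M.l_neg)
  with nrm_add[OF M.a_inv_closed[OF d] x]
  have 2: "AE \<omega> in M. nrm y \<omega> \<le> nrm (\<ominus>\<^bsub>E\<^esub> ?d) \<omega> + nrm x \<omega>" by simp
  show ?thesis using 1 2 nrm_uminus[OF d] by eventually_elim simp
qed

text \<open>If \<open>x\<^sub>n\<close> has norm \<open>1\<close> on \<open>B\<^sub>n\<close> and \<open>0\<close> elsewhere, the norm is additive on the cone of all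
  those elements that are nonnegative multiples of \<open>x\<^sub>n\<close> on each \<open>B\<^sub>n\<close> and vanish outside their union.\<close>

lemma disjoint_normed_sequence_functional:
  fixes B :: "nat \<Rightarrow> 'w set" and x :: "nat \<Rightarrow> 'e"
  assumes B: "disjoint_family B" "\<And>n. B n \<in> sets M"
    and x: "\<And>n. x n \<in> carrier E" "\<And>n. AE \<omega> in M. nrm (x n) \<omega> = indicator (B n) \<omega>"
  obtains f where "f \<in> carrier conj_module"
    "\<And>n. AE \<omega> in M. inner 1 (L0_rep (f (x n)) \<omega>) = indicator (B n) \<omega>"
proof -
  \<comment> \<open>Membership is tested on each \<open>B n\<close> separately, so that no infinite
    sum of the multiples of the \<open>x n\<close> has to exist in E.\<close>
  define P where "P z t \<longleftrightarrow> z \<in> carrier E \<and> (\<forall>n. t n \<in> borel_measurable M \<and> (AE \<omega> in M. 0 \<le> t n \<omega>) \<and>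
      (AE \<omega> in M. \<omega> \<in> B n \<longrightarrow> nrm (z \<oplus>\<^bsub>E\<^esub> \<ominus>\<^bsub>E\<^esub> (t n \<star>\<^sub>R x n)) \<omega> = 0)) \<and>
      (AE \<omega> in M. \<omega> \<notin> (\<Union>n. B n) \<longrightarrow> nrm z \<omega> = 0)" for z t
  define Z where "Z = {z. \<exists>t. P z t}"
  \<comment> \<open>On \<open>B n\<close> the norm of z is its coefficient \<open>t n\<close>.
    Coefficients add, and therefore so do norms on \<open>Z\<close>.\<close>
  have P_nrm: "AE \<omega> in M. (\<forall>n. \<omega> \<in> B n \<longrightarrow> nrm z \<omega> = t n \<omega>) \<and> (\<omega> \<notin> (\<Union>n. B n) \<longrightarrow> nrm z \<omega> = 0)"
    if P: "P z t" for z t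
  proof -
    have "AE \<omega> in M. \<omega> \<in> B n \<longrightarrow> nrm z \<omega> = t n \<omega>" for n
    proof -
      have t: "t n \<in> borel_measurable M" "AE \<omega> in M. 0 \<le> t n \<omega>"
        "AE \<omega> in M. \<omega> \<in> B n \<longrightarrow> nrm (z \<oplus>\<^bsub>E\<^esub> \<ominus>\<^bsub>E\<^esub> (t n \<star>\<^sub>R x n)) \<omega> = 0" and z: "z \<in> carrier E"
        using P by (auto simp: P_def)
      show ?thesis
        using nrm_diff[OF z rscl_closed[OF t(1) x(1)[of n]]] nrm_rscl[OF t(1) x(1)[of n]] x(2)[of n] t(2,3)
        by eventually_elim auto
    qed
    then have "AE \<omega> in M. \<forall>n. \<omega> \<in> B n \<longrightarrow> nrm z \<omega> = t n \<omega>" by (simp add: AE_all_countable)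
    moreover have "AE \<omega> in M. \<omega> \<notin> (\<Union>n. B n) \<longrightarrow> nrm z \<omega> = 0" using P by (simp add: P_def)
    ultimately show ?thesis by (rule AE_conjI)
  qed
  have P_add: "P (z \<oplus>\<^bsub>E\<^esub> z') (\<lambda>n \<omega>. t n \<omega> + t' n \<omega>)" if P: "P z t" "P z' t'" for z t z' t'
    unfolding P_def
  proof (intro conjI allI)
    have z: "z \<in> carrier E" "z' \<in> carrier E" using P by (auto simp: P_def)
    then show "z \<oplus>\<^bsub>E\<^esub> z' \<in> carrier E" by simp
    show "AE \<omega> in M. \<omega> \<notin> (\<Union>n. B n) \<longrightarrow> nrm (z \<oplus>\<^bsub>E\<^esub> z') \<omega> = 0"
      using P_nrm[OF P(1)] P_nrm[OF P(2)] nrm_add[OF z] nrm_nonneg[OF M.a_closed[OF z]]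
      by eventually_elim auto
    fix n
    have t: "t n \<in> borel_measurable M" "AE \<omega> in M. 0 \<le> t n \<omega>"
        "AE \<omega> in M. \<omega> \<in> B n \<longrightarrow> nrm (z \<oplus>\<^bsub>E\<^esub> \<ominus>\<^bsub>E\<^esub> (t n \<star>\<^sub>R x n)) \<omega> = 0"
      and t': "t' n \<in> borel_measurable M" "AE \<omega> in M. 0 \<le> t' n \<omega>"
        "AE \<omega> in M. \<omega> \<in> B n \<longrightarrow> nrm (z' \<oplus>\<^bsub>E\<^esub> \<ominus>\<^bsub>E\<^esub> (t' n \<star>\<^sub>R x n)) \<omega> = 0"
      using P by (auto simp: P_def)
    show "(\<lambda>\<omega>. t n \<omega> + t' n \<omega>) \<in> borel_measurable M" using t t' by simp
    show "AE \<omega> in M. 0 \<le> t n \<omega> + t' n \<omega>" using t(2) t'(2) by eventually_elim simp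
    let ?a = "z \<oplus>\<^bsub>E\<^esub> \<ominus>\<^bsub>E\<^esub> (t n \<star>\<^sub>R x n)" and ?b = "z' \<oplus>\<^bsub>E\<^esub> \<ominus>\<^bsub>E\<^esub> (t' n \<star>\<^sub>R x n)"
    have c: "t n \<star>\<^sub>R x n \<in> carrier E" "t' n \<star>\<^sub>R x n \<in> carrier E" using t t' x by (auto intro: rscl_closed)
    have ab: "?a \<in> carrier E" "?b \<in> carrier E" using z c by auto
    have eq: "(z \<oplus>\<^bsub>E\<^esub> z') \<oplus>\<^bsub>E\<^esub> \<ominus>\<^bsub>E\<^esub> ((\<lambda>\<omega>. t n \<omega> + t' n \<omega>) \<star>\<^sub>R x n) = ?a \<oplus>\<^bsub>E\<^esub> ?b"
      using z c by (simp add: rscl_add_left[OF t(1) t'(1) x(1)] M.minus_add M.a_ac)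
    show "AE \<omega> in M. \<omega> \<in> B n \<longrightarrow> nrm ((z \<oplus>\<^bsub>E\<^esub> z') \<oplus>\<^bsub>E\<^esub> \<ominus>\<^bsub>E\<^esub> ((\<lambda>\<omega>. t n \<omega> + t' n \<omega>) \<star>\<^sub>R x n)) \<omega> = 0"
      unfolding eq using nrm_add[OF ab] nrm_nonneg[OF M.a_closed[OF ab]] t(3) t'(3)
      by eventually_elim auto
  qed
  have P_scl: "P (s \<star>\<^sub>R z) (\<lambda>n \<omega>. s \<omega> * t n \<omega>)"
    if P: "P z t" and s: "s \<in> borel_measurable M" "\<And>\<omega>. 0 < s \<omega>" for z t s
    unfolding P_def
  proof (intro conjI allI)
    have z: "z \<in> carrier E" using P by (auto simp: P_def)
    then show "s \<star>\<^sub>R z \<in> carrier E" by (rule rscl_closed[OF s(1)])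
    show "AE \<omega> in M. \<omega> \<notin> (\<Union>n. B n) \<longrightarrow> nrm (s \<star>\<^sub>R z) \<omega> = 0"
      using P_nrm[OF P] nrm_rscl[OF s(1) z] by eventually_elim auto
    fix n
    have t: "t n \<in> borel_measurable M" "AE \<omega> in M. 0 \<le> t n \<omega>"
        "AE \<omega> in M. \<omega> \<in> B n \<longrightarrow> nrm (z \<oplus>\<^bsub>E\<^esub> \<ominus>\<^bsub>E\<^esub> (t n \<star>\<^sub>R x n)) \<omega> = 0"
      using P by (auto simp: P_def)
    show "(\<lambda>\<omega>. s \<omega> * t n \<omega>) \<in> borel_measurable M" using t s by simp
    show "AE \<omega> in M. 0 \<le> s \<omega> * t n \<omega>" using t(2) by eventually_elim (simp add: s(2) less_imp_le)
    let ?a = "z \<oplus>\<^bsub>E\<^esub> \<ominus>\<^bsub>E\<^esub> (t n \<star>\<^sub>R x n)"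
    have c: "t n \<star>\<^sub>R x n \<in> carrier E" using t x by (auto intro: rscl_closed)
    have a: "?a \<in> carrier E" using z c by auto
    have eq: "s \<star>\<^sub>R z \<oplus>\<^bsub>E\<^esub> \<ominus>\<^bsub>E\<^esub> ((\<lambda>\<omega>. s \<omega> * t n \<omega>) \<star>\<^sub>R x n) = s \<star>\<^sub>R ?a"
      using z c by (simp add: rscl_add_right[OF s(1)] rscl_minus_right[OF s(1)] rscl_rscl[OF s(1) t(1) x(1)])
    show "AE \<omega> in M. \<omega> \<in> B n \<longrightarrow> nrm (s \<star>\<^sub>R z \<oplus>\<^bsub>E\<^esub> \<ominus>\<^bsub>E\<^esub> ((\<lambda>\<omega>. s \<omega> * t n \<omega>) \<star>\<^sub>R x n)) \<omega> = 0"
      unfolding eq using nrm_rscl[OF s(1) a] t(3) by eventually_elim auto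
  qed
  have zero: "\<ominus>\<^bsub>E\<^esub> \<zero>\<^bsub>E\<^esub> = \<zero>\<^bsub>E\<^esub>" by (rule M.minus_equality) simp_all
  have P_zero: "P \<zero>\<^bsub>E\<^esub> (\<lambda>_ _. 0)"
    unfolding P_def using nrm_zero by (auto simp: rscl_zero x(1) zero elim!: eventually_mono)
  have P_x: "P (x m) (\<lambda>n _. if n = m then 1 else 0)" for m
    unfolding P_def
  proof (intro conjI allI)
    show "AE \<omega> in M. \<omega> \<notin> (\<Union>n. B n) \<longrightarrow> nrm (x m) \<omega> = 0"
      using x(2)[of m] by eventually_elim auto
    fix n
    show "AE \<omega> in M. \<omega> \<in> B n \<longrightarrow> nrm (x m \<oplus>\<^bsub>E\<^esub> \<ominus>\<^bsub>E\<^esub> ((\<lambda>_. if n = m then 1 else 0) \<star>\<^sub>R x n)) \<omega> = 0"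
    proof (cases "n = m")
      case True
      then show ?thesis using nrm_zero x(1) by (auto simp: rscl_one M.r_neg elim!: eventually_mono)
    next
      case False
      have "B n \<inter> B m = {}" using B(1) False by (auto simp: disjoint_family_on_def)
      then show ?thesis using x(2)[of m] x(1) False
        by (auto simp: rscl_zero zero indicator_def elim!: eventually_mono)
    qed
  qed (auto simp: x(1))
  obtain u :: "'e \<Rightarrow> 'w \<Rightarrow> real" where
    u: "\<And>x. x \<in> carrier E \<Longrightarrow> u x \<in> borel_measurable M"
    "\<And>x y. x \<in> carrier E \<Longrightarrow> y \<in> carrier E \<Longrightarrow> AE \<omega> in M. u (x \<oplus>\<^bsub>E\<^esub> y) \<omega> = u x \<omega> + u y \<omega>"
    "\<And>t x. t \<in> borel_measurable M \<Longrightarrow> x \<in> carrier E \<Longrightarrow> AE \<omega> in M. u (t \<star>\<^sub>R x) \<omega> = t \<omega> * u x \<omega>"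
    "\<And>x. x \<in> carrier E \<Longrightarrow> AE \<omega> in M. \<bar>u x \<omega>\<bar> \<le> nrm x \<omega>"
    and uZ: "\<And>z. z \<in> Z \<Longrightarrow> AE \<omega> in M. u z \<omega> = nrm z \<omega>"
  proof (rule random_Hahn_Banach[of Z])
    show "Z \<subseteq> carrier E" by (auto simp: Z_def P_def)
    show "\<zero>\<^bsub>E\<^esub> \<in> Z" using P_zero by (auto simp: Z_def)
    show "z \<oplus>\<^bsub>E\<^esub> z' \<in> Z" if "z \<in> Z" "z' \<in> Z" for z z' using that P_add by (auto simp: Z_def) blast
    show "s \<star>\<^sub>R z \<in> Z" if "z \<in> Z" "s \<in> borel_measurable M" "\<And>\<omega>. 0 < s \<omega>" for z s
      using that P_scl by (auto simp: Z_def) blast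
    show "AE \<omega> in M. nrm (z \<oplus>\<^bsub>E\<^esub> z') \<omega> = nrm z \<omega> + nrm z' \<omega>" if "z \<in> Z" "z' \<in> Z" for z z'
    proof -
      obtain t t' where P: "P z t" "P z' t'" using \<open>z \<in> Z\<close> \<open>z' \<in> Z\<close> by (auto simp: Z_def)
      show ?thesis using P_nrm[OF P(1)] P_nrm[OF P(2)] P_nrm[OF P_add[OF P]] by eventually_elim auto
    qed
  qed (blast intro: that)
  obtain f where f: "f \<in> carrier conj_module" "\<And>x. x \<in> carrier E \<Longrightarrow> AE \<omega> in M. inner 1 (L0_rep (f x) \<omega>) = u x \<omega>"
    using conj_of_real_functional[of u] u by blast
  have "x n \<in> Z" for n using P_x by (auto simp: Z_def)
  have "AE \<omega> in M. inner 1 (L0_rep (f (x n)) \<omega>) = indicator (B n) \<omega>" for n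
    using f(2)[OF x(1)[of n]] uZ[OF \<open>x n \<in> Z\<close>] x(2)[of n] by eventually_elim simp
  with f(1) show ?thesis by (rule that)
qed

text \<open>An element that is nonzero somewhere on \<open>A\<close> is divided by its own norm.
  \<open>B\<close> is the part of \<open>A\<close> where that norm is positive, since a single
  element may vanish on the rest of \<open>A\<close>.\<close>

lemma full_support_normed_element:
  assumes full: "full_support M E" and A: "A \<in> sets M" "measure M A > 0"
  obtains B x where "B \<in> sets M" "B \<subseteq> A" "measure M B > 0" "x \<in> carrier E"
    "AE \<omega> in M. nrm x \<omega> = indicator B \<omega>"
proof -
  obtain y where y: "y \<in> carrier E" "measure M {\<omega>\<in>A. 0 < nrm y \<omega>} > 0"
    using full_supportD[OF full A] .
  let ?B = "{\<omega>\<in>A. 0 < nrm y \<omega>}"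
  have "?B = A \<inter> {\<omega>\<in>space M. 0 < nrm y \<omega>}" using sets.sets_into_space[OF A(1)] by auto
  then have B: "?B \<in> sets M" using A(1) nrm_measurable[OF y(1)] by auto
  define t where "t \<omega> = indicator ?B \<omega> / nrm y \<omega>" for \<omega>
  have t: "t \<in> borel_measurable M"
    unfolding t_def using B nrm_measurable[OF y(1)] by (intro borel_measurable_divide borel_measurable_indicator)
  have "AE \<omega> in M. nrm (t \<star>\<^sub>R y) \<omega> = indicator ?B \<omega>"
    using nrm_rscl[OF t y(1)] by eventually_elim (auto simp: t_def indicator_def)
  then show ?thesis using that[OF B _ y(2) rscl_closed[OF t y(1)]] by auto
qed

text \<open>In \<open>L\<^sup>0\<close> with the locally \<open>L\<^sup>0\<close>-convex topology the indicators of disjoint nonnull sets form a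
  closed discrete set: a ball whose radius at each point is smaller than the distance of the centre
  to \<open>{0, 1}\<close> contains at most one of them.\<close>

theorem compact_unit_ball_no_disjoint_sequence:
  fixes A :: "nat \<Rightarrow> 'w set"
  assumes full: "full_support M E" and comp: "compactin (sigma_c M E) (unit_ball M E)"
    and A: "disjoint_family A"
  shows "\<exists>n. A n \<notin> sets M \<or> measure M (A n) = 0"
proof (rule ccontr)
  assume "\<not> ?thesis"
  then have A': "\<And>n. A n \<in> sets M" "\<And>n. measure M (A n) > 0" by (auto simp: zero_less_measure_iff)
  have "\<exists>B x. B \<in> sets M \<and> B \<subseteq> A n \<and> measure M B > 0 \<and> x \<in> carrier E \<and> (AE \<omega> in M. nrm x \<omega> = indicator B \<omega>)" for n
    using full_support_normed_element[OF full A'(1,2)] by metis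
  then obtain B x where B: "\<And>n. B n \<in> sets M" "\<And>n. B n \<subseteq> A n" "\<And>n. measure M (B n) > 0"
    and x: "\<And>n. x n \<in> carrier E" "\<And>n. AE \<omega> in M. nrm (x n) \<omega> = indicator (B n) \<omega>"
    by metis
  have disj: "disjoint_family B" using A B(2) unfolding disjoint_family_on_def by blast
  obtain f where f: "f \<in> carrier conj_module" "\<And>n. AE \<omega> in M. inner 1 (L0_rep (f (x n)) \<omega>) = indicator (B n) \<omega>"
    by (rule disjoint_normed_sequence_functional[OF disj B(1) x]) (blast intro: that)
  \<comment> \<open>At 0 and 1 the distance to the set of these two numbers would be 0, which is no
    admissible radius; 1/2 is positive and still excludes the other number.\<close>
  define e :: "real \<Rightarrow> real" where "e a = (if a = 0 \<or> a = 1 then 1/2 else min \<bar>a\<bar> \<bar>a - 1\<bar>)" for a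
  have em: "e \<in> borel_measurable borel" unfolding e_def by measurable
  have e_less: "a = i" if "\<bar>i - a\<bar> < e a" "i = 0 \<or> i = 1" for a i
    using that by (auto simp: e_def abs_if split: if_splits)
  \<comment> \<open>The radius varies with the point through the real part of f y. It is positive
    everywhere, but it need not be bounded away from 0.\<close>
  define G where "G y = {z \<in> carrier E. AE \<omega> in M. norm (L0_rep (f z) \<omega> - L0_rep (f y) \<omega>) < e (inner 1 (L0_rep (f y) \<omega>))}" for y
  have fm: "L0_rep (f y) \<in> borel_measurable M" if "y \<in> carrier E" for y using conj_measurable[OF f(1) that] .
  have G_open: "openin (sigma_c M E) (G y)" if y: "y \<in> carrier E" for y
  proof -
    have "(\<lambda>\<omega>. inner 1 (L0_rep (f y) \<omega>)) \<in> borel_measurable M"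
      by (intro borel_measurable_inner borel_measurable_const fm[OF y])
    from measurable_compose[OF this em] have "(\<lambda>\<omega>. e (inner 1 (L0_rep (f y) \<omega>))) \<in> borel_measurable M" .
    then show ?thesis unfolding openin_sigma_c G_def by (intro sigma_c_open_ball[OF f(1) fm[OF y]])
  qed
  have G_self: "y \<in> G y" if "y \<in> carrier E" for y
    using that unfolding G_def by (auto simp: e_def)
  \<comment> \<open>Membership of \<open>x n\<close> pins the real part of f y to 0 or 1 at almost
    every point, hence to one particular indicator.\<close>
  have G_one: "AE \<omega> in M. inner 1 (L0_rep (f y) \<omega>) = indicator (B n) \<omega>" if "x n \<in> G y" for n y
  proof -
    have "AE \<omega> in M. norm (L0_rep (f (x n)) \<omega> - L0_rep (f y) \<omega>) < e (inner 1 (L0_rep (f y) \<omega>))"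
      using that by (simp add: G_def)
    with f(2)[of n] show ?thesis
    proof eventually_elim
      case (elim \<omega>)
      let ?a = "inner 1 (L0_rep (f y) \<omega>)" and ?i = "indicator (B n) \<omega> :: real"
      have "\<bar>?i - ?a\<bar> = \<bar>inner 1 (L0_rep (f (x n)) \<omega> - L0_rep (f y) \<omega>)\<bar>"
        by (simp add: elim(1) inner_diff_right)
      also have "\<dots> \<le> norm (L0_rep (f (x n)) \<omega> - L0_rep (f y) \<omega>)"
        using Cauchy_Schwarz_ineq2[of 1 "L0_rep (f (x n)) \<omega> - L0_rep (f y) \<omega>"] by simp
      finally have "\<bar>?i - ?a\<bar> < e ?a" using elim(2) by simp
      moreover have "?i = 0 \<or> ?i = 1" by (simp add: indicator_def)
      ultimately show ?case using e_less by metis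
    qed
  qed
  have G_inj: "n = m" if "x n \<in> G y" "x m \<in> G y" for n m y
  proof (rule ccontr)
    assume "n \<noteq> m"
    then have d: "B n \<inter> B m = {}" using disj by (auto simp: disjoint_family_on_def)
    have "AE \<omega> in M. \<omega> \<notin> B n"
      using G_one[OF that(1)] G_one[OF that(2)]
    proof eventually_elim
      case (elim \<omega>)
      then have "indicator (B n) \<omega> = (indicator (B m) \<omega> :: real)" by simp
      then show ?case using d by (auto simp: indicator_def split: if_splits)
    qed
    then have "B n \<in> null_sets M" using B(1) by (simp add: AE_iff_null_sets)
    then show False using B(3)[of n] by (simp add: null_sets_def emeasure_eq_measure)
  qed
  have "\<exists>\<F>. finite \<F> \<and> \<F> \<subseteq> G ` unit_ball M E \<and> unit_ball M E \<subseteq> \<Union>\<F>"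
  proof (rule compactinD[OF comp])
    show "openin (sigma_c M E) U" if "U \<in> G ` unit_ball M E" for U
      using that G_open by (auto simp: unit_ball_iff)
    show "unit_ball M E \<subseteq> \<Union>(G ` unit_ball M E)"
      using G_self by (auto simp: unit_ball_iff)
  qed
  then obtain \<F> where \<F>: "finite \<F>" "\<F> \<subseteq> G ` unit_ball M E" "unit_ball M E \<subseteq> \<Union>\<F>" by blast
  have "x n \<in> unit_ball M E" for n
    unfolding unit_ball_iff using x(1) x(2)[of n] by (auto simp: indicator_def elim!: eventually_mono)
  then have "\<forall>n. \<exists>H. H \<in> \<F> \<and> x n \<in> H" using \<F>(3) by blast
  then obtain H where H: "\<And>n. H n \<in> \<F>" "\<And>n. x n \<in> H n" by metis
  \<comment> \<open>Pigeonhole: infinitely many \<open>x n\<close> would lie in finitely many sets,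
    each of which contains at most one of them.\<close>
  have "inj H"
  proof (rule injI)
    fix n m assume eq: "H n = H m"
    obtain y where "H n = G y" using H(1) \<F>(2) by blast
    then show "n = m" using G_inj[of n y m] H(2)[of n] H(2)[of m] eq by simp
  qed
  moreover have "finite (range H)" using H(1) \<F>(1) by (auto intro: finite_subset)
  ultimately show False using finite_imageD by blast
qed

end

section \<open>Reflexivity over finitely many atoms\<close>

definition atom_value :: "'w measure \<Rightarrow> 'w set \<Rightarrow> ('w \<Rightarrow> 'a) \<Rightarrow> 'a" where
  "atom_value M A f = (SOME c. AE \<omega> in M. \<omega> \<in> A \<longrightarrow> f \<omega> = c)"

lemma AE_atom_value:
  fixes f :: "'w \<Rightarrow> 'a::{t2_space, second_countable_topology}"
  assumes "prob_space M" "P_atom M A" "f \<in> borel_measurable M"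
  shows "AE \<omega> in M. \<omega> \<in> A \<longrightarrow> f \<omega> = atom_value M A f"
  unfolding atom_value_def using P_atom_AE_constant[OF assms] by (rule someI_ex)

text \<open>An atom is nonnull, so a proposition that does not mention the point cannot fail while
  holding almost everywhere on it. This turns each almost everywhere identity on an atom into an
  identity between scalars.\<close>

lemma AE_atom_const:
  assumes "prob_space M" "P_atom M A" "AE \<omega> in M. \<omega> \<in> A \<longrightarrow> Q"
  shows Q
  using P_atom_not_AE[OF assms(1,2)] assms(3) by (cases Q) auto

lemma random_conjugate_carrier_iff:
  "f \<in> carrier (random_conjugate M E) \<longleftrightarrow>
    f \<in> extensional (carrier E) \<and> (\<forall>x\<in>carrier E. f x \<in> L0_set M) \<and>
    (\<forall>x\<in>carrier E. \<forall>y\<in>carrier E. f (x \<oplus>\<^bsub>E\<^esub> y) = f x \<oplus>\<^bsub>L0 M\<^esub> f y) \<and>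
    (\<forall>\<xi>\<in>L0_set M. \<forall>x\<in>carrier E. f (\<xi> \<odot>\<^bsub>E\<^esub> x) = \<xi> \<otimes>\<^bsub>L0 M\<^esub> f x) \<and>
    dominating_set M E f \<noteq> {}"
  unfolding random_conjugate_def PiE_def Pi_def partial_object.simps by auto

text \<open>First-order condition at a minimum: after division by s the quadratic term becomes
  negligible for small s.\<close>

lemma nonpos_of_quadratic:
  fixes S T :: real
  assumes "\<And>s. 0 < s \<Longrightarrow> s \<le> 1 \<Longrightarrow> 0 \<le> s\<^sup>2 * T - 2 * s * S" "0 \<le> T"
  shows "S \<le> 0"
proof (rule ccontr)
  assume "\<not> S \<le> 0"
  then have S: "0 < S" by simp
  \<comment> \<open>Small enough that s T is at most S, whereas the assumption would give 2 S at
    most s T. The summand 1 keeps the denominator positive when T = 0.\<close>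
  define s where "s = min 1 (S / (T + 1))"
  have s: "0 < s" "s \<le> 1" "s \<le> S / (T + 1)" using S assms(2) by (auto simp: s_def)
  have "s * (2 * S) \<le> s * (s * T)" using assms(1)[OF s(1,2)] by (simp add: power2_eq_square algebra_simps)
  then have "2 * S \<le> s * T" using s(1) by (simp only: mult_le_cancel_left_pos)
  also have "\<dots> \<le> s * (T + 1)" using s(1) by simp
  also have "\<dots> \<le> S" using s(3) assms(2) by (simp add: pos_le_divide_eq)
  finally show False using S by simp
qed

context rn_module_euclidean
begin

section \<open>The conjugate norm and the biconjugate module\<close>

lemma conj_add_closed:
  assumes f: "f \<in> carrier conj_module" and g: "g \<in> carrier conj_module"
  shows "f \<oplus>\<^bsub>conj_module\<^esub> g \<in> carrier conj_module"
proof -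
  note fD = conjD[OF f] and gD = conjD[OF g]
  obtain \<xi> where \<xi>: "\<xi> \<in> borel_measurable M" "AE \<omega> in M. 0 \<le> \<xi> \<omega>"
    "\<And>x. x \<in> carrier E \<Longrightarrow> AE \<omega> in M. norm (L0_rep (f x) \<omega>) \<le> \<xi> \<omega> * nrm x \<omega>"
    by (rule conj_dominated[OF f]) blast
  obtain \<eta> where \<eta>: "\<eta> \<in> borel_measurable M" "AE \<omega> in M. 0 \<le> \<eta> \<omega>"
    "\<And>x. x \<in> carrier E \<Longrightarrow> AE \<omega> in M. norm (L0_rep (g x) \<omega>) \<le> \<eta> \<omega> * nrm x \<omega>"
    by (rule conj_dominated[OF g]) blast
  have "(\<lambda>x\<in>carrier E. L0_class M (\<lambda>\<omega>. L0_rep (f x) \<omega> + L0_rep (g x) \<omega>)) \<in> carrier conj_module"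
  proof (rule conjI_function)
    show "(\<lambda>\<omega>. L0_rep (f x) \<omega> + L0_rep (g x) \<omega>) \<in> borel_measurable M" if "x \<in> carrier E" for x
      using fD(2)[OF that] gD(2)[OF that] by (rule borel_measurable_add)
    show "AE \<omega> in M. L0_rep (f (x \<oplus>\<^bsub>E\<^esub> y)) \<omega> + L0_rep (g (x \<oplus>\<^bsub>E\<^esub> y)) \<omega> =
      (L0_rep (f x) \<omega> + L0_rep (g x) \<omega>) + (L0_rep (f y) \<omega> + L0_rep (g y) \<omega>)"
      if "x \<in> carrier E" "y \<in> carrier E" for x y
      using fD(4)[OF that] gD(4)[OF that] by eventually_elim simp
    show "AE \<omega> in M. L0_rep (f (t \<star> x)) \<omega> + L0_rep (g (t \<star> x)) \<omega> = t \<omega> * (L0_rep (f x) \<omega> + L0_rep (g x) \<omega>)"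
      if "t \<in> borel_measurable M" "x \<in> carrier E" for t x
      using fD(5)[OF that] gD(5)[OF that] by eventually_elim (simp add: distrib_left)
    show "(\<lambda>\<omega>. \<xi> \<omega> + \<eta> \<omega>) \<in> borel_measurable M" using \<xi> \<eta> by simp
    show "AE \<omega> in M. 0 \<le> \<xi> \<omega> + \<eta> \<omega>" using \<xi>(2) \<eta>(2) by eventually_elim simp
    show "AE \<omega> in M. norm (L0_rep (f x) \<omega> + L0_rep (g x) \<omega>) \<le> (\<xi> \<omega> + \<eta> \<omega>) * nrm x \<omega>"
      if "x \<in> carrier E" for x
      using \<xi>(3)[OF that] \<eta>(3)[OF that]
      by eventually_elim (simp add: distrib_right norm_triangle_le)
  qed
  then show ?thesis by (simp add: random_conjugate_def L0_def)
qed

lemma conj_smult_closed: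
  assumes f: "f \<in> carrier conj_module" and \<zeta>: "\<zeta> \<in> L0_set M"
  shows "\<zeta> \<odot>\<^bsub>conj_module\<^esub> f \<in> carrier conj_module"
proof -
  note fD = conjD[OF f]
  have \<zeta>m: "L0_rep \<zeta> \<in> borel_measurable M" using \<zeta> by (rule L0_rep_measurable)
  obtain \<xi> where \<xi>: "\<xi> \<in> borel_measurable M" "AE \<omega> in M. 0 \<le> \<xi> \<omega>"
    "\<And>x. x \<in> carrier E \<Longrightarrow> AE \<omega> in M. norm (L0_rep (f x) \<omega>) \<le> \<xi> \<omega> * nrm x \<omega>"
    by (rule conj_dominated[OF f]) blast
  have "(\<lambda>x\<in>carrier E. L0_class M (\<lambda>\<omega>. L0_rep \<zeta> \<omega> * L0_rep (f x) \<omega>)) \<in> carrier conj_module"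
  proof (rule conjI_function)
    show "(\<lambda>\<omega>. L0_rep \<zeta> \<omega> * L0_rep (f x) \<omega>) \<in> borel_measurable M" if "x \<in> carrier E" for x
      using \<zeta>m fD(2)[OF that] by (rule borel_measurable_times)
    show "AE \<omega> in M. L0_rep \<zeta> \<omega> * L0_rep (f (x \<oplus>\<^bsub>E\<^esub> y)) \<omega> =
      L0_rep \<zeta> \<omega> * L0_rep (f x) \<omega> + L0_rep \<zeta> \<omega> * L0_rep (f y) \<omega>"
      if "x \<in> carrier E" "y \<in> carrier E" for x y
      using fD(4)[OF that] by eventually_elim (simp add: distrib_left)
    show "AE \<omega> in M. L0_rep \<zeta> \<omega> * L0_rep (f (t \<star> x)) \<omega> = t \<omega> * (L0_rep \<zeta> \<omega> * L0_rep (f x) \<omega>)"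
      if "t \<in> borel_measurable M" "x \<in> carrier E" for t x
      using fD(5)[OF that] by eventually_elim simp
    show "(\<lambda>\<omega>. norm (L0_rep \<zeta> \<omega>) * \<xi> \<omega>) \<in> borel_measurable M" using \<xi> \<zeta>m by simp
    show "AE \<omega> in M. 0 \<le> norm (L0_rep \<zeta> \<omega>) * \<xi> \<omega>" using \<xi>(2) by eventually_elim simp
    show "AE \<omega> in M. norm (L0_rep \<zeta> \<omega> * L0_rep (f x) \<omega>) \<le> (norm (L0_rep \<zeta> \<omega>) * \<xi> \<omega>) * nrm x \<omega>"
      if "x \<in> carrier E" for x
      using \<xi>(3)[OF that] by eventually_elim (simp add: norm_mult mult.assoc mult_left_mono)
  qed
  then show ?thesis by (simp add: random_conjugate_def L0_def)
qed

abbreviation cnrm :: "('e \<Rightarrow> ('w \<Rightarrow> 'k) set) \<Rightarrow> 'w \<Rightarrow> real" where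
  "cnrm f \<equiv> L0_rep (rnorm conj_module f)"

text \<open>The essential infimum of the dominating functions is itself dominating, one x at a time:
  the quotient of the modulus of f x by the norm of x is a lower bound of the whole set, hence lies
  below the infimum.\<close>

lemma conj_rnorm:
  assumes f: "f \<in> carrier conj_module"
  shows conj_rnorm_L0: "rnorm conj_module f \<in> L0_set M"
    and conj_rnorm_nonneg: "AE \<omega> in M. 0 \<le> cnrm f \<omega>"
    and conj_rnorm_le: "\<xi> \<in> borel_measurable M \<Longrightarrow> AE \<omega> in M. 0 \<le> \<xi> \<omega> \<Longrightarrow>
      (\<And>x. x \<in> carrier E \<Longrightarrow> AE \<omega> in M. norm (L0_rep (f x) \<omega>) \<le> \<xi> \<omega> * nrm x \<omega>) \<Longrightarrow>
      AE \<omega> in M. cnrm f \<omega> \<le> \<xi> \<omega>"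
    and conj_le_rnorm: "x \<in> carrier E \<Longrightarrow> AE \<omega> in M. norm (L0_rep (f x) \<omega>) \<le> cnrm f \<omega> * nrm x \<omega>"
proof -
  let ?D = "dominating_set M E f"
  note D_iff = dominating_set_conj[OF f]
  have n: "rnorm conj_module f = \<Sqinter>\<^bsub>L0_order M\<^esub> ?D" by (simp add: random_conjugate_def)
  have "?D \<subseteq> L0_nonneg M" by (auto simp: dominating_set_def)
  moreover have D_ne: "?D \<noteq> {}" using f by (simp add: random_conjugate_def)
  ultimately have gr: "greatest (L0_order M) (rnorm conj_module f) (Lower (L0_order M) ?D)"
    unfolding n by (rule L0_nonneg_inf[OF prob_space_axioms])
  have DL: "?D \<subseteq> L0_set M" using D_iff by blast
  show L0: "rnorm conj_module f \<in> L0_set M"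
    using gr by (auto simp: greatest_def Lower_def L0_order_def)
  have lower: "AE \<omega> in M. cnrm f \<omega> \<le> L0_rep \<zeta> \<omega>" if "\<zeta> \<in> ?D" for \<zeta>
    using gr that DL by (auto simp: greatest_def Lower_def L0_order_def)
  have greatest: "AE \<omega> in M. h \<omega> \<le> cnrm f \<omega>"
    if h: "h \<in> borel_measurable M" and le: "\<And>\<zeta>. \<zeta> \<in> ?D \<Longrightarrow> AE \<omega> in M. h \<omega> \<le> L0_rep \<zeta> \<omega>" for h
  proof -
    have "AE \<omega> in M. L0_rep (L0_class M h) \<omega> \<le> L0_rep \<zeta> \<omega>" if "\<zeta> \<in> ?D" for \<zeta>
      using le[OF that] L0_rep_class[OF h] by eventually_elim simp
    then have "L0_class M h \<in> Lower (L0_order M) ?D" using h by (auto simp: Lower_def L0_order_def)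
    then have "AE \<omega> in M. L0_rep (L0_class M h) \<omega> \<le> cnrm f \<omega>"
      using gr by (auto simp: greatest_def L0_order_def)
    then show ?thesis using L0_rep_class[OF h] by eventually_elim simp
  qed
  show "AE \<omega> in M. 0 \<le> cnrm f \<omega>"
    by (rule greatest) (auto simp: D_iff)
  show "AE \<omega> in M. cnrm f \<omega> \<le> \<xi> \<omega>"
    if \<xi>: "\<xi> \<in> borel_measurable M" "AE \<omega> in M. 0 \<le> \<xi> \<omega>"
      "\<And>x. x \<in> carrier E \<Longrightarrow> AE \<omega> in M. norm (L0_rep (f x) \<omega>) \<le> \<xi> \<omega> * nrm x \<omega>"
  proof -
    note r = L0_rep_class[OF \<xi>(1)]
    have "AE \<omega> in M. 0 \<le> L0_rep (L0_class M \<xi>) \<omega>" using \<xi>(2) r by eventually_elim simp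
    moreover have "AE \<omega> in M. norm (L0_rep (f x) \<omega>) \<le> L0_rep (L0_class M \<xi>) \<omega> * nrm x \<omega>" if "x \<in> carrier E" for x
      using \<xi>(3)[OF that] r by eventually_elim simp
    ultimately have "L0_class M \<xi> \<in> ?D" using \<xi>(1) by (simp add: D_iff)
    from lower[OF this] r show ?thesis by eventually_elim simp
  qed
  show "AE \<omega> in M. norm (L0_rep (f x) \<omega>) \<le> cnrm f \<omega> * nrm x \<omega>" if x: "x \<in> carrier E"
  proof -
    define h where "h \<omega> = (if 0 < nrm x \<omega> then norm (L0_rep (f x) \<omega>) / nrm x \<omega> else 0)" for \<omega>
    note [measurable] = nrm_measurable[OF x] conj_measurable[OF f x]
    have hm: "h \<in> borel_measurable M" unfolding h_def by measurable
    have "AE \<omega> in M. h \<omega> \<le> cnrm f \<omega>"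
    proof (rule greatest[OF hm])
      fix \<zeta> assume "\<zeta> \<in> ?D"
      then have "AE \<omega> in M. 0 \<le> L0_rep \<zeta> \<omega>" "AE \<omega> in M. norm (L0_rep (f x) \<omega>) \<le> L0_rep \<zeta> \<omega> * nrm x \<omega>"
        using x by (auto simp: D_iff)
      then show "AE \<omega> in M. h \<omega> \<le> L0_rep \<zeta> \<omega>"
        by eventually_elim (auto simp: h_def pos_divide_le_eq)
    qed
    \<comment> \<open>Where the norm of x vanishes the quotient carries no information; any one
      dominating function forces f x = 0 there.\<close>
    moreover obtain \<zeta> where "\<zeta> \<in> ?D" using D_ne by blast
    then have "AE \<omega> in M. norm (L0_rep (f x) \<omega>) \<le> L0_rep \<zeta> \<omega> * nrm x \<omega>" using x by (simp add: D_iff)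
    ultimately show ?thesis using nrm_nonneg[OF x]
      by eventually_elim (auto simp: h_def pos_divide_le_eq split: if_splits)
  qed
qed

abbreviation biconj_module :: "('w, 'k, ('e \<Rightarrow> ('w \<Rightarrow> 'k) set) \<Rightarrow> ('w \<Rightarrow> 'k) set) rn_module" where
  "biconj_module \<equiv> random_conjugate M conj_module"

lemma dominating_set_biconj:
  assumes "\<And>f. f \<in> carrier conj_module \<Longrightarrow> g f \<in> L0_set M"
  shows "\<xi> \<in> dominating_set M conj_module g \<longleftrightarrow> \<xi> \<in> L0_set M \<and> (AE \<omega> in M. 0 \<le> L0_rep \<xi> \<omega>) \<and>
    (\<forall>f\<in>carrier conj_module. AE \<omega> in M. norm (L0_rep (g f) \<omega>) \<le> L0_rep \<xi> \<omega> * cnrm f \<omega>)"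
  by (intro dominating_set_iff assms conj_rnorm_L0)

lemma canonical_embedding_closed:
  assumes x: "x \<in> carrier E"
  shows "canonical_embedding M E x \<in> carrier biconj_module"
proof -
  let ?J = "canonical_embedding M E x"
  have J: "?J f = f x" if "f \<in> carrier conj_module" for f using that by (simp add: canonical_embedding_def)
  have L0: "?J f \<in> L0_set M" if "f \<in> carrier conj_module" for f using J[OF that] conj_L0[OF that x] by simp
  have "rnorm E x \<in> dominating_set M conj_module ?J"
  proof (subst dominating_set_biconj[OF L0])
    have "AE \<omega> in M. norm (L0_rep (?J f) \<omega>) \<le> nrm x \<omega> * cnrm f \<omega>" if f: "f \<in> carrier conj_module" for f
      using conj_le_rnorm[OF f x] by eventually_elim (simp add: J[OF f] mult.commute)
    then show "rnorm E x \<in> L0_set M \<and> (AE \<omega> in M. 0 \<le> nrm x \<omega>) \<and>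
      (\<forall>f\<in>carrier conj_module. AE \<omega> in M. norm (L0_rep (?J f) \<omega>) \<le> nrm x \<omega> * cnrm f \<omega>)"
      using rnorm_L0[OF x] nrm_nonneg[OF x] by blast
  qed
  moreover have "?J \<in> extensional (carrier conj_module)"
    by (simp add: canonical_embedding_def)
  moreover have "?J (f \<oplus>\<^bsub>conj_module\<^esub> g) = ?J f \<oplus>\<^bsub>L0 M\<^esub> ?J g"
    if "f \<in> carrier conj_module" "g \<in> carrier conj_module" for f g
  proof -
    have "(f \<oplus>\<^bsub>conj_module\<^esub> g) x = f x \<oplus>\<^bsub>L0 M\<^esub> g x" using x by (simp add: random_conjugate_def)
    then show ?thesis using J[OF conj_add_closed[OF that]] J[OF that(1)] J[OF that(2)] by simp
  qed
  moreover have "?J (\<zeta> \<odot>\<^bsub>conj_module\<^esub> f) = \<zeta> \<otimes>\<^bsub>L0 M\<^esub> ?J f"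
    if f: "f \<in> carrier conj_module" and z: "\<zeta> \<in> L0_set M" for f \<zeta>
  proof -
    have "(\<zeta> \<odot>\<^bsub>conj_module\<^esub> f) x = \<zeta> \<otimes>\<^bsub>L0 M\<^esub> f x" using x by (simp add: random_conjugate_def)
    then show ?thesis using J[OF conj_smult_closed[OF f z]] J[OF f] by simp
  qed
  ultimately show ?thesis
    using L0 unfolding random_conjugate_carrier_iff[of ?J] by blast
qed

lemma biconjD:
  assumes g: "g \<in> carrier biconj_module"
  shows biconj_extensional: "g \<in> extensional (carrier conj_module)"
    and biconj_L0: "f \<in> carrier conj_module \<Longrightarrow> g f \<in> L0_set M"
    and biconj_add: "f \<in> carrier conj_module \<Longrightarrow> f' \<in> carrier conj_module \<Longrightarrow>
      g (f \<oplus>\<^bsub>conj_module\<^esub> f') = g f \<oplus>\<^bsub>L0 M\<^esub> g f'"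
    and biconj_smult: "\<zeta> \<in> L0_set M \<Longrightarrow> f \<in> carrier conj_module \<Longrightarrow>
      g (\<zeta> \<odot>\<^bsub>conj_module\<^esub> f) = \<zeta> \<otimes>\<^bsub>L0 M\<^esub> g f"
    and biconj_dominated: "dominating_set M conj_module g \<noteq> {}"
  using g unfolding random_conjugate_carrier_iff[of g] by blast+

text \<open>Induction over \<open>F\<close> uses only closure of the conjugate module under sums and
  scalar multiples. A single h has to satisfy both identities, because the Helly argument compares
  the norm of h, known through its values on E, with the value of g at h.\<close>

lemma biconj_linear_combination:
  assumes g: "g \<in> carrier biconj_module" and F: "finite F" "F \<subseteq> carrier conj_module"
  obtains h where "h \<in> carrier conj_module"
    "\<And>x. x \<in> carrier E \<Longrightarrow> AE \<omega> in M. L0_rep (h x) \<omega> = (\<Sum>f\<in>F. c f * L0_rep (f x) \<omega>)"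
    "AE \<omega> in M. L0_rep (g h) \<omega> = (\<Sum>f\<in>F. c f * L0_rep (g f) \<omega>)"
proof -
  have smult: "\<exists>k\<in>carrier conj_module. (\<forall>x\<in>carrier E. AE \<omega> in M. L0_rep (k x) \<omega> = b * L0_rep (f x) \<omega>) \<and>
      (AE \<omega> in M. L0_rep (g k) \<omega> = b * L0_rep (g f) \<omega>)"
    if f: "f \<in> carrier conj_module" for f b
  proof -
    define d where "d = L0_class M (\<lambda>_::'w. b)"
    have d: "d \<in> L0_set M" and r: "AE \<omega> in M. L0_rep d \<omega> = b"
      unfolding d_def by (simp_all add: L0_rep_class)
    have "AE \<omega> in M. L0_rep ((d \<odot>\<^bsub>conj_module\<^esub> f) x) \<omega> = b * L0_rep (f x) \<omega>" if x: "x \<in> carrier E" for x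
    proof -
      have "(d \<odot>\<^bsub>conj_module\<^esub> f) x = d \<otimes>\<^bsub>L0 M\<^esub> f x" using x by (simp add: random_conjugate_def)
      then show ?thesis using L0_rep_mult[OF d conj_L0[OF f x]] r by (auto elim: eventually_elim2)
    qed
    moreover have "AE \<omega> in M. L0_rep (g (d \<odot>\<^bsub>conj_module\<^esub> f)) \<omega> = b * L0_rep (g f) \<omega>"
      using L0_rep_mult[OF d biconj_L0[OF g f]] r biconj_smult[OF g d f] by (auto elim: eventually_elim2)
    ultimately show ?thesis using conj_smult_closed[OF f d] by blast
  qed
  have "\<exists>h\<in>carrier conj_module.
    (\<forall>x\<in>carrier E. AE \<omega> in M. L0_rep (h x) \<omega> = (\<Sum>f\<in>F. c f * L0_rep (f x) \<omega>)) \<and>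
    (AE \<omega> in M. L0_rep (g h) \<omega> = (\<Sum>f\<in>F. c f * L0_rep (g f) \<omega>))"
    using F
  proof induction
    case empty
    have f0: "(\<lambda>x\<in>carrier E. L0_class M (\<lambda>_. 0)) \<in> carrier conj_module"
      by (rule conjI_function[where \<xi> = "\<lambda>_. 0"]) auto
    show ?case using smult[OF f0, of 0] by simp
  next
    case (insert f F)
    then obtain h where h: "h \<in> carrier conj_module"
      "\<And>x. x \<in> carrier E \<Longrightarrow> AE \<omega> in M. L0_rep (h x) \<omega> = (\<Sum>f\<in>F. c f * L0_rep (f x) \<omega>)"
      "AE \<omega> in M. L0_rep (g h) \<omega> = (\<Sum>f\<in>F. c f * L0_rep (g f) \<omega>)" by blast
    have "f \<in> carrier conj_module" using insert.prems by blast
    then obtain k where k: "k \<in> carrier conj_module"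
      "\<And>x. x \<in> carrier E \<Longrightarrow> AE \<omega> in M. L0_rep (k x) \<omega> = c f * L0_rep (f x) \<omega>"
      "AE \<omega> in M. L0_rep (g k) \<omega> = c f * L0_rep (g f) \<omega>"
      using smult[of f "c f"] by blast
    have "AE \<omega> in M. L0_rep ((k \<oplus>\<^bsub>conj_module\<^esub> h) x) \<omega> = (\<Sum>f\<in>insert f F. c f * L0_rep (f x) \<omega>)"
      if x: "x \<in> carrier E" for x
    proof -
      have "(k \<oplus>\<^bsub>conj_module\<^esub> h) x = k x \<oplus>\<^bsub>L0 M\<^esub> h x" using x by (simp add: random_conjugate_def)
      then have "AE \<omega> in M. L0_rep ((k \<oplus>\<^bsub>conj_module\<^esub> h) x) \<omega> = L0_rep (k x) \<omega> + L0_rep (h x) \<omega>"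
        using L0_rep_add[OF conj_L0[OF k(1) x] conj_L0[OF h(1) x]] by simp
      then show ?thesis using k(2)[OF x] h(2)[OF x] by eventually_elim (simp add: insert.hyps)
    qed
    moreover have "AE \<omega> in M. L0_rep (g (k \<oplus>\<^bsub>conj_module\<^esub> h)) \<omega> = (\<Sum>f\<in>insert f F. c f * L0_rep (g f) \<omega>)"
    proof -
      have "AE \<omega> in M. L0_rep (g (k \<oplus>\<^bsub>conj_module\<^esub> h)) \<omega> = L0_rep (g k) \<omega> + L0_rep (g h) \<omega>"
        using L0_rep_add[OF biconj_L0[OF g k(1)] biconj_L0[OF g h(1)]] biconj_add[OF g k(1) h(1)] by simp
      then show ?thesis using k(3) h(3) by eventually_elim (simp add: insert.hyps)
    qed
    ultimately show ?case using conj_add_closed[OF k(1) h(1)] by blast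
  qed
  then show ?thesis using that by blast
qed

lemma unit_ball_combination:
  assumes x: "x \<in> unit_ball M E" and y: "y \<in> unit_ball M E" and s: "0 \<le> s" "s \<le> 1"
  shows "(\<lambda>_. of_real (1 - s)) \<star> x \<oplus>\<^bsub>E\<^esub> (\<lambda>_. of_real s) \<star> y \<in> unit_ball M E"
proof -
  have xE: "x \<in> carrier E" "AE \<omega> in M. nrm x \<omega> \<le> 1" and yE: "y \<in> carrier E" "AE \<omega> in M. nrm y \<omega> \<le> 1"
    using x y by (auto simp: unit_ball_iff)
  let ?x = "(\<lambda>_. of_real (1 - s)) \<star> x" and ?y = "(\<lambda>_. of_real s) \<star> y"
  have c: "?x \<in> carrier E" "?y \<in> carrier E" using xE yE by (auto intro!: scl_closed)
  have "AE \<omega> in M. nrm (?x \<oplus>\<^bsub>E\<^esub> ?y) \<omega> \<le> 1"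
    using nrm_add[OF c] nrm_scl[OF borel_measurable_const xE(1), of "of_real (1 - s)"]
      nrm_scl[OF borel_measurable_const yE(1), of "of_real s"] xE(2) yE(2)
  proof eventually_elim
    case (elim \<omega>)
    have "nrm ?x \<omega> = (1 - s) * nrm x \<omega>" using elim(2) s by (simp only: norm_of_real)
    moreover have "nrm ?y \<omega> = s * nrm y \<omega>" using elim(3) s by simp
    moreover have "(1 - s) * nrm x \<omega> \<le> 1 - s" "s * nrm y \<omega> \<le> s"
      using elim(4,5) s by (simp_all add: mult_left_le)
    ultimately show ?case using elim(1) by linarith
  qed
  then show ?thesis using c by (simp add: unit_ball_iff)
qed

section \<open>Helly approximation on an atom and gluing\<close>

text \<open>A constant radius is enough: on an atom the almost everywhere inequality between values
  of f is one inequality between scalars.\<close>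

lemma continuous_map_atom_value:
  assumes A: "P_atom M A" and f: "f \<in> carrier conj_module"
  shows "continuous_map (sigma_c M E) euclidean (\<lambda>x. atom_value M A (L0_rep (f x)))"
proof -
  let ?p = "\<lambda>x. atom_value M A (L0_rep (f x))"
  have p: "AE \<omega> in M. \<omega> \<in> A \<longrightarrow> L0_rep (f x) \<omega> = ?p x" if "x \<in> carrier E" for x
    using AE_atom_value[OF prob_space_axioms A conj_measurable[OF f that]] .
  have "sigma_c_open M E {x \<in> carrier E. ?p x \<in> U}" if U: "open U" for U
    unfolding sigma_c_open_def
  proof (intro conjI ballI)
    fix x assume "x \<in> {x \<in> carrier E. ?p x \<in> U}"
    then have x: "x \<in> carrier E" "?p x \<in> U" by auto
    obtain e where e: "0 < e" "cball (?p x) e \<subseteq> U" using U x(2) open_contains_cball by blast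
    have r: "AE \<omega> in M. L0_rep (L0_class M (\<lambda>_. e)) \<omega> = e" by (simp add: L0_rep_class)
    have "L0_class M (\<lambda>_. e) \<in> L0_pos M"
      using r e(1) by (auto simp: L0_pos_iff elim!: eventually_mono)
    moreover have "{y \<in> carrier E. \<forall>f\<in>{f}. L0_le M (L0_abs M (f y \<ominus>\<^bsub>L0 M\<^esub> f x)) (L0_class M (\<lambda>_. e))} \<subseteq>
      {x \<in> carrier E. ?p x \<in> U}"
    proof safe
      fix y assume y: "y \<in> carrier E"
        and "\<forall>f\<in>{f}. L0_le M (L0_abs M (f y \<ominus>\<^bsub>L0 M\<^esub> f x)) (L0_class M (\<lambda>_. e))"
      then have "AE \<omega> in M. norm (L0_rep (f y) \<omega> - L0_rep (f x) \<omega>) \<le> L0_rep (L0_class M (\<lambda>_. e)) \<omega>"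
        using L0_le_abs_minus_iff[OF conj_L0[OF f y] conj_L0[OF f x(1)]] by auto
      then have "AE \<omega> in M. \<omega> \<in> A \<longrightarrow> norm (?p y - ?p x) \<le> e"
        using r p[OF y] p[OF x(1)] by eventually_elim auto
      then have "norm (?p y - ?p x) \<le> e" by (rule AE_atom_const[OF prob_space_axioms A])
      then show "?p y \<in> U" using e(2) by (auto simp: dist_norm norm_minus_commute)
    qed
    ultimately show "\<exists>F \<epsilon>. finite F \<and> F \<subseteq> carrier conj_module \<and> \<epsilon> \<in> L0_pos M \<and>
        {y \<in> carrier E. \<forall>f\<in>F. L0_le M (L0_abs M (f y \<ominus>\<^bsub>L0 M\<^esub> f x)) \<epsilon>} \<subseteq> {x \<in> carrier E. ?p x \<in> U}"
      using f by (intro exI[of _ "{f}"] exI[of _ "L0_class M (\<lambda>_. e)"] conjI) auto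
  qed auto
  then show ?thesis by (auto simp: continuous_map_def topspace_sigma_c openin_sigma_c)
qed

text \<open>A test element is rotated and rescaled on \<open>A\<close> so that its value becomes a
  nonnegative real and its norm becomes 1, and it is cut off outside \<open>A\<close> to stay in the
  unit ball; hence bounding the real part bounds the modulus. Off \<open>A\<close> some dominating
  function is kept, so that the glued bound dominates h on the whole space.\<close>

lemma conj_functional_bound_on_atom:
  assumes A: "P_atom M A" and h: "h \<in> carrier conj_module"
    and b: "\<And>y. y \<in> unit_ball M E \<Longrightarrow> inner 1 (atom_value M A (L0_rep (h y))) \<le> b"
  shows "AE \<omega> in M. \<omega> \<in> A \<longrightarrow> cnrm h \<omega> \<le> b"
proof -
  have As: "A \<in> sets M" using A by (simp add: P_atom_def)
  note AE_const = AE_atom_const[OF prob_space_axioms A]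
  obtain \<xi> where \<xi>: "\<xi> \<in> borel_measurable M" "AE \<omega> in M. 0 \<le> \<xi> \<omega>"
    "\<And>x. x \<in> carrier E \<Longrightarrow> AE \<omega> in M. norm (L0_rep (h x) \<omega>) \<le> \<xi> \<omega> * nrm x \<omega>"
    by (rule conj_dominated[OF h]) blast
  define p where "p x = atom_value M A (L0_rep (h x))" for x
  have p: "AE \<omega> in M. \<omega> \<in> A \<longrightarrow> L0_rep (h x) \<omega> = p x" if "x \<in> carrier E" for x
    unfolding p_def using AE_atom_value[OF prob_space_axioms A conj_measurable[OF h that]] .
  have z: "\<zero>\<^bsub>E\<^esub> \<in> unit_ball M E" using nrm_zero by (auto simp: unit_ball_iff elim!: eventually_mono)
  have "AE \<omega> in M. \<omega> \<in> A \<longrightarrow> p \<zero>\<^bsub>E\<^esub> = 0"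
    using \<xi>(3)[OF M.zero_closed] nrm_zero p[OF M.zero_closed] by eventually_elim auto
  then have "p \<zero>\<^bsub>E\<^esub> = 0" by (rule AE_const)
  then have b0: "0 \<le> b" using b[OF z] by (simp add: p_def)
  have main: "AE \<omega> in M. \<omega> \<in> A \<longrightarrow> norm (L0_rep (h y) \<omega>) \<le> b * nrm y \<omega>" if y: "y \<in> carrier E" for y
  proof -
    define n where "n = atom_value M A (nrm y)"
    have n: "AE \<omega> in M. \<omega> \<in> A \<longrightarrow> nrm y \<omega> = n"
      unfolding n_def using AE_atom_value[OF prob_space_axioms A nrm_measurable[OF y]] .
    have "AE \<omega> in M. \<omega> \<in> A \<longrightarrow> 0 \<le> n" using n nrm_nonneg[OF y] by eventually_elim auto
    then have n0: "0 \<le> n" by (rule AE_const)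
    have "norm (p y) \<le> b * n"
    proof (cases "n = 0 \<or> p y = 0")
      \<comment> \<open>If n = 0, domination by \<xi> forces p y = 0.\<close>
      case True
      have "AE \<omega> in M. \<omega> \<in> A \<longrightarrow> norm (p y) \<le> \<xi> \<omega> * n"
        using \<xi>(3)[OF y] n p[OF y] by eventually_elim auto
      then have "AE \<omega> in M. \<omega> \<in> A \<longrightarrow> norm (p y) \<le> b * n"
        by eventually_elim (use True b0 n0 in auto)
      then show ?thesis by (rule AE_const)
    next
      case False
      then have nz: "0 < n" "p y \<noteq> 0" using n0 by auto
      define k where "k = of_real (norm (p y) / n) * inverse (p y)"
      have k: "norm k = 1 / n" "k * p y = of_real (norm (p y) / n)"
        unfolding k_def norm_mult norm_of_real norm_inverse using nz by (simp_all add: mult.assoc)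
      define t where "t \<omega> = indicator A \<omega> *\<^sub>R k" for \<omega>
      have t: "t \<in> borel_measurable M" unfolding t_def using As by measurable
      have ty: "t \<star> y \<in> carrier E" using t y by (rule scl_closed)
      have "AE \<omega> in M. nrm (t \<star> y) \<omega> \<le> 1"
        using nrm_scl[OF t y] n by eventually_elim (use k(1) nz in \<open>auto simp: t_def indicator_def\<close>)
      then have ball: "t \<star> y \<in> unit_ball M E" using ty by (simp add: unit_ball_iff)
      have "AE \<omega> in M. \<omega> \<in> A \<longrightarrow> p (t \<star> y) = k * p y"
        using p[OF ty] p[OF y] conj_scl[OF h t y] by eventually_elim (auto simp: t_def)
      then have "p (t \<star> y) = of_real (norm (p y) / n)" unfolding k(2) by (rule AE_const)
      then have "norm (p y) / n \<le> b"
        using b[OF ball] by (simp add: p_def[symmetric] of_real_def dot_square_norm)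
      then show ?thesis using nz by (simp add: pos_divide_le_eq)
    qed
    then show ?thesis using p[OF y] n by (auto elim!: eventually_elim2)
  qed
  define \<xi>' where "\<xi>' \<omega> = (if \<omega> \<in> A then b else \<xi> \<omega>)" for \<omega>
  have "AE \<omega> in M. cnrm h \<omega> \<le> \<xi>' \<omega>"
  proof (rule conj_rnorm_le[OF h])
    show "\<xi>' \<in> borel_measurable M" unfolding \<xi>'_def using As \<xi>(1) by measurable
    show "AE \<omega> in M. 0 \<le> \<xi>' \<omega>" using \<xi>(2) by eventually_elim (simp add: \<xi>'_def b0)
    show "AE \<omega> in M. norm (L0_rep (h x) \<omega>) \<le> \<xi>' \<omega> * nrm x \<omega>" if "x \<in> carrier E" for x
      using main[OF that] \<xi>(3)[OF that] by eventually_elim (auto simp: \<xi>'_def)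
  qed
  then show ?thesis by eventually_elim (simp add: \<xi>'_def split: if_splits)
qed

text \<open>Minimise the squared distance of \<open>(r f(x))\<^sub>f\<close> to \<open>(g f)\<^sub>f\<close> over the unit ball. If \<open>d\<^sub>f\<close> are the
  differences at a minimiser \<open>x\<^sub>0\<close>, the variational inequality says that \<open>h = \<Sum> conj d\<^sub>f \<sqdot> f\<close> attains its
  norm at \<open>x\<^sub>0\<close>, and \<open>|g h| \<le> r \<parallel>h\<parallel>\<close> then forces \<open>\<Sum> |d\<^sub>f|\<^sup>2 \<le> 0\<close>. No separation theorem is needed.\<close>

lemma Helly_on_atom:
  assumes comp: "compactin (sigma_c M E) (unit_ball M E)" and A: "P_atom M A"
    and g: "g \<in> carrier biconj_module" and r: "0 < r"
    and g_le: "\<And>f. f \<in> carrier conj_module \<Longrightarrow> AE \<omega> in M. \<omega> \<in> A \<longrightarrow> norm (L0_rep (g f) \<omega>) \<le> r * cnrm f \<omega>"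
    and F: "finite F" "F \<subseteq> carrier conj_module"
  shows "\<exists>x\<in>unit_ball M E. \<forall>f\<in>F. atom_value M A (L0_rep (g f)) = r *\<^sub>R atom_value M A (L0_rep (f x))"
proof -
  note AE_const = AE_atom_const[OF prob_space_axioms A]
  define p where "p f x = atom_value M A (L0_rep (f x))" for f :: "'e \<Rightarrow> ('w \<Rightarrow> 'k) set" and x
  define a where "a f = atom_value M A (L0_rep (g f))" for f
  have p: "AE \<omega> in M. \<omega> \<in> A \<longrightarrow> L0_rep (f x) \<omega> = p f x" if "f \<in> carrier conj_module" "x \<in> carrier E" for f x
    unfolding p_def using AE_atom_value[OF prob_space_axioms A conj_measurable[OF that]] .
  have a: "AE \<omega> in M. \<omega> \<in> A \<longrightarrow> L0_rep (g f) \<omega> = a f" if "f \<in> carrier conj_module" for f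
    unfolding a_def using AE_atom_value[OF prob_space_axioms A L0_rep_measurable[OF biconj_L0[OF g that]]] .
  have ballE: "x \<in> carrier E" if "x \<in> unit_ball M E" for x using that by (simp add: unit_ball_iff)
  have FE: "f \<in> carrier conj_module" if "f \<in> F" for f using that F(2) by blast
  define \<Phi> where "\<Phi> x = (\<Sum>f\<in>F. (norm (a f - r *\<^sub>R p f x))\<^sup>2)" for x
  have "continuous_map (sigma_c M E) euclideanreal \<Phi>"
    unfolding \<Phi>_def
  proof (rule continuous_map_sum[OF F(1)])
    fix f assume "f \<in> F"
    then have 1: "continuous_map (sigma_c M E) euclidean (p f)"
      unfolding p_def[abs_def] using continuous_map_atom_value[OF A] FE by blast
    have 2: "continuous_map euclidean euclideanreal (\<lambda>c. (norm (a f - r *\<^sub>R c))\<^sup>2)"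
      by (simp add: continuous_intros)
    show "continuous_map (sigma_c M E) euclideanreal (\<lambda>x. (norm (a f - r *\<^sub>R p f x))\<^sup>2)"
      using continuous_map_compose[OF 1 2] by (simp add: o_def)
  qed
  \<comment> \<open>The minimum is attained, which removes the error term of the usual Helly
    theorem.\<close>
  from image_compactin[OF comp this] have cpt: "compact (\<Phi> ` unit_ball M E)" by simp
  have z: "\<zero>\<^bsub>E\<^esub> \<in> unit_ball M E" using nrm_zero by (auto simp: unit_ball_iff elim!: eventually_mono)
  obtain x0 where x0: "x0 \<in> unit_ball M E" "\<And>y. y \<in> unit_ball M E \<Longrightarrow> \<Phi> x0 \<le> \<Phi> y"
    using compact_attains_inf[OF cpt] z by auto
  define d where "d f = a f - r *\<^sub>R p f x0" for f
  have var: "(\<Sum>f\<in>F. inner (d f) (p f y)) \<le> (\<Sum>f\<in>F. inner (d f) (p f x0))" if y: "y \<in> unit_ball M E" for y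
  proof -
    \<comment> \<open>Moving from x0 to (1 - s) x0 + s y changes each \<open>d f\<close> by - s
      times \<open>q f\<close>, so \<Phi> along the segment is a quadratic in s, minimal at s =
      0.\<close>
    define q where "q f = r *\<^sub>R (p f y - p f x0)" for f
    have "(\<Sum>f\<in>F. inner (d f) (q f)) \<le> 0"
    proof (rule nonpos_of_quadratic)
      fix s :: real assume s: "0 < s" "s \<le> 1"
      let ?x = "(\<lambda>_. of_real (1 - s)) \<star> x0" and ?y = "(\<lambda>_. of_real s) \<star> y"
      have ball: "?x \<oplus>\<^bsub>E\<^esub> ?y \<in> unit_ball M E" using unit_ball_combination[OF x0(1) y] s by simp
      have c: "?x \<in> carrier E" "?y \<in> carrier E" using ballE x0(1) y by (auto intro!: scl_closed)
      have "a f - r *\<^sub>R p f (?x \<oplus>\<^bsub>E\<^esub> ?y) = d f - s *\<^sub>R q f" if "f \<in> F" for f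
      proof -
        note f = FE[OF that]
        have "AE \<omega> in M. \<omega> \<in> A \<longrightarrow> p f (?x \<oplus>\<^bsub>E\<^esub> ?y) = of_real (1 - s) * p f x0 + of_real s * p f y"
          using p[OF f M.a_closed[OF c]] conj_add[OF f c] p[OF f ballE[OF x0(1)]] p[OF f ballE[OF y]]
            conj_scl[OF f borel_measurable_const ballE[OF x0(1)], of "of_real (1 - s)"]
            conj_scl[OF f borel_measurable_const ballE[OF y], of "of_real s"]
          by eventually_elim auto
        then have "p f (?x \<oplus>\<^bsub>E\<^esub> ?y) = of_real (1 - s) * p f x0 + of_real s * p f y" by (rule AE_const)
        then have w: "p f (?x \<oplus>\<^bsub>E\<^esub> ?y) = p f x0 + s *\<^sub>R (p f y - p f x0)"
          by (simp add: scaleR_conv_of_real algebra_simps)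
        show ?thesis unfolding w d_def q_def by (simp add: algebra_simps)
      qed
      then have "\<Phi> (?x \<oplus>\<^bsub>E\<^esub> ?y) = (\<Sum>f\<in>F. (norm (d f - s *\<^sub>R q f))\<^sup>2)" by (simp add: \<Phi>_def)
      also have "\<dots> = (\<Sum>f\<in>F. (norm (d f))\<^sup>2 + (s\<^sup>2 * (norm (q f))\<^sup>2 - 2 * s * inner (d f) (q f)))"
        unfolding power2_norm_eq_inner
        by (intro sum.cong refl)
          (simp add: inner_diff_left inner_diff_right inner_commute power2_eq_square[of s] algebra_simps)
      also have "\<dots> = \<Phi> x0 + (s\<^sup>2 * (\<Sum>f\<in>F. (norm (q f))\<^sup>2) - 2 * s * (\<Sum>f\<in>F. inner (d f) (q f)))"
        by (simp add: \<Phi>_def d_def sum.distrib sum_subtractf sum_distrib_left)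
      finally show "0 \<le> s\<^sup>2 * (\<Sum>f\<in>F. (norm (q f))\<^sup>2) - 2 * s * (\<Sum>f\<in>F. inner (d f) (q f))"
        using x0(2)[OF ball] by simp
    qed (simp add: sum_nonneg)
    then have "r * ((\<Sum>f\<in>F. inner (d f) (p f y)) - (\<Sum>f\<in>F. inner (d f) (p f x0))) \<le> 0"
      by (simp add: q_def inner_diff_right sum_subtractf sum_distrib_left right_diff_distrib)
    then show ?thesis using r by (simp add: mult_le_0_iff)
  qed
  define b where "b = (\<Sum>f\<in>F. inner (d f) (p f x0))"
  obtain h where h: "h \<in> carrier conj_module"
    "\<And>x. x \<in> carrier E \<Longrightarrow> AE \<omega> in M. L0_rep (h x) \<omega> = (\<Sum>f\<in>F. conj_elt (d f) * L0_rep (f x) \<omega>)"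
    "AE \<omega> in M. L0_rep (g h) \<omega> = (\<Sum>f\<in>F. conj_elt (d f) * L0_rep (g f) \<omega>)"
    by (rule biconj_linear_combination[OF g F, where c = "\<lambda>f. conj_elt (d f)"]) blast
  \<comment> \<open>Conjugate coefficients turn the real part of the K-linear h into a real inner
    product with d, so that \<open>var\<close> bounds the real part of h on the unit ball by its
    value at x0.\<close>
  have inner_sum_conj: "inner 1 (\<Sum>f\<in>F. conj_elt (d f) * w f) = (\<Sum>f\<in>F. inner (d f) (w f))" for w
    by (simp add: inner_sum_right inner_conj_elt[symmetric])
  have ph: "p h y = (\<Sum>f\<in>F. conj_elt (d f) * p f y)" if y: "y \<in> carrier E" for y
  proof -
    have "AE \<omega> in M. \<forall>f\<in>F. \<omega> \<in> A \<longrightarrow> L0_rep (f y) \<omega> = p f y"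
      using F(1) p[OF FE y] by (intro AE_finite_allI) auto
    then have "AE \<omega> in M. \<omega> \<in> A \<longrightarrow> p h y = (\<Sum>f\<in>F. conj_elt (d f) * p f y)"
      using p[OF h(1) y] h(2)[OF y] by eventually_elim auto
    then show ?thesis by (rule AE_const)
  qed
  have ah: "a h = (\<Sum>f\<in>F. conj_elt (d f) * a f)"
  proof -
    have "AE \<omega> in M. \<forall>f\<in>F. \<omega> \<in> A \<longrightarrow> L0_rep (g f) \<omega> = a f"
      using F(1) a[OF FE] by (intro AE_finite_allI) auto
    then have "AE \<omega> in M. \<omega> \<in> A \<longrightarrow> a h = (\<Sum>f\<in>F. conj_elt (d f) * a f)"
      using a[OF h(1)] h(3) by eventually_elim auto
    then show ?thesis by (rule AE_const)
  qed
  have "inner 1 (p h y) \<le> b" if "y \<in> unit_ball M E" for y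
    unfolding ph[OF ballE[OF that]] inner_sum_conj b_def by (rule var[OF that])
  then have "AE \<omega> in M. \<omega> \<in> A \<longrightarrow> cnrm h \<omega> \<le> b"
    unfolding p_def by (rule conj_functional_bound_on_atom[OF A h(1)])
  then have "AE \<omega> in M. \<omega> \<in> A \<longrightarrow> norm (a h) \<le> r * b"
    using g_le[OF h(1)] a[OF h(1)]
  proof eventually_elim
    case (elim \<omega>)
    show ?case
    proof
      assume "\<omega> \<in> A"
      then have "norm (a h) \<le> r * cnrm h \<omega>" "r * cnrm h \<omega> \<le> r * b" using elim r by auto
      then show "norm (a h) \<le> r * b" by linarith
    qed
  qed
  then have "norm (a h) \<le> r * b" by (rule AE_const)
  moreover have "inner 1 (a h) \<le> norm (a h)" using norm_cauchy_schwarz[of 1 "a h"] by simp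
  moreover have "inner 1 (a h) = (\<Sum>f\<in>F. (norm (d f))\<^sup>2) + r * b"
  proof -
    have "inner (d f) (a f) = (norm (d f))\<^sup>2 + r * inner (d f) (p f x0)" for f
    proof -
      have "a f = d f + r *\<^sub>R p f x0" by (simp add: d_def)
      then show ?thesis by (simp add: inner_add_right power2_norm_eq_inner)
    qed
    then show ?thesis unfolding ah inner_sum_conj b_def by (simp add: sum.distrib sum_distrib_left)
  qed
  ultimately have "(\<Sum>f\<in>F. (norm (d f))\<^sup>2) \<le> 0" by linarith
  then have "(\<Sum>f\<in>F. (norm (d f))\<^sup>2) = 0" by (simp add: antisym sum_nonneg)
  then have "\<forall>f\<in>F. d f = 0" using F(1) by (simp add: sum_nonneg_eq_0_iff)
  then show ?thesis using x0(1) by (auto simp: d_def a_def p_def)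
qed

text \<open>Each equation g f = r f x on \<open>A\<close> cuts out a closed set of x, and the Helly
  step supplies the finite intersection property within the compact unit ball. A common point,
  multiplied by r, represents g on \<open>A\<close>.\<close>

lemma biconj_represented_on_atom:
  assumes comp: "compactin (sigma_c M E) (unit_ball M E)" and A: "P_atom M A"
    and g: "g \<in> carrier biconj_module"
  shows "\<exists>x\<in>carrier E. \<forall>f\<in>carrier conj_module. AE \<omega> in M. \<omega> \<in> A \<longrightarrow> L0_rep (f x) \<omega> = L0_rep (g f) \<omega>"
proof -
  define p where "p f x = atom_value M A (L0_rep (f x))" for f :: "'e \<Rightarrow> ('w \<Rightarrow> 'k) set" and x
  define a where "a f = atom_value M A (L0_rep (g f))" for f
  have p: "AE \<omega> in M. \<omega> \<in> A \<longrightarrow> L0_rep (f x) \<omega> = p f x" if "f \<in> carrier conj_module" "x \<in> carrier E" for f x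
    unfolding p_def using AE_atom_value[OF prob_space_axioms A conj_measurable[OF that]] .
  have a: "AE \<omega> in M. \<omega> \<in> A \<longrightarrow> L0_rep (g f) \<omega> = a f" if "f \<in> carrier conj_module" for f
    unfolding a_def using AE_atom_value[OF prob_space_axioms A L0_rep_measurable[OF biconj_L0[OF g that]]] .
  obtain \<xi> where "\<xi> \<in> dominating_set M conj_module g" using biconj_dominated[OF g] by blast
  then have \<xi>: "\<xi> \<in> L0_set M" "AE \<omega> in M. 0 \<le> L0_rep \<xi> \<omega>"
    "\<And>f. f \<in> carrier conj_module \<Longrightarrow> AE \<omega> in M. norm (L0_rep (g f) \<omega>) \<le> L0_rep \<xi> \<omega> * cnrm f \<omega>"
    using dominating_set_biconj[OF biconj_L0[OF g]] by auto
  define c where "c = atom_value M A (L0_rep \<xi>)"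
  have c: "AE \<omega> in M. \<omega> \<in> A \<longrightarrow> L0_rep \<xi> \<omega> = c"
    unfolding c_def using AE_atom_value[OF prob_space_axioms A L0_rep_measurable[OF \<xi>(1)]] .
  have "AE \<omega> in M. \<omega> \<in> A \<longrightarrow> 0 \<le> c" using c \<xi>(2) by eventually_elim auto
  then have "0 \<le> c" by (rule AE_atom_const[OF prob_space_axioms A])
  \<comment> \<open>The bound c may be 0, but r has to be positive because the equations are divided
    by it; enlarging the bound is harmless.\<close>
  define r where "r = c + 1"
  have r: "0 < r" using \<open>0 \<le> c\<close> by (simp add: r_def)
  have g_le: "AE \<omega> in M. \<omega> \<in> A \<longrightarrow> norm (L0_rep (g f) \<omega>) \<le> r * cnrm f \<omega>" if f: "f \<in> carrier conj_module" for f
    using \<xi>(3)[OF f] c conj_rnorm_nonneg[OF f]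
    by eventually_elim (auto simp: r_def distrib_right intro: order_trans)
  define C where "C f = {x \<in> carrier E. p f x \<in> {a f /\<^sub>R r}}" for f
  have C: "x \<in> C f \<longleftrightarrow> x \<in> carrier E \<and> a f = r *\<^sub>R p f x" for x f
    using r by (auto simp: C_def)
  have closed: "closedin (sigma_c M E) (C f)" if f: "f \<in> carrier conj_module" for f
  proof -
    have "continuous_map (sigma_c M E) euclidean (p f)"
      unfolding p_def[abs_def] by (rule continuous_map_atom_value[OF A f])
    from closedin_continuous_map_preimage[OF this, of "{a f /\<^sub>R r}"]
    show ?thesis by (simp add: C_def topspace_sigma_c)
  qed
  have "unit_ball M E \<inter> \<Inter>(C ` carrier conj_module) \<noteq> {}"
  proof -
    have "unit_ball M E \<inter> \<Inter>\<F> \<noteq> {}" if \<F>: "finite \<F>" "\<F> \<subseteq> C ` carrier conj_module" for \<F>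
    proof -
      obtain F where F: "F \<subseteq> carrier conj_module" "finite F" "\<F> = C ` F"
        using finite_subset_image[OF \<F>] by blast
      obtain x where x: "x \<in> unit_ball M E" "\<forall>f\<in>F. a f = r *\<^sub>R p f x"
        using Helly_on_atom[OF comp A g r g_le F(2,1)] unfolding a_def p_def by blast
      then have "x \<in> unit_ball M E \<inter> \<Inter>\<F>" using F(3) by (simp add: C unit_ball_iff)
      then show ?thesis by blast
    qed
    then have "\<forall>\<F>. finite \<F> \<and> \<F> \<subseteq> C ` carrier conj_module \<longrightarrow> unit_ball M E \<inter> \<Inter>\<F> \<noteq> {}" by blast
    moreover have "\<forall>K\<in>C ` carrier conj_module. closedin (sigma_c M E) K" using closed by blast
    ultimately show ?thesis
      using comp[unfolded compactin_fip, THEN conjunct2, THEN spec, of "C ` carrier conj_module"] by (elim impE) (rule conjI)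
  qed
  then obtain x where x: "x \<in> unit_ball M E" "\<And>f. f \<in> carrier conj_module \<Longrightarrow> x \<in> C f" by blast
  have xE: "x \<in> carrier E" using x(1) by (simp add: unit_ball_iff)
  let ?x = "(\<lambda>_. of_real r) \<star> x"
  have "AE \<omega> in M. \<omega> \<in> A \<longrightarrow> L0_rep (f ?x) \<omega> = L0_rep (g f) \<omega>" if f: "f \<in> carrier conj_module" for f
    using conj_scl[OF f borel_measurable_const xE, of "of_real r"] p[OF f xE] a[OF f]
  proof eventually_elim
    case (elim \<omega>)
    have "a f = r *\<^sub>R p f x" using x(2)[OF f] C by blast
    then show ?case using elim by (simp add: scaleR_conv_of_real)
  qed
  moreover have "?x \<in> carrier E" by (intro scl_closed xE) simp
  ultimately show ?thesis by blast
qed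

text \<open>Only finitely many representing elements are glued, so that multiplication by indicators
  and finite sums stay within E.\<close>

lemma random_reflexive_of_finite_atoms:
  assumes comp: "compactin (sigma_c M E) (unit_ball M E)"
    and \<A>: "finite \<A>" "\<And>A. A \<in> \<A> \<Longrightarrow> P_atom M A" "\<Union>\<A> = space M"
  shows "random_reflexive M E"
  unfolding random_reflexive_def
proof (intro equalityI subsetI)
  fix g assume "g \<in> canonical_embedding M E ` carrier E"
  then show "g \<in> carrier biconj_module" using canonical_embedding_closed by blast
next
  fix g assume g: "g \<in> carrier biconj_module"
  have "\<exists>x\<in>carrier E. \<forall>A\<in>\<A>. \<forall>f\<in>carrier conj_module. AE \<omega> in M. \<omega> \<in> A \<longrightarrow> L0_rep (f x) \<omega> = L0_rep (g f) \<omega>"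
    using \<A>(1,2)
  proof induction
    case empty
    then show ?case by blast
  next
    case (insert A \<A>)
    then obtain x where x: "x \<in> carrier E"
      "\<And>B f. B \<in> \<A> \<Longrightarrow> f \<in> carrier conj_module \<Longrightarrow> AE \<omega> in M. \<omega> \<in> B \<longrightarrow> L0_rep (f x) \<omega> = L0_rep (g f) \<omega>"
      by auto
    have A: "P_atom M A" using insert.prems by blast
    then have As: "A \<in> sets M" by (simp add: P_atom_def)
    obtain y where y: "y \<in> carrier E"
      "\<And>f. f \<in> carrier conj_module \<Longrightarrow> AE \<omega> in M. \<omega> \<in> A \<longrightarrow> L0_rep (f y) \<omega> = L0_rep (g f) \<omega>"
      using biconj_represented_on_atom[OF comp A g] by blast
    define s t :: "'w \<Rightarrow> 'k" where "s \<omega> = (if \<omega> \<in> A then 0 else 1)" and "t \<omega> = (if \<omega> \<in> A then 1 else 0)" for \<omega>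
    have st: "s \<in> borel_measurable M" "t \<in> borel_measurable M"
      unfolding s_def t_def using As by measurable
    let ?z = "s \<star> x \<oplus>\<^bsub>E\<^esub> t \<star> y"
    have c: "s \<star> x \<in> carrier E" "t \<star> y \<in> carrier E" using st x(1) y(1) by (auto intro: scl_closed)
    have "AE \<omega> in M. \<omega> \<in> B \<longrightarrow> L0_rep (f ?z) \<omega> = L0_rep (g f) \<omega>"
      if B: "B \<in> insert A \<A>" and f: "f \<in> carrier conj_module" for B f
    proof (cases "B = A")
      case True
      show ?thesis
        using conj_add[OF f c] conj_scl[OF f st(1) x(1)] conj_scl[OF f st(2) y(1)] y(2)[OF f]
        by eventually_elim (auto simp: s_def t_def True)
    next
      case False
      then have "B \<in> \<A>" using B by simp
      from x(2)[OF this f] show ?thesis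
        using conj_add[OF f c] conj_scl[OF f st(1) x(1)] conj_scl[OF f st(2) y(1)] y(2)[OF f]
        by eventually_elim (auto simp: s_def t_def)
    qed
    then show ?case using M.a_closed[OF c] by blast
  qed
  then obtain x where x: "x \<in> carrier E"
    "\<And>A f. A \<in> \<A> \<Longrightarrow> f \<in> carrier conj_module \<Longrightarrow> AE \<omega> in M. \<omega> \<in> A \<longrightarrow> L0_rep (f x) \<omega> = L0_rep (g f) \<omega>"
    by blast
  have "f x = g f" if f: "f \<in> carrier conj_module" for f
  proof (rule L0_eqI[OF conj_L0[OF f x(1)] biconj_L0[OF g f]])
    have "AE \<omega> in M. \<forall>A\<in>\<A>. \<omega> \<in> A \<longrightarrow> L0_rep (f x) \<omega> = L0_rep (g f) \<omega>"
      using \<A>(1) x(2)[OF _ f] by (intro AE_finite_allI) auto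
    then show "AE \<omega> in M. L0_rep (f x) \<omega> = L0_rep (g f) \<omega>"
      using AE_space by eventually_elim (use \<A>(3) in blast)
  qed
  then have "canonical_embedding M E x = g"
    unfolding canonical_embedding_def using biconj_extensional[OF g]
    by (intro ext) (auto simp: extensional_def)
  then show "g \<in> canonical_embedding M E ` carrier E" using x(1) by blast
qed

theorem compact_unit_ball_imp_reflexive_atomic:
  assumes full: "full_support M E" and comp: "compactin (sigma_c M E) (unit_ball M E)"
  shows "random_reflexive M E" "essentially_purely_atomic M"
proof -
  obtain \<A> where \<A>: "finite \<A>" "disjoint \<A>" "\<And>A. A \<in> \<A> \<Longrightarrow> P_atom M A" "\<Union>\<A> = space M"
    using finite_atomic_partition[OF prob_space_axioms compact_unit_ball_no_disjoint_sequence[OF full comp]]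
    by blast
  show "random_reflexive M E" using comp \<A>(1,3,4) by (rule random_reflexive_of_finite_atoms)
  show "essentially_purely_atomic M" using prob_space_axioms \<A> by (rule essentially_purely_atomicI)
qed

end

section \<open>The module of all measurable functions\<close>

definition L0_module :: "'w measure \<Rightarrow> ('w, 'k::real_normed_field, ('w \<Rightarrow> 'k) set) rn_module" where
  "L0_module M = \<lparr>carrier = L0_set M, mult = undefined, one = undefined, zero = \<zero>\<^bsub>L0 M\<^esub>,
     add = (\<lambda>x y. x \<oplus>\<^bsub>L0 M\<^esub> y), smult = (\<lambda>x y. x \<otimes>\<^bsub>L0 M\<^esub> y), rnorm = L0_abs M\<rparr>"

lemma L0_module_simps [simp]:
  "carrier (L0_module M) = L0_set M" "\<zero>\<^bsub>L0_module M\<^esub> = \<zero>\<^bsub>L0 M\<^esub>"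
  "x \<oplus>\<^bsub>L0_module M\<^esub> y = x \<oplus>\<^bsub>L0 M\<^esub> y" "x \<odot>\<^bsub>L0_module M\<^esub> y = x \<otimes>\<^bsub>L0 M\<^esub> y"
  "rnorm (L0_module M) = L0_abs M"
  by (simp_all add: L0_module_def)

lemma random_normed_module_L0_module:
  assumes "prob_space M"
  shows "random_normed_module M (L0_module M :: ('w, 'k::{real_normed_field, second_countable_topology}, _) rn_module)"
proof -
  interpret prob_space M by fact
  interpret R: cring "L0 M :: ('w \<Rightarrow> 'k) set ring" by (rule cring_L0)
  have "abelian_group (L0_module M :: ('w, 'k, _) rn_module)"
  proof (rule abelian_groupI)
    show "\<exists>y\<in>carrier (L0_module M). y \<oplus>\<^bsub>L0_module M\<^esub> x = \<zero>\<^bsub>L0_module M\<^esub>"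
      if "x \<in> carrier (L0_module M)" for x :: "('w \<Rightarrow> 'k) set"
      using that R.a_inv_closed[of x] R.l_neg[of x] by auto
  qed (use R.a_closed R.zero_closed R.a_assoc R.a_comm R.l_zero in simp_all)
  then have m: "Module.module (L0 M) (L0_module M :: ('w, 'k, _) rn_module)"
    using R.l_distr R.r_distr R.m_assoc R.m_closed R.l_one
    by (intro moduleI cring_L0) simp_all
  show ?thesis
  proof (rule random_normed_module.intro[OF prob_space_axioms m], unfold_locales)
    show "rnorm (L0_module M) x \<in> L0_nonneg M" if "x \<in> carrier (L0_module M :: ('w, 'k, _) rn_module)" for x
      using that L0_abs_closed[of x M] L0_rep_abs[of x M] by (auto simp: L0_nonneg_iff elim!: eventually_mono)
    show "rnorm (L0_module M) (\<xi> \<odot>\<^bsub>L0_module M\<^esub> x) = L0_abs M \<xi> \<otimes>\<^bsub>L0 M\<^esub> rnorm (L0_module M) x"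
      if "\<xi> \<in> carrier (L0 M)" "x \<in> carrier (L0_module M)" for \<xi> x :: "('w \<Rightarrow> 'k) set"
    proof -
      have x: "\<xi> \<in> L0_set M" "x \<in> L0_set M" using that by simp_all
      note c = L0_abs_closed[OF x(1)] L0_abs_closed[OF x(2)]
      have "L0_abs M (\<xi> \<otimes>\<^bsub>L0 M\<^esub> x) = L0_abs M \<xi> \<otimes>\<^bsub>L0 M\<^esub> L0_abs M x"
      proof (rule L0_eqI)
        show "AE \<omega> in M. L0_rep (L0_abs M (\<xi> \<otimes>\<^bsub>L0 M\<^esub> x)) \<omega> = L0_rep (L0_abs M \<xi> \<otimes>\<^bsub>L0 M\<^esub> L0_abs M x) \<omega>"
          using L0_rep_abs[OF L0_mult_closed[OF x]] L0_rep_mult[OF x] L0_rep_mult[OF c] L0_rep_abs[OF x(1)] L0_rep_abs[OF x(2)]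
          by eventually_elim (simp add: norm_mult)
      qed (intro L0_abs_closed L0_mult_closed x c)+
      then show ?thesis by simp
    qed
    show "L0_le M (rnorm (L0_module M) (x \<oplus>\<^bsub>L0_module M\<^esub> y)) (rnorm (L0_module M) x \<oplus>\<^bsub>L0 M\<^esub> rnorm (L0_module M) y)"
      if "x \<in> carrier (L0_module M)" "y \<in> carrier (L0_module M)" for x y :: "('w \<Rightarrow> 'k) set"
    proof -
      have x: "x \<in> L0_set M" "y \<in> L0_set M" using that by simp_all
      note c = L0_abs_closed[OF x(1)] L0_abs_closed[OF x(2)]
      have "AE \<omega> in M. L0_rep (L0_abs M (x \<oplus>\<^bsub>L0 M\<^esub> y)) \<omega> \<le> L0_rep (L0_abs M x \<oplus>\<^bsub>L0 M\<^esub> L0_abs M y) \<omega>"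
        using L0_rep_abs[OF L0_add_closed[OF x]] L0_rep_add[OF x] L0_rep_add[OF c] L0_rep_abs[OF x(1)] L0_rep_abs[OF x(2)]
        by eventually_elim (simp add: norm_triangle_ineq)
      then show ?thesis by (simp add: L0_le_iff)
    qed
    show "rnorm (L0_module M) x = \<zero>\<^bsub>L0 M\<^esub> \<longleftrightarrow> x = \<zero>\<^bsub>L0_module M\<^esub>"
      if "x \<in> carrier (L0_module M)" for x :: "('w \<Rightarrow> 'k) set"
    proof -
      have x: "x \<in> L0_set M" using that by simp
      have zr: "AE \<omega> in M. L0_rep \<zero>\<^bsub>L0 M\<^esub> \<omega> = (0::real)" and zk: "AE \<omega> in M. L0_rep \<zero>\<^bsub>L0 M\<^esub> \<omega> = (0::'k)"
        by (rule L0_rep_zero)+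
      have "L0_abs M x = \<zero>\<^bsub>L0 M\<^esub> \<longleftrightarrow> x = \<zero>\<^bsub>L0 M\<^esub>"
      proof
        assume "L0_abs M x = \<zero>\<^bsub>L0 M\<^esub>"
        then have "AE \<omega> in M. norm (L0_rep x \<omega>) = 0"
          using L0_rep_abs[OF x] zr by (auto elim: eventually_elim2)
        then show "x = \<zero>\<^bsub>L0 M\<^esub>"
          using zk by (intro L0_eqI[OF x L0_zero_closed], eventually_elim) simp
      next
        assume x0: "x = \<zero>\<^bsub>L0 M\<^esub>"
        show "L0_abs M x = \<zero>\<^bsub>L0 M\<^esub>"
          using L0_rep_abs[OF x] zr zk by (intro L0_eqI[OF L0_abs_closed[OF x] L0_zero_closed], eventually_elim) (simp add: x0)
      qed
      then show ?thesis by simp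
    qed
  qed
qed

text \<open>The constant 1 has norm 1, which already bounds the supremum from below.\<close>

lemma full_support_L0_module:
  assumes "prob_space M"
  shows "full_support M (L0_module M :: ('w, 'k::{real_normed_field, second_countable_topology}, _) rn_module)"
proof -
  let ?E = "L0_module M :: ('w, 'k, _) rn_module"
  let ?S = "(\<lambda>x. L0_map M ereal (rnorm ?E x)) ` carrier ?E"
  have m: "(\<lambda>\<omega>. ereal (L0_rep (L0_abs M x) \<omega>)) \<in> borel_measurable M" if "x \<in> L0_set M" for x :: "('w \<Rightarrow> 'k) set"
    using L0_rep_measurable[OF L0_abs_closed[OF that]] by measurable
  have S: "?S \<subseteq> L0_set M" using m by (auto simp: L0_map_def[of M ereal])
  have one: "\<one>\<^bsub>L0 M\<^esub> \<in> (L0_set M :: ('w \<Rightarrow> 'k) set set)" "AE \<omega> in M. L0_rep \<one>\<^bsub>L0 M\<^esub> \<omega> = (1::'k)"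
    by (rule L0_one_closed L0_rep_one)+
  have "AE \<omega> in M. L0_rep (L0_map M ereal (L0_abs M (\<one>\<^bsub>L0 M\<^esub> :: ('w \<Rightarrow> 'k) set))) \<omega> \<le>
      L0_rep (\<Squnion>\<^bsub>L0_order M\<^esub> ?S) \<omega>"
    using L0_ereal_sup[OF assms S] S one(1)
    by (auto simp: least_def Upper_def L0_order_def image_subset_iff)
  then show ?thesis
    unfolding full_support_def
    using L0_rep_class[OF m[OF one(1)]] L0_rep_abs[OF one(1)] one(2)
    by eventually_elim (auto simp: L0_map_def[of M ereal] intro: less_le_trans[of 0 "ereal 1"])
qed

text \<open>The module has rank one: every functional is the multiple by f 1 of the identity
  functional \<open>i\<close>, so g is determined by its value at \<open>i\<close> and is evaluation
  at the element \<open>g i\<close>.\<close>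

lemma random_reflexive_L0_module:
  assumes "prob_space M"
  shows "random_reflexive M (L0_module M :: ('w, 'k::{real_normed_field, euclidean_space}, _) rn_module)"
proof -
  let ?E = "L0_module M :: ('w, 'k, _) rn_module"
  interpret rn_module_euclidean M ?E
    using random_normed_module_L0_module[OF assms] by (rule rn_module_euclidean.intro)
  interpret R: cring "L0 M :: ('w \<Rightarrow> 'k) set ring" by (rule cring_L0)
  define i where "i = (\<lambda>x\<in>L0_set M. x :: ('w \<Rightarrow> 'k) set)"
  have i: "i \<in> carrier conj_module"
  proof -
    have "L0_class M (\<lambda>_. 1) \<in> dominating_set M ?E i"
    proof (subst dominating_set_iff)
      have r: "AE \<omega> in M. L0_rep (L0_class M (\<lambda>_. 1)) \<omega> = (1::real)" by (simp add: L0_rep_class)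
      have "AE \<omega> in M. norm (L0_rep (i x) \<omega>) \<le> L0_rep (L0_class M (\<lambda>_. 1)) \<omega> * L0_rep (rnorm ?E x) \<omega>"
        if "x \<in> L0_set M" for x
        using r L0_rep_abs[OF that] by eventually_elim (simp add: i_def that)
      then show "L0_class M (\<lambda>_. 1) \<in> L0_set M \<and> (AE \<omega> in M. 0 \<le> L0_rep (L0_class M (\<lambda>_. 1::real)) \<omega>) \<and>
        (\<forall>x\<in>carrier ?E. AE \<omega> in M. norm (L0_rep (i x) \<omega>) \<le> L0_rep (L0_class M (\<lambda>_. 1)) \<omega> * L0_rep (rnorm ?E x) \<omega>)"
        using r by (auto elim!: eventually_mono)
    qed (simp_all add: i_def L0_abs_closed)
    then show ?thesis
      by (auto simp: random_conjugate_carrier_iff i_def L0_add_closed L0_mult_closed)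
  qed
  have f_eq: "f x = x \<otimes>\<^bsub>L0 M\<^esub> f \<one>\<^bsub>L0 M\<^esub>" if "f \<in> carrier conj_module" "x \<in> L0_set M" for f x
  proof -
    have "\<forall>\<xi>\<in>L0_set M. \<forall>x\<in>L0_set M. f (\<xi> \<otimes>\<^bsub>L0 M\<^esub> x) = \<xi> \<otimes>\<^bsub>L0 M\<^esub> f x"
      using that(1) by (simp add: random_conjugate_carrier_iff)
    then have "f (x \<otimes>\<^bsub>L0 M\<^esub> \<one>\<^bsub>L0 M\<^esub>) = x \<otimes>\<^bsub>L0 M\<^esub> f \<one>\<^bsub>L0 M\<^esub>"
      using that(2) L0_one_closed by blast
    then show ?thesis using R.r_one[of x] that(2) by simp
  qed
  have "g \<in> canonical_embedding M ?E ` carrier ?E" if g: "g \<in> carrier biconj_module" for g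
  proof
    have gi: "g i \<in> L0_set M" using biconj_L0[OF g i] .
    then show "g i \<in> carrier ?E" by simp
    have "g f = f (g i)" if f: "f \<in> carrier conj_module" for f
    proof -
      have f1: "f \<one>\<^bsub>L0 M\<^esub> \<in> L0_set M" using conj_L0[OF f] R.one_closed by simp
      have "f = f \<one>\<^bsub>L0 M\<^esub> \<odot>\<^bsub>conj_module\<^esub> i"
      proof
        fix x show "f x = (f \<one>\<^bsub>L0 M\<^esub> \<odot>\<^bsub>conj_module\<^esub> i) x"
          using conj_extensional[OF f] f_eq[OF f, of x] R.m_comm[of x "f \<one>\<^bsub>L0 M\<^esub>"] f1
          by (cases "x \<in> L0_set M") (simp_all add: random_conjugate_def i_def extensional_def)
      qed
      then have "g f = f \<one>\<^bsub>L0 M\<^esub> \<otimes>\<^bsub>L0 M\<^esub> g i" using biconj_smult[OF g f1 i] by simp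
      also have "\<dots> = f (g i)" using f_eq[OF f gi] R.m_comm[of "g i" "f \<one>\<^bsub>L0 M\<^esub>"] f1 gi by simp
      finally show ?thesis .
    qed
    then show "g = canonical_embedding M ?E (g i)"
      unfolding canonical_embedding_def using biconj_extensional[OF g]
      by (intro ext) (auto simp: extensional_def)
  qed
  then show ?thesis
    unfolding random_reflexive_def using canonical_embedding_closed by blast
qed

lemma not_compact_unit_ball_L0_module:
  assumes "prob_space M" "disjoint_family A" "\<And>n::nat. A n \<in> sets M" "\<And>n. measure M (A n) \<noteq> 0"
  shows "\<not> compactin (sigma_c M (L0_module M)) (unit_ball M (L0_module M :: ('w, 'k::{real_normed_field, euclidean_space}, _) rn_module))"
proof
  let ?E = "L0_module M :: ('w, 'k, _) rn_module"
  interpret rn_module_euclidean M ?E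
    using random_normed_module_L0_module[OF assms(1)] by (rule rn_module_euclidean.intro)
  assume "compactin (sigma_c M ?E) (unit_ball M ?E)"
  from compact_unit_ball_no_disjoint_sequence[OF full_support_L0_module[OF assms(1)] this assms(2)]
  show False using assms(3,4) by blast
qed

section \<open>A base space with infinitely many atoms\<close>

text \<open>Positive mass makes each singleton an atom, and over a countable type every set is a
  countable union of singletons; the correcting null set is therefore empty.\<close>

lemma essentially_purely_atomic_measure_pmf:
  fixes p :: "'a::countable pmf"
  assumes "set_pmf p = UNIV"
  shows "essentially_purely_atomic (measure_pmf p)"
proof -
  let ?A = "range (\<lambda>n::'a. {n})"
  have "P_atom (measure_pmf p) {n}" for n
  proof -
    have "0 < pmf p n" using assms by (simp add: pmf_positive)
    moreover have "measure p B = 0 \<or> measure p ({n} - B) = 0" if "B \<subseteq> {n}" for B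
      using that by (cases "n \<in> B") (auto simp: subset_singleton_iff)
    ultimately show ?thesis by (simp add: P_atom_def measure_pmf_single)
  qed
  moreover have "B \<in> P_completion (measure_pmf p) (sigma_sets UNIV ?A)" for B
  proof -
    have "(\<Union>n\<in>B. {n}) \<in> sigma_sets UNIV ?A"
      by (rule sigma_sets_UNION) (auto simp: countable_image)
    then have "B \<in> sigma_sets UNIV ?A" by simp
    then show ?thesis unfolding P_completion_def by (intro CollectI conjI bexI[of _ B] bexI[of _ "{}"]) auto
  qed
  moreover have "disjoint ?A" by (auto simp: disjoint_def)
  ultimately show ?thesis
    unfolding essentially_purely_atomic_def by (intro exI[of _ ?A]) auto
qed

lemma L0_module_counterexample:
  "\<exists>M :: nat measure. essentially_purely_atomic M \<and>
    random_normed_module M (L0_module M :: (nat, 'k::{real_normed_field, euclidean_space}, _) rn_module) \<and>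
    random_reflexive M (L0_module M :: (nat, 'k, _) rn_module) \<and> full_support M (L0_module M :: (nat, 'k, _) rn_module) \<and>
    \<not> compactin (sigma_c M (L0_module M)) (unit_ball M (L0_module M :: (nat, 'k, _) rn_module))"
proof -
  \<comment> \<open>Any distribution that charges every natural number would do: the singletons then
    form an infinite disjoint sequence of nonnull sets.\<close>
  define p :: "nat pmf" where "p = geometric_pmf (1/2)"
  have p: "set_pmf p = UNIV" by (simp add: p_def set_pmf_geometric)
  have ps: "prob_space (measure_pmf p)" by (rule prob_space_measure_pmf)
  have "pmf p n \<noteq> 0" for n using p by (metis UNIV_I set_pmf_iff)
  then have "\<not> compactin (sigma_c (measure_pmf p) (L0_module (measure_pmf p)))
      (unit_ball (measure_pmf p) (L0_module (measure_pmf p) :: (nat, 'k, _) rn_module))"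
    by (intro not_compact_unit_ball_L0_module[OF ps, of "\<lambda>n. {n}"])
      (auto simp: measure_pmf_single disjoint_family_on_def)
  then show ?thesis
    using essentially_purely_atomic_measure_pmf[OF p] random_normed_module_L0_module[OF ps]
      random_reflexive_L0_module[OF ps] full_support_L0_module[OF ps] by blast
qed

text \<open>The scalar field is a type, so the real and the complex case appear as separate
  conjuncts. Each is an instance of the arguments over
  \<open>{real_normed_field, euclidean_space}\<close>, and the converse fails for both
  fields.\<close>

theorem theorem4p18:
  shows "(\<forall>(M :: 'w measure) (E :: ('w, real, 'e) rn_module).
            random_normed_module M E \<and> full_support M E \<and> compactin (sigma_c M E) (unit_ball M E)
              \<longrightarrow> random_reflexive M E \<and> essentially_purely_atomic M) \<and>
         (\<forall>(M :: 'w measure) (E :: ('w, complex, 'e) rn_module).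
            random_normed_module M E \<and> full_support M E \<and> compactin (sigma_c M E) (unit_ball M E)
              \<longrightarrow> random_reflexive M E \<and> essentially_purely_atomic M) \<and>
         (\<exists>(M :: nat measure) (E :: (nat, real, (nat \<Rightarrow> real) set) rn_module).
            essentially_purely_atomic M \<and> random_normed_module M E \<and> random_reflexive M E \<and>
            full_support M E \<and> \<not> compactin (sigma_c M E) (unit_ball M E)) \<and>
         (\<exists>(M :: nat measure) (E :: (nat, complex, (nat \<Rightarrow> complex) set) rn_module).
            essentially_purely_atomic M \<and> random_normed_module M E \<and> random_reflexive M E \<and>
            full_support M E \<and> \<not> compactin (sigma_c M E) (unit_ball M E))"
proof (intro conjI allI impI)
  fix M :: "'w measure" and E :: "('w, real, 'e) rn_module"
  assume *: "random_normed_module M E \<and> full_support M E \<and> compactin (sigma_c M E) (unit_ball M E)"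
  then have "random_normed_module M E" by (elim conjE)
  then interpret rn_module_euclidean M E by (rule rn_module_euclidean.intro)
  show "random_reflexive M E" "essentially_purely_atomic M"
    using compact_unit_ball_imp_reflexive_atomic * by blast+
next
  fix M :: "'w measure" and E :: "('w, complex, 'e) rn_module"
  assume *: "random_normed_module M E \<and> full_support M E \<and> compactin (sigma_c M E) (unit_ball M E)"
  then have "random_normed_module M E" by (elim conjE)
  then interpret rn_module_euclidean M E by (rule rn_module_euclidean.intro)
  show "random_reflexive M E" "essentially_purely_atomic M"
    using compact_unit_ball_imp_reflexive_atomic * by blast+
next
  show "\<exists>(M :: nat measure) (E :: (nat, real, (nat \<Rightarrow> real) set) rn_module).
      essentially_purely_atomic M \<and> random_normed_module M E \<and> random_reflexive M E \<and>
      full_support M E \<and> \<not> compactin (sigma_c M E) (unit_ball M E)"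
    using L0_module_counterexample[where 'k = real] by (elim exE) (intro exI)
  show "\<exists>(M :: nat measure) (E :: (nat, complex, (nat \<Rightarrow> complex) set) rn_module).
      essentially_purely_atomic M \<and> random_normed_module M E \<and> random_reflexive M E \<and>
      full_support M E \<and> \<not> compactin (sigma_c M E) (unit_ball M E)"
    using L0_module_counterexample[where 'k = complex] by (elim exE) (intro exI)
qed

end
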